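(* (i) Let $m\ge1$ be an integer and let $\mu$ be a finite signed normalized directional rule on $\mathbb S^{d-1}$. Then $$\int\mathcal B_{2m}K\,d\mu=\int\mathcal B_{2m}K\,d\sigma\qquad\text{for all }K\in\mathcal K^d_\circ$$ holds if and only if $$\int Y\,d\mu=0\qquad\text{for all }Y\in\mathcal H_{2r},\ 1\le r\le m.$$ Equivalently, the antipodal symmetrization $\frac12(\mu+(-\mathrm{Id})_\#\mu)$ of $\mu$ is a weighted real projective $m$-design. (ii) If $p>0$ is a real number that is not an even integer, then there is no finite signed normalized directional rule $\mu$ on $\mathbb S^{d-1}$ such that $\int\mathcal B_pK\,d\mu=\int\mathcal B_pK\,d\sigma$ for all $K\in\mathcal K^d_\circ$.
   Context: Fix an integer $d\ge 2$. $\sigma$ is the normalized rotation-invariant Borel probability measure on the unit sphere $\mathbb S^{d-1}\subset\mathbb R^d$. $\mathcal K^d_\circ$ is the set of convex bodies (compact convex sets) in $\mathbb R^d$ with nonempty interior. For $K\in\mathcal K^d_\circ$, the surface area measure $S_K$ on $\mathbb S^{d-1}$ is the pushforward of $(d-1)$-dimensional Hausdorff measure on $\partial K$ under the ($\mathcal H^{d-1}$-a.e. defined) outer Gauss map. For real $p>0$, $$\mathcal B_pK(u):=\frac12\int_{\mathbb S^{d-1}}|\langle u,v\rangle|^p\,dS_K(v),\qquad u\in\mathbb S^{d-1}.$$ A finite signed normalized directional rule is a finite atomic signed measure $\mu=\sum_{j=1}^Nw_j\delta_{x_j}$ with $x_j\in\mathbb S^{d-1}$, $w_j\in\mathbb R$,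 $\sum_jw_j=1$. $\mathcal H_\ell$ denotes the space of restrictions to $\mathbb S^{d-1}$ of real homogeneous harmonic polynomials of degree $\ell$ on $\mathbb R^d$. $(-\mathrm{Id})_\#\mu$ is the pushforward of $\mu$ under $u\mapsto-u$. A (real-weighted) normalized finite atomic measure $\nu$ on $\mathbb S^{d-1}$ is a weighted real projective $m$-design if it integrates exactly the functions of projective degree at most $m$ on $\mathbb{RP}^{d-1}=\mathbb S^{d-1}/\{\pm1\}$, which pull back to the even spherical polynomials of degree at most $2m$; that is, $\int Y\,d\nu=0$ for all $Y\in\mathcal H_2\cup\mathcal H_4\cup\cdots\cup\mathcal H_{2m}$. *)

theory Defs
  imports "HOL-Probability.Probability" "HOL-Library.Poly_Mapping"
begin

text \<open>
  The ambient space is \<open>real^'n\<close>, with \<open>d = CARD('n)\<close>.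
\<close>

section \<open>The uniform measure on the sphere\<close>

definition uniform_sphere_measure :: "(real^'n) measure \<Rightarrow> bool" where
  "uniform_sphere_measure \<sigma> \<longleftrightarrow>
     prob_space \<sigma> \<and>
     sets \<sigma> = sets (restrict_space borel (sphere 0 1)) \<and>
     (\<forall>f. orthogonal_transformation f \<and> det (matrix f) = 1 \<longrightarrow> distr \<sigma> \<sigma> f = \<sigma>)"

section \<open>Surface area measures of convex bodies\<close>

text \<open>
  Hausdorff measure of integer dimension \<open>s\<close>, with the factor that makes it agree with Lebesgue
  measure on \<open>s\<close>-dimensional subspaces. Boundedness of the covering sets is required explicitly
  because \<open>diameter\<close> is unspecified on unbounded sets.
\<close>

definition hausdorff_outer_measure :: "nat \<Rightarrow> 'a::metric_space set \<Rightarrow> ennreal" where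
  "hausdorff_outer_measure s A =
     (SUP \<delta>\<in>{0<..}.
        INF U\<in>{U :: nat \<Rightarrow> 'a set. A \<subseteq> (\<Union>i. U i) \<and> (\<forall>i. bounded (U i) \<and> diameter (U i) \<le> \<delta>)}.
          suminf (\<lambda>i. if U i = {} then 0
                else ennreal (unit_ball_vol (real s) * (diameter (U i) / 2) ^ s)))"

text \<open>
  The outer measure is additive on Borel sets (Caratheodory's criterion), so \<open>measure_of\<close> does not
  fall back to the zero measure here.
\<close>

definition hausdorff_measure :: "nat \<Rightarrow> 'a::metric_space measure" where
  "hausdorff_measure s = measure_of UNIV (sets borel) (hausdorff_outer_measure s)"

definition convex_body :: "(real^'n) set \<Rightarrow> bool" where
  "convex_body K \<longleftrightarrow> compact K \<and> convex K \<and> interior K \<noteq> {}"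

definition outer_unit_normals :: "(real^'n) set \<Rightarrow> real^'n \<Rightarrow> (real^'n) set" where
  "outer_unit_normals K x = {u \<in> sphere 0 1. \<forall>y\<in>K. u \<bullet> (y - x) \<le> 0}"

text \<open>
  The Gauss map is defined at the boundary points having exactly one outer unit normal. For a
  convex body, the remaining boundary points form a \<open>(d - 1)\<close>-dimensional null set.
\<close>

definition regular_boundary :: "(real^'n) set \<Rightarrow> (real^'n) set" where
  "regular_boundary K = {x \<in> frontier K. \<exists>!u. u \<in> outer_unit_normals K x}"

definition gauss_map :: "(real^'n) set \<Rightarrow> real^'n \<Rightarrow> real^'n" where
  "gauss_map K x = (THE u. u \<in> outer_unit_normals K x)"

definition surface_area_measure :: "(real^'n) set \<Rightarrow> (real^'n) measure" where
  "surface_area_measure K =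
     distr (restrict_space (hausdorff_measure (CARD('n) - 1)) (regular_boundary K))
       (restrict_space borel (sphere 0 1)) (gauss_map K)"

definition B_body :: "real \<Rightarrow> (real^'n) set \<Rightarrow> real^'n \<Rightarrow> real" where
  "B_body p K u = (1/2) * (\<integral>v. \<bar>u \<bullet> v\<bar> powr p \<partial>surface_area_measure K)"

section \<open>Finite atomic signed measures\<close>

text \<open>
  A finite atomic signed measure is represented by its finitely supported function of point masses,
  so that \<open>Poly_Mapping.single x w\<close> is \<open>w\<close> times the Dirac measure at \<open>x\<close>.
\<close>

type_synonym 'a atomic_measure = "'a \<Rightarrow>\<^sub>0 real"

definition atomic_integral :: "'a atomic_measure \<Rightarrow> ('a \<Rightarrow> real) \<Rightarrow> real" where
  "atomic_integral \<mu> f = (\<Sum>x\<in>Poly_Mapping.keys \<mu>. Poly_Mapping.lookup \<mu> x * f x)"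

definition atomic_pushforward ::
    "('a \<Rightarrow> 'b) \<Rightarrow> 'a atomic_measure \<Rightarrow> 'b atomic_measure" where
  "atomic_pushforward T \<mu> =
     (\<Sum>x\<in>Poly_Mapping.keys \<mu>. Poly_Mapping.single (T x) (Poly_Mapping.lookup \<mu> x))"

definition directional_rule :: "(real^'n) atomic_measure \<Rightarrow> bool" where
  "directional_rule \<mu> \<longleftrightarrow>
     (\<exists>(N::nat) x w. (\<forall>j\<in>{1..N}. x j \<in> sphere 0 1) \<and> (\<Sum>j=1..N. w j) = 1 \<and>
        \<mu> = (\<Sum>j=1..N. Poly_Mapping.single (x j) (w j)))"

definition antipodal_symmetrization :: "(real^'n) atomic_measure \<Rightarrow> (real^'n) atomic_measure" where
  "antipodal_symmetrization \<mu> =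
     Poly_Mapping.map (\<lambda>w. (1/2) * w) (\<mu> + atomic_pushforward uminus \<mu>)"

section \<open>Spherical harmonics and projective designs\<close>

definition laplacian :: "(real^'n \<Rightarrow> real) \<Rightarrow> real^'n \<Rightarrow> real" where
  "laplacian P x = (\<Sum>i\<in>UNIV. (deriv ^^ 2) (\<lambda>t. P (x + t *\<^sub>R axis i 1)) 0)"

definition homogeneous_polynomial :: "nat \<Rightarrow> (real^'n \<Rightarrow> real) \<Rightarrow> bool" where
  "homogeneous_polynomial l P \<longleftrightarrow>
     real_polynomial_function P \<and> (\<forall>c x. P (c *\<^sub>R x) = c ^ l * P x)"

definition spherical_harmonics :: "nat \<Rightarrow> (real^'n \<Rightarrow> real) set" where
  "spherical_harmonics l =
     {restrict P (sphere 0 1) | P. homogeneous_polynomial l P \<and> (\<forall>x. laplacian P x = 0)}"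

text \<open>Polynomials of degree at most \<open>k\<close> are written as sums of homogeneous ones.\<close>

definition spherical_polynomials :: "nat \<Rightarrow> (real^'n \<Rightarrow> real) set" where
  "spherical_polynomials k =
     {restrict (\<lambda>x. \<Sum>i\<le>k. Q i x) (sphere 0 1) | Q. \<forall>i\<le>k. homogeneous_polynomial i (Q i)}"

definition even_spherical_polynomials :: "nat \<Rightarrow> (real^'n \<Rightarrow> real) set" where
  "even_spherical_polynomials k = {f \<in> spherical_polynomials k. \<forall>x\<in>sphere 0 1. f (- x) = f x}"

text \<open>
  Functions of projective degree at most \<open>m\<close> on projective space are given by their pullbacks to
  the sphere, the even spherical polynomials of degree at most \<open>2 * m\<close>; a design integrates them
  exactly, that is, with the same result as the uniform measure \<open>\<sigma>\<close>.
\<close>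

definition weighted_projective_design ::
    "(real^'n) measure \<Rightarrow> nat \<Rightarrow> (real^'n) atomic_measure \<Rightarrow> bool" where
  "weighted_projective_design \<sigma> m \<nu> \<longleftrightarrow>
     directional_rule \<nu> \<and>
     (\<forall>f\<in>even_spherical_polynomials (2 * m). atomic_integral \<nu> f = (\<integral>u. f u \<partial>\<sigma>))"

end

theory Submission
  imports Defs
begin

text \<open>
  By Fubini, the quadrature identity for a body \<open>K\<close> says that the even continuous function
  \<open>F v = atomic_integral \<mu> (\<lambda>u. \<bar>u \<bullet> v\<bar> powr p) - c\<close>, with \<open>c\<close> the mean of \<open>\<bar>u \<bullet> v\<bar> powr p\<close> over the
  sphere, has integral zero against the surface area measure of \<open>K\<close>. Thin rotated slabs, whose
  surface area measures concentrate at \<open>\<plusminus>v\<close>, show that this holds for all \<open>K\<close> only if \<open>F = 0\<close>.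

  For \<open>p = 2 * m\<close> the equation \<open>F = 0\<close> is the quadrature identity for the powers \<open>(u \<bullet> v) ^ (2 * m)\<close>,
  which span the homogeneous polynomials of degree \<open>2 * m\<close>. Conversely these powers are
  combinations of zonal harmonics of degrees \<open>0, 2, \<dots>, 2 * m\<close>. If \<open>p\<close> is not an even integer,
  then \<open>F = 0\<close> fails because \<open>\<bar>u \<bullet> v\<bar> powr p\<close> is not smooth in \<open>v\<close> on the hyperplane orthogonal to \<open>u\<close>.
\<close>

section \<open>Hausdorff measure as a Borel measure\<close>

text \<open>No exact area is ever computed. Surface area is defined through Hausdorff measure, so
  the argument is arranged to need only crude facts: Borel sets are measurable, a cube face has
  positive finite measure, a convex boundary has finite measure, and the sides of a slab of
  thickness 1/(2M) have measure O(1/M). A slab has two opposite large faces and thus tests only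
  \<open>F v + F (- v)\<close>, which is where evenness of \<open>F\<close> enters. The single
  exponent \<open>2 * m\<close> controls all lower even degrees because factors
  \<open>x \<bullet> x\<close> are invisible on the sphere: every even polynomial of degree at most
  \<open>2 * m\<close> has there a homogeneous representative of degree \<open>2 * m\<close>. For
  other exponents the constant \<open>c\<close> does not drop out. Extending the identity
  p-homogeneously along \<open>v + t *\<^sub>R x\<close> turns it into
  \<open>c * (1 + t\<^sup>2) powr (p / 2)\<close>, which is smooth at 0 and hence harmless. Odd
  integers \<open>p\<close> are the delicate case: \<open>\<bar>t\<bar> powr p\<close> is polynomial
  on either side of 0, so both sides have to be used together.\<close>

definition hausdorff_weight :: "nat \<Rightarrow> 'a::metric_space set \<Rightarrow> ennreal" where
  "hausdorff_weight s U = (if U = {} then 0 else ennreal (unit_ball_vol (real s) * (diameter U / 2) ^ s))"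

definition hausdorff_covers :: "real \<Rightarrow> 'a::metric_space set \<Rightarrow> (nat \<Rightarrow> 'a set) set" where
  "hausdorff_covers \<delta> A = {U. A \<subseteq> (\<Union>i. U i) \<and> (\<forall>i. bounded (U i) \<and> diameter (U i) \<le> \<delta>)}"

definition hausdorff_content :: "nat \<Rightarrow> real \<Rightarrow> 'a::metric_space set \<Rightarrow> ennreal" where
  "hausdorff_content s \<delta> A = (INF U\<in>hausdorff_covers \<delta> A. suminf (\<lambda>i. hausdorff_weight s (U i)))"

lemma hausdorff_outer_measure_eq:
  "hausdorff_outer_measure s A = (SUP \<delta>\<in>{0<..}. hausdorff_content s \<delta> A)"
  by (simp add: hausdorff_outer_measure_def hausdorff_content_def hausdorff_covers_def
      hausdorff_weight_def)

lemma hausdorff_weight_empty [simp]: "hausdorff_weight s {} = 0"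
  by (simp add: hausdorff_weight_def)

lemma hausdorff_content_empty: "\<delta> \<ge> 0 \<Longrightarrow> hausdorff_content s \<delta> {} = 0"
proof -
  assume "\<delta> \<ge> 0"
  then have "(\<lambda>_. {}) \<in> hausdorff_covers \<delta> {}"
    by (simp add: hausdorff_covers_def)
  then have "hausdorff_content s \<delta> {} \<le> 0"
    unfolding hausdorff_content_def by (rule INF_lower2) simp
  then show ?thesis by simp
qed

lemma hausdorff_content_mono: "A \<subseteq> B \<Longrightarrow> hausdorff_content s \<delta> A \<le> hausdorff_content s \<delta> B"
  unfolding hausdorff_content_def
  by (rule INF_superset_mono) (auto simp: hausdorff_covers_def)

lemma hausdorff_content_antimono: "\<delta> \<le> \<epsilon> \<Longrightarrow> hausdorff_content s \<epsilon> A \<le> hausdorff_content s \<delta> A"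
  unfolding hausdorff_content_def
  by (rule INF_superset_mono) (auto simp: hausdorff_covers_def intro: order_trans)

lemma hausdorff_content_le_outer: "\<delta> > 0 \<Longrightarrow> hausdorff_content s \<delta> A \<le> hausdorff_outer_measure s A"
  unfolding hausdorff_outer_measure_eq by (rule SUP_upper) simp

text \<open>Near-optimal covers of the sets \<open>A i\<close>, with slacks
  \<open>e * (1/2)^Suc i\<close> of total \<open>e\<close>, are merged into a single sequence by
  \<open>prod_decode\<close>.\<close>

lemma hausdorff_content_UN_le:
  "hausdorff_content s \<delta> (\<Union>i. A i) \<le> suminf (\<lambda>i::nat. hausdorff_content s \<delta> (A i))"
proof (rule ennreal_le_epsilon)
  fix e :: real assume e: "e > 0" and fin: "suminf (\<lambda>i. hausdorff_content s \<delta> (A i)) < top"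
  have "\<exists>U\<in>hausdorff_covers \<delta> (A i).
      (suminf (\<lambda>j. hausdorff_weight s (U j))) \<le> hausdorff_content s \<delta> (A i) + e * (1/2)^Suc i" for i
  proof -
    have "hausdorff_content s \<delta> (A i) < top"
      using fin by (metis ennreal_suminf_lessD)
    then have "hausdorff_content s \<delta> (A i) < hausdorff_content s \<delta> (A i) + e * (1/2)^Suc i"
      using e by (auto simp: less_top[symmetric] ennreal_add_left_cancel_less)
    then show ?thesis
      unfolding hausdorff_content_def INF_less_iff by (meson less_imp_le)
  qed
  then obtain U where U: "\<And>i. U i \<in> hausdorff_covers \<delta> (A i)"
    and le: "\<And>i. (suminf (\<lambda>j. hausdorff_weight s (U i j))) \<le> hausdorff_content s \<delta> (A i) + e * (1/2)^Suc i"
    by metis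
  define V where "V = (\<lambda>n. case_prod U (prod_decode n))"
  have "V \<in> hausdorff_covers \<delta> (\<Union>i. A i)"
  proof -
    have "\<exists>n. x \<in> V n" if "x \<in> A i" for x i
    proof -
      have "x \<in> (\<Union>j. U i j)"
        using U[of i] that unfolding hausdorff_covers_def by blast
      then obtain j where "x \<in> U i j" by blast
      then have "x \<in> V (prod_encode (i, j))" by (simp add: V_def)
      then show ?thesis ..
    qed
    then show ?thesis
      using U by (auto simp: hausdorff_covers_def V_def split: prod.split)
  qed
  then have "hausdorff_content s \<delta> (\<Union>i. A i) \<le> suminf (\<lambda>n. hausdorff_weight s (V n))"
    unfolding hausdorff_content_def by (rule INF_lower)
  also have "\<dots> = suminf (\<lambda>i. suminf (\<lambda>j. hausdorff_weight s (U i j)))"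
    unfolding V_def using suminf_ennreal_2dimen[of "\<lambda>i. suminf (\<lambda>j. hausdorff_weight s (U i j))" "\<lambda>p. hausdorff_weight s (case_prod U p)"]
    by simp
  also have "\<dots> \<le> suminf (\<lambda>i. hausdorff_content s \<delta> (A i) + e * (1/2)^Suc i)"
    by (intro suminf_le le) auto
  also have "\<dots> = suminf (\<lambda>i. hausdorff_content s \<delta> (A i)) + suminf (\<lambda>i. ennreal (e * (1/2)^Suc i))"
    by (intro suminf_add[symmetric]) auto
  also have "suminf (\<lambda>i. ennreal (e * (1/2)^Suc i)) = ennreal (suminf (\<lambda>i. e * (1/2)^Suc i))"
    using e by (intro suminf_ennreal2 summable_mult)
      (auto intro: sums_summable power_half_series)
  also have "suminf (\<lambda>i. e * (1/2)^Suc i) = e"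
    using sums_mult[OF power_half_series, of e] by (simp add: sums_iff)
  finally show "hausdorff_content s \<delta> (\<Union>i. A i) \<le> suminf (\<lambda>i. hausdorff_content s \<delta> (A i)) + ennreal e" .
qed

lemma hausdorff_outer_measure_UN_le:
  "hausdorff_outer_measure s (\<Union>i. A i) \<le> suminf (\<lambda>i::nat. hausdorff_outer_measure s (A i))"
proof -
  have "hausdorff_content s \<delta> (\<Union>i. A i) \<le> suminf (\<lambda>i. hausdorff_outer_measure s (A i))" if "\<delta> > 0" for \<delta>
  proof -
    have "suminf (\<lambda>i. hausdorff_content s \<delta> (A i)) \<le> suminf (\<lambda>i. hausdorff_outer_measure s (A i))"
      using that by (intro suminf_le hausdorff_content_le_outer) auto
    then show ?thesis using hausdorff_content_UN_le order_trans by blast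
  qed
  then show ?thesis
    by (subst hausdorff_outer_measure_eq) (rule SUP_least, simp)
qed

lemma outer_measure_space_hausdorff:
  "outer_measure_space UNIV (hausdorff_outer_measure s)"
proof -
  have "hausdorff_outer_measure s {} = 0"
    by (simp add: hausdorff_outer_measure_eq hausdorff_content_empty)
  moreover have "hausdorff_outer_measure s A \<le> hausdorff_outer_measure s B" if "A \<subseteq> B" for A B :: "'a set"
    unfolding hausdorff_outer_measure_eq
    by (intro SUP_mono) (use that hausdorff_content_mono in blast)
  ultimately show ?thesis
    using hausdorff_outer_measure_UN_le
    by (auto simp: outer_measure_space_def positive_def increasing_def countably_subadditive_def)
qed

lemma hausdorff_outer_measure_empty [simp]: "hausdorff_outer_measure s {} = 0"
  and hausdorff_outer_measure_mono:
    "A \<subseteq> B \<Longrightarrow> hausdorff_outer_measure s A \<le> hausdorff_outer_measure s B"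
  using outer_measure_space_hausdorff[of s]
  by (auto simp: outer_measure_space_def positive_def increasing_def)

lemma hausdorff_outer_measure_Un_le:
  "hausdorff_outer_measure s (A \<union> B) \<le> hausdorff_outer_measure s A + hausdorff_outer_measure s B"
proof -
  have "A \<union> B = (\<Union>i::nat. if i = 0 then A else if i = 1 then B else {})"
    by (auto split: if_splits)
  also have "hausdorff_outer_measure s \<dots>
      \<le> suminf (\<lambda>i::nat. hausdorff_outer_measure s (if i = 0 then A else if i = 1 then B else {}))"
    by (rule hausdorff_outer_measure_UN_le)
  also have "\<dots> = (\<Sum>i\<in>{0, 1::nat}. hausdorff_outer_measure s (if i = 0 then A else if i = 1 then B else {}))"
    by (intro suminf_finite) auto
  finally show ?thesis by simp
qed

text \<open>A covering set of diameter below \<open>\<epsilon>\<close> cannot meet both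
  \<open>A\<close> and \<open>B\<close>, so every fine cover of the union splits into a cover of
  \<open>A\<close> and a cover of \<open>B\<close> without sharing weight.\<close>

lemma hausdorff_outer_measure_separated:
  assumes "\<epsilon> > 0" and sep: "\<And>a b. a \<in> A \<Longrightarrow> b \<in> B \<Longrightarrow> dist a b \<ge> \<epsilon>"
  shows "hausdorff_outer_measure s A + hausdorff_outer_measure s B \<le> hausdorff_outer_measure s (A \<union> B)"
proof -
  have content: "hausdorff_content s \<delta> A + hausdorff_content s \<delta> B \<le> hausdorff_content s \<delta> (A \<union> B)"
    if "\<delta> < \<epsilon>" for \<delta>
  proof -
    have "hausdorff_content s \<delta> A + hausdorff_content s \<delta> B \<le> suminf (\<lambda>i. hausdorff_weight s (U i))"
      if U: "U \<in> hausdorff_covers \<delta> (A \<union> B)" for U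
    proof -
      define V where "V = (\<lambda>i. if U i \<inter> A \<noteq> {} then U i else {})"
      define W where "W = (\<lambda>i. if U i \<inter> B \<noteq> {} then U i else {})"
      have "diameter (U 0) \<le> \<delta>" "bounded (U 0)" using U by (auto simp: hausdorff_covers_def)
      then have "\<delta> \<ge> 0" using diameter_ge_0 by (meson order_trans)
      then have V: "V \<in> hausdorff_covers \<delta> A" and W: "W \<in> hausdorff_covers \<delta> B"
        using U by (auto simp: hausdorff_covers_def V_def W_def) blast+
      have "hausdorff_weight s (V i) + hausdorff_weight s (W i) \<le> hausdorff_weight s (U i)" for i
      proof -
        have False if a: "a \<in> U i" "a \<in> A" and b: "b \<in> U i" "b \<in> B" for a b
        proof -
          have "dist a b \<le> \<delta>"
            using diameter_bounded_bound[of "U i" a b] U a b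
            by (auto simp: hausdorff_covers_def intro: order_trans)
          then show False using sep[OF a(2) b(2)] \<open>\<delta> < \<epsilon>\<close> by linarith
        qed
        then show ?thesis by (auto simp: V_def W_def)
      qed
      then have "suminf (\<lambda>i. hausdorff_weight s (V i) + hausdorff_weight s (W i)) \<le> suminf (\<lambda>i. hausdorff_weight s (U i))"
        by (intro suminf_le) auto
      moreover have "suminf (\<lambda>i. hausdorff_weight s (V i) + hausdorff_weight s (W i))
         = suminf (\<lambda>i. hausdorff_weight s (V i)) + suminf (\<lambda>i. hausdorff_weight s (W i))"
        by (intro suminf_add[symmetric]) auto
      moreover have "hausdorff_content s \<delta> A \<le> suminf (\<lambda>i. hausdorff_weight s (V i))"
        unfolding hausdorff_content_def using V by (rule INF_lower)
      moreover have "hausdorff_content s \<delta> B \<le> suminf (\<lambda>i. hausdorff_weight s (W i))"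
        unfolding hausdorff_content_def using W by (rule INF_lower)
      ultimately show ?thesis by (metis add_mono order_trans)
    qed
    then show ?thesis
      by (subst (3) hausdorff_content_def) (rule INF_greatest)
  qed
  \<comment> \<open>Content grows as the scale shrinks, so the smaller of two scales dominates both
    terms and the two suprema can be taken jointly.\<close>
  have "hausdorff_outer_measure s A + hausdorff_outer_measure s B
      = (SUP \<delta>\<in>{0<..}. hausdorff_content s \<delta> A + hausdorff_content s \<delta> B)"
    unfolding hausdorff_outer_measure_eq
  proof (rule SUP_add_directed_ennreal[symmetric])
    fix i j :: real assume "i \<in> {0<..}" "j \<in> {0<..}"
    then show "\<exists>k\<in>{0<..}. hausdorff_content s i A + hausdorff_content s j B
        \<le> hausdorff_content s k A + hausdorff_content s k B"
      by (intro bexI[of _ "min i j"] add_mono hausdorff_content_antimono) auto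
  qed
  also have "\<dots> \<le> hausdorff_outer_measure s (A \<union> B)"
  proof (rule SUP_least)
    fix \<delta> :: real assume "\<delta> \<in> {0<..}"
    define \<eta> where "\<eta> = min \<delta> (\<epsilon>/2)"
    have \<eta>: "\<eta> > 0" "\<eta> < \<epsilon>" "\<eta> \<le> \<delta>" using \<open>\<delta> \<in> _\<close> \<open>\<epsilon> > 0\<close> by (auto simp: \<eta>_def)
    have "hausdorff_content s \<delta> A + hausdorff_content s \<delta> B
        \<le> hausdorff_content s \<eta> A + hausdorff_content s \<eta> B"
      by (intro add_mono hausdorff_content_antimono \<eta>)
    also have "\<dots> \<le> hausdorff_content s \<eta> (A \<union> B)" by (rule content[OF \<eta>(2)])
    also have "\<dots> \<le> hausdorff_outer_measure s (A \<union> B)" by (rule hausdorff_content_le_outer[OF \<eta>(1)])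
    finally show "hausdorff_content s \<delta> A + hausdorff_content s \<delta> B \<le> \<dots>" .
  qed
  finally show ?thesis .
qed

lemma infdist_separated:
  assumes "infdist x F \<ge> a" "infdist y F \<le> b"
  shows "dist x y \<ge> a - b"
  using assms infdist_triangle[of x F y] by linarith

text \<open>
  The annuli \<open>R k\<close> of even index are pairwise separated, and so are those of odd index; this makes
  the series of their measures converge, so that the part of \<open>A\<close> close to \<open>F\<close> is negligible.
\<close>

lemma hausdorff_caratheodory_closed:
  assumes "closed F" "F \<noteq> {}"
  shows "hausdorff_outer_measure s (A \<inter> F) + hausdorff_outer_measure s (A - F) \<le> hausdorff_outer_measure s A"
proof (cases "hausdorff_outer_measure s A = top")
  case False
  let ?H = "hausdorff_outer_measure s"
  define R where "R = (\<lambda>k::nat. {x \<in> A. 1 / (real k + 2) \<le> infdist x F \<and> infdist x F < 1 / (real k + 1)})"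
  define A' where "A' = (\<lambda>n::nat. {x \<in> A. 1 / (real n + 1) \<le> infdist x F})"
  have alt: "(\<Sum>k<N. ?H (R (2 * k + j))) \<le> ?H A" for N j
  proof -
    have "(\<Sum>k<N. ?H (R (2 * k + j))) \<le> ?H (\<Union>k<N. R (2 * k + j))"
    proof (induction N)
      case (Suc N)
      have "(\<Sum>k<Suc N. ?H (R (2 * k + j))) \<le> ?H (\<Union>k<N. R (2 * k + j)) + ?H (R (2 * N + j))"
        using Suc by (simp add: add_mono)
      also have "\<dots> \<le> ?H ((\<Union>k<N. R (2 * k + j)) \<union> R (2 * N + j))"
      \<comment> \<open>The gap used below is the width of the ring of index
        \<open>2 * N + j - 1\<close>, which separates the new ring from all earlier ones. For
        \<open>N = 0\<close> there are no earlier rings, and the formula for the gap would divide by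
        0 at \<open>j = 0\<close>.\<close>
      proof (cases "N = 0")
        case N: False
        show ?thesis
        proof (rule hausdorff_outer_measure_separated)
          show "1 / real (2 * N + j) - 1 / real (2 * N + j + 1) > 0"
          proof -
            have "1 / real (2 * N + j + 1) < 1 / real (2 * N + j)"
              using N by (intro divide_strict_left_mono) auto
            then show ?thesis by simp
          qed
          fix x y assume "x \<in> (\<Union>k<N. R (2 * k + j))" "y \<in> R (2 * N + j)"
          then obtain k where k: "k < N" "1 / (real (2 * k + j) + 2) \<le> infdist x F"
            and y: "infdist y F < 1 / (real (2 * N + j) + 1)"
            by (auto simp: R_def)
          have "1 / real (2 * N + j) \<le> 1 / (real (2 * k + j) + 2)"
            using k(1) by (intro divide_left_mono) auto
          then show "1 / real (2 * N + j) - 1 / real (2 * N + j + 1) \<le> dist x y"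
            using k(2) y by (intro infdist_separated[of _ _ F]) (auto simp: add_ac)
        qed
      qed simp
      also have "(\<Union>k<N. R (2 * k + j)) \<union> R (2 * N + j) = (\<Union>k<Suc N. R (2 * k + j))"
        by (auto simp: lessThan_Suc)
      finally show ?case .
    qed simp
    also have "\<dots> \<le> ?H A" by (intro hausdorff_outer_measure_mono) (auto simp: R_def)
    finally show ?thesis .
  qed
  have "(\<Sum>k<N. ?H (R k)) \<le> 2 * ?H A" for N
  proof -
    have "(\<Sum>k<N. ?H (R k)) \<le> (\<Sum>k<2 * N. ?H (R k))"
      by (intro sum_mono2) auto
    also have "\<dots> = (\<Sum>k<N. ?H (R (2 * k + 0))) + (\<Sum>k<N. ?H (R (2 * k + 1)))"
      by (induction N) (auto simp: algebra_simps)
    also have "\<dots> \<le> ?H A + ?H A"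
      by (intro add_mono alt)
    also have "\<dots> = 2 * ?H A" by (simp add: mult_2)
    finally show ?thesis .
  qed
  then have "suminf (\<lambda>k. ?H (R k)) \<le> 2 * ?H A"
    by (intro suminf_le_const) auto
  then have sumfin: "suminf (\<lambda>k. ?H (R k)) < top"
    by (rule order_le_less_trans) (use False in \<open>simp add: mult_2 less_top[symmetric]\<close>)
  define g where "g = (\<lambda>k. enn2real (?H (R k)))"
  have g: "?H (R k) = ennreal (g k)" for k
    using sumfin by (metis ennreal_enn2real ennreal_suminf_lessD g_def)
  have g0: "g k \<ge> 0" for k by (simp add: g_def)
  have "summable g"
    using sumfin g0 by (auto simp: g intro!: summable_suminf_not_top)
  show ?thesis
  proof (rule ennreal_le_epsilon)
    fix e :: real assume "e > 0"
    \<comment> \<open>The rings from index \<open>n\<close> on fill the space between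
      \<open>A' n\<close> and \<open>F\<close>; their total measure is below
      \<open>e\<close>.\<close>
    obtain n where n: "norm (suminf (\<lambda>i. g (i + n))) < e"
      using suminf_exist_split[OF \<open>e > 0\<close> \<open>summable g\<close>] by blast
    have "A - F \<subseteq> A' n \<union> (\<Union>i. R (i + n))"
    proof
      fix x assume x: "x \<in> A - F"
      then have pos: "infdist x F > 0"
        using assms by (meson DiffD2 infdist_pos_not_in_closed)
      show "x \<in> A' n \<union> (\<Union>i. R (i + n))"
      proof (cases "1 / (real n + 1) \<le> infdist x F")
        case False
        define P where "P = (\<lambda>k::nat. 1 / (real k + 1) \<le> infdist x F)"
        obtain m where m: "inverse (real (Suc m)) < infdist x F"
          using reals_Archimedean[OF pos] by blast
        have "P m" using m by (simp add: P_def inverse_eq_divide add_ac)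
        \<comment> \<open>The first threshold that \<open>x\<close> clears; since the previous one
          is not cleared, \<open>x\<close> lies in the ring of index \<open>k - 1\<close>.\<close>
        define k where "k = (LEAST k. P k)"
        have k: "P k" "\<And>j. j < k \<Longrightarrow> \<not> P j"
          unfolding k_def using \<open>P m\<close> by (auto intro: LeastI dest: not_less_Least)
        have "k > n"
        proof (rule ccontr)
          assume "\<not> k > n"
          then have "1 / (real n + 1) \<le> 1 / (real k + 1)" by (intro divide_left_mono) auto
          then show False using k(1) False by (simp add: P_def)
        qed
        then obtain i where i: "k = Suc (i + n)" using less_imp_Suc_add by (metis add.commute)
        then have "\<not> P (i + n)" using k(2) by simp
        then have "x \<in> R (i + n)" using k(1) x unfolding P_def R_def i by (auto simp: add_ac)
        then show ?thesis by blast
      qed (use x in \<open>auto simp: A'_def\<close>)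
    qed
    then have "?H (A - F) \<le> ?H (A' n) + ?H (\<Union>i. R (i + n))"
      by (meson hausdorff_outer_measure_Un_le hausdorff_outer_measure_mono order_trans)
    also have "?H (\<Union>i. R (i + n)) \<le> suminf (\<lambda>i. ?H (R (i + n)))"
      by (rule hausdorff_outer_measure_UN_le)
    also have "\<dots> = ennreal (suminf (\<lambda>i. g (i + n)))"
      unfolding g using g0 \<open>summable g\<close> by (intro suminf_ennreal2) (auto simp: summable_iff_shift)
    also have "\<dots> \<le> ennreal e" using n by (intro ennreal_leI) auto
    finally have "?H (A - F) \<le> ?H (A' n) + ennreal e" by (auto intro: add_left_mono)
    then have "?H (A \<inter> F) + ?H (A - F) \<le> ?H (A \<inter> F) + ?H (A' n) + ennreal e"
      by (simp add: add.assoc add_left_mono)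
    also have "?H (A \<inter> F) + ?H (A' n) \<le> ?H (A \<inter> F \<union> A' n)"
    proof (rule hausdorff_outer_measure_separated)
      show "1 / (real n + 1) > 0" by simp
      fix a b assume "a \<in> A \<inter> F" "b \<in> A' n"
      then show "1 / (real n + 1) \<le> dist a b"
        using infdist_separated[of "1 / (real n + 1)" b F a 0] by (simp add: A'_def dist_commute)
    qed
    also have "?H (A \<inter> F \<union> A' n) \<le> ?H A"
      by (rule hausdorff_outer_measure_mono) (auto simp: A'_def)
    finally show "?H (A \<inter> F) + ?H (A - F) \<le> ?H A + ennreal e" by (auto intro: add_right_mono)
  qed
qed simp

text \<open>The Caratheodory measurable sets form a sigma-algebra on which the outer measure is
  additive, and it contains the closed sets, hence all Borel sets. This licenses evaluating
  \<open>measure_of\<close> in \<open>hausdorff_measure\<close>.\<close>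

lemma measure_space_hausdorff:
  "measure_space UNIV (sets borel) (hausdorff_outer_measure s :: 'a::metric_space set \<Rightarrow> ennreal)"
proof -
  let ?H = "hausdorff_outer_measure s :: 'a set \<Rightarrow> ennreal"
  interpret P: sigma_algebra "UNIV :: 'a set" "UNIV :: 'a set set"
    using sigma_algebra_Pow[of "UNIV :: 'a set"] by simp
  let ?L = "lambda_system UNIV UNIV ?H"
  have L: "measure_space UNIV ?L ?H"
    by (rule P.caratheodory_lemma[OF outer_measure_space_hausdorff])
  then interpret L: sigma_algebra UNIV ?L by (simp add: measure_space_def)
  have "F \<in> ?L" if "closed F" for F
  proof (cases "F = {}")
    case False
    have "?H (A \<inter> F) + ?H (A - F) = ?H A" for A
    proof (rule antisym)
      have "?H A \<le> ?H ((A \<inter> F) \<union> (A - F))" by (simp add: Int_Diff_Un)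
      also have "\<dots> \<le> ?H (A \<inter> F) + ?H (A - F)" by (rule hausdorff_outer_measure_Un_le)
      finally show "?H A \<le> ?H (A \<inter> F) + ?H (A - F)" .
    qed (rule hausdorff_caratheodory_closed[OF that False])
    then show ?thesis by (simp add: P.lambda_system_eq)
  qed simp
  then have "sigma_sets UNIV {S. closed S} \<subseteq> ?L"
    by (intro L.sigma_sets_subset) auto
  then have sub: "sets borel \<subseteq> ?L"
    unfolding borel_eq_closed by simp
  then have "countably_additive (sets borel) ?H"
    using L unfolding measure_space_def countably_additive_def by blast
  then show ?thesis
    using sets.sigma_algebra_axioms[of borel] by (auto simp: measure_space_def positive_def)
qed

lemma space_hausdorff_measure [simp]: "space (hausdorff_measure s) = UNIV"
  and sets_hausdorff_measure [simp, measurable_cong]: "sets (hausdorff_measure s) = sets borel"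
  using sets.sigma_sets_eq[of borel] by (simp_all add: hausdorff_measure_def)

lemma emeasure_hausdorff_measure:
  assumes "A \<in> sets borel"
  shows "emeasure (hausdorff_measure s) A = hausdorff_outer_measure s A"
  unfolding hausdorff_measure_def
  by (rule emeasure_measure_of_sigma)
    (use measure_space_hausdorff[of s] assms in \<open>auto simp: measure_space_def\<close>)

section \<open>Hausdorff measure of cube faces and of convex boundaries\<close>

lemma hausdorff_outer_measure_finite_UN:
  assumes "finite I" "\<And>i. i \<in> I \<Longrightarrow> hausdorff_outer_measure s (A i) < top"
  shows "hausdorff_outer_measure s (\<Union>i\<in>I. A i) < top"
  using assms
proof (induction I rule: finite_induct)
  case (insert i I)
  have "hausdorff_outer_measure s (\<Union>i\<in>insert i I. A i)
      \<le> hausdorff_outer_measure s (A i) + hausdorff_outer_measure s (\<Union>i\<in>I. A i)"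
    using hausdorff_outer_measure_Un_le[of s "A i"] by simp
  also have "\<dots> < top"
    using insert by simp
  finally show ?case .
qed simp

text \<open>A cover of \<open>A\<close> at scale \<open>\<delta> / L\<close> is pushed forward to a
  cover of the image at scale \<open>\<delta>\<close>. The sets are first cut down to
  \<open>A\<close>, because \<open>f\<close> is Lipschitz only there.\<close>

lemma hausdorff_outer_measure_lipschitz:
  fixes f :: "'a::metric_space \<Rightarrow> 'b::metric_space"
  assumes L: "L > 0" and f: "\<And>x y. x \<in> A \<Longrightarrow> y \<in> A \<Longrightarrow> dist (f x) (f y) \<le> L * dist x y"
  shows "hausdorff_outer_measure s (f ` A) \<le> ennreal (L ^ s) * hausdorff_outer_measure s A"
proof -
  let ?c = "ennreal (1 / L ^ s)"
  have w: "?c * hausdorff_weight s (f ` (U \<inter> A)) \<le> hausdorff_weight s U \<and>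
      bounded (f ` (U \<inter> A)) \<and> diameter (f ` (U \<inter> A)) \<le> L * diameter U" if U: "bounded U" for U
  proof (cases "U \<inter> A = {}")
    case False
    have d: "dist (f x) (f y) \<le> L * diameter U" if "x \<in> U \<inter> A" "y \<in> U \<inter> A" for x y
    proof -
      have "dist (f x) (f y) \<le> L * dist x y" using f that by blast
      also have "\<dots> \<le> L * diameter U"
        using L that by (intro mult_left_mono diameter_bounded_bound[OF U]) auto
      finally show ?thesis .
    qed
    have bd: "bounded (f ` (U \<inter> A))"
      using d False unfolding bounded_def by blast
    have diam: "diameter (f ` (U \<inter> A)) \<le> L * diameter U"
      unfolding diameter_def[of "f ` (U \<inter> A)"] using d False by (auto intro!: cSUP_least)
    have "?c * hausdorff_weight s (f ` (U \<inter> A))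
        = ennreal (1 / L ^ s * (unit_ball_vol (real s) * (diameter (f ` (U \<inter> A)) / 2) ^ s))"
      using False L by (simp add: hausdorff_weight_def ennreal_mult'[symmetric])
    also have "\<dots> \<le> ennreal (1 / L ^ s * (unit_ball_vol (real s) * (L * diameter U / 2) ^ s))"
      using L diam diameter_ge_0[OF bd]
      by (intro ennreal_leI mult_left_mono power_mono divide_right_mono) auto
    also have "\<dots> = hausdorff_weight s U"
      using L False by (auto simp: hausdorff_weight_def power_divide power_mult_distrib)
    finally show ?thesis using bd diam by blast
  qed (use L U in \<open>auto simp: diameter_ge_0\<close>)
  have content: "?c * hausdorff_content s \<delta> (f ` A) \<le> hausdorff_content s (\<delta> / L) A" for \<delta>
    unfolding hausdorff_content_def[of s "\<delta> / L"]
  proof (rule INF_greatest)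
    fix U assume U: "U \<in> hausdorff_covers (\<delta> / L) A"
    then have bdU: "bounded (U i)" "L * diameter (U i) \<le> \<delta>" for i
      using L by (auto simp: hausdorff_covers_def field_simps)
    have "(\<lambda>i. f ` (U i \<inter> A)) \<in> hausdorff_covers \<delta> (f ` A)"
      unfolding hausdorff_covers_def using U w[OF bdU(1)] bdU(2)
      by (fastforce simp: hausdorff_covers_def intro: order_trans)
    then have "?c * hausdorff_content s \<delta> (f ` A) \<le> ?c * suminf (\<lambda>i. hausdorff_weight s (f ` (U i \<inter> A)))"
      unfolding hausdorff_content_def by (intro mult_left_mono INF_lower) auto
    also have "\<dots> = suminf (\<lambda>i. ?c * hausdorff_weight s (f ` (U i \<inter> A)))"
      by simp
    also have "\<dots> \<le> suminf (\<lambda>i. hausdorff_weight s (U i))"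
      using w[OF bdU(1)] by (intro suminf_le) auto
    finally show "?c * hausdorff_content s \<delta> (f ` A) \<le> suminf (\<lambda>i. hausdorff_weight s (U i))" .
  qed
  have "?c * hausdorff_outer_measure s (f ` A) \<le> hausdorff_outer_measure s A"
    unfolding hausdorff_outer_measure_eq[of s "f ` A"] SUP_mult_left_ennreal
  proof (rule SUP_least)
    fix \<delta> :: real assume "\<delta> \<in> {0<..}"
    then show "?c * hausdorff_content s \<delta> (f ` A) \<le> hausdorff_outer_measure s A"
      using content[of \<delta>] hausdorff_content_le_outer[of "\<delta> / L" s A] L
      by (auto intro: order_trans)
  qed
  then have "ennreal (L ^ s) * (?c * hausdorff_outer_measure s (f ` A)) \<le> ennreal (L ^ s) * hausdorff_outer_measure s A"
    by (intro mult_left_mono) auto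
  then show ?thesis
    using L by (simp add: mult.assoc[symmetric] ennreal_mult'[symmetric])
qed

lemma hausdorff_outer_measure_isometric_image:
  assumes f: "\<And>x y. x \<in> A \<Longrightarrow> y \<in> A \<Longrightarrow> dist (f x) (f y) = dist x y"
  shows "hausdorff_outer_measure s (f ` A) = hausdorff_outer_measure s A"
proof (rule antisym)
  show "hausdorff_outer_measure s (f ` A) \<le> hausdorff_outer_measure s A"
    using hausdorff_outer_measure_lipschitz[of 1 A f s] f by simp
  have inj: "inj_on f A"
    using f by (metis dist_eq_0_iff inj_onI)
  have "dist (inv_into A f x) (inv_into A f y) \<le> 1 * dist x y" if "x \<in> f ` A" "y \<in> f ` A" for x y
    using that f inj by auto
  then have "hausdorff_outer_measure s (inv_into A f ` f ` A) \<le> hausdorff_outer_measure s (f ` A)"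
    using hausdorff_outer_measure_lipschitz[of 1 "f ` A" "inv_into A f" s] by simp
  then show "hausdorff_outer_measure s A \<le> hausdorff_outer_measure s (f ` A)"
    using inj by simp
qed

text \<open>Covers are sequences, so a finite cover is padded with empty sets; these have weight 0
  even for \<open>s = 0\<close>.\<close>

lemma hausdorff_content_le_sum:
  assumes "finite I" "A \<subseteq> (\<Union>i\<in>I. U i)" "\<And>i. i \<in> I \<Longrightarrow> bounded (U i) \<and> diameter (U i) \<le> \<delta>" "\<delta> \<ge> 0"
  shows "hausdorff_content s \<delta> A \<le> (\<Sum>i\<in>I. hausdorff_weight s (U i))"
proof -
  obtain h where h: "bij_betw h {..<card I} I"
    using bij_betw_from_nat_into_finite assms(1) by blast
  define V where "V = (\<lambda>n. if n < card I then U (h n) else {})"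
  have hI: "h n \<in> I" if "n < card I" for n using h that by (auto simp: bij_betw_def)
  have "\<exists>n. x \<in> V n" if "x \<in> A" for x
  proof -
    obtain i where "i \<in> I" "x \<in> U i" using assms(2) \<open>x \<in> A\<close> by blast
    then have "i \<in> h ` {..<card I}" using h by (simp add: bij_betw_def)
    then obtain n where "n < card I" "h n = i" by auto
    then show ?thesis using \<open>x \<in> U i\<close> by (auto simp: V_def)
  qed
  then have "A \<subseteq> (\<Union>n. V n)" by blast
  moreover have "bounded (V n) \<and> diameter (V n) \<le> \<delta>" for n
    using assms(3)[OF hI] assms(4) by (simp add: V_def)
  ultimately have "V \<in> hausdorff_covers \<delta> A"
    by (simp add: hausdorff_covers_def)
  then have "hausdorff_content s \<delta> A \<le> suminf (\<lambda>n. hausdorff_weight s (V n))"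
    unfolding hausdorff_content_def by (rule INF_lower)
  also have "\<dots> = (\<Sum>n<card I. hausdorff_weight s (V n))"
    by (intro suminf_finite) (auto simp: V_def)
  also have "\<dots> = (\<Sum>n<card I. hausdorff_weight s (U (h n)))"
    by (intro sum.cong) (auto simp: V_def)
  also have "\<dots> = (\<Sum>i\<in>I. hausdorff_weight s (U i))"
    by (rule sum.reindex_bij_betw[OF h])
  finally show ?thesis .
qed

definition unit_face :: "'n \<Rightarrow> (real^'n) set" where
  "unit_face k = {x. x $ k = 0 \<and> (\<forall>i. 0 \<le> x $ i \<and> x $ i \<le> 1)}"

definition open_unit_face :: "'n \<Rightarrow> (real^'n) set" where
  "open_unit_face k = {x. x $ k = 0 \<and> (\<forall>i. i \<noteq> k \<longrightarrow> 0 < x $ i \<and> x $ i < 1)}"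

text \<open>A grid of mesh 1/N cuts the face into N^(d-1) cells of diameter at most d/N, each of
  weight proportional to (d/N)^(d-1). The powers of N cancel, leaving the bound \<open>C\<close>
  independent of the scale.\<close>

lemma hausdorff_unit_face_finite:
  "hausdorff_outer_measure (CARD('n) - 1) (unit_face k :: (real^'n) set) < top"
proof -
  let ?s = "CARD('n) - 1" and ?d = "real CARD('n)"
  define C where "C = unit_ball_vol (real ?s) * (?d / 2) ^ ?s"
  have "hausdorff_content ?s \<delta> (unit_face k :: (real^'n) set) \<le> ennreal C" if \<delta>: "\<delta> > 0" for \<delta>
  proof -
    obtain N :: nat where N: "?d / \<delta> < N" using reals_Archimedean2 by blast
    have "?d / \<delta> \<ge> 0" using \<delta> by simp
    with N have N0: "N > 0" by (metis of_nat_0_less_iff order_le_less_trans)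
    have N\<delta>: "?d / N \<le> \<delta>" using N N0 \<delta> by (simp add: field_simps)
    define I where "I = Pi\<^sub>E (UNIV :: 'n set) (\<lambda>i. if i = k then {0} else {..<N})"
    define U where "U = (\<lambda>q. {x :: real^'n. \<forall>i. x $ i \<in> {real (q i) / N .. (real (q i) + 1) / N}})"
    have finI: "finite I" unfolding I_def by (intro finite_PiE) auto
    have cardI: "card I = N ^ ?s"
    proof -
      have "card I = (\<Prod>i\<in>UNIV. if i = k then 1 else N)"
        unfolding I_def by (subst card_PiE) (auto intro!: prod.cong)
      also have "\<dots> = (\<Prod>i\<in>UNIV - {k}. N)"
        by (subst prod.remove[of _ k]) (auto intro!: prod.cong)
      finally show ?thesis by (simp add: card_Diff_singleton)
    qed
    have dist: "dist x y \<le> ?d / N" if "x \<in> U q" "y \<in> U q" for x y q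
    proof -
      have "dist x y \<le> (\<Sum>i\<in>UNIV. \<bar>(x - y) $ i\<bar>)"
        unfolding dist_norm by (rule norm_le_l1_cart)
      also have "\<dots> \<le> (\<Sum>i\<in>(UNIV :: 'n set). 1 / N)"
      proof (rule sum_mono)
        fix i
        have "x $ i \<in> {real (q i) / N .. (real (q i) + 1) / N}" "y $ i \<in> {real (q i) / N .. (real (q i) + 1) / N}"
          using that by (auto simp: U_def)
        then show "\<bar>(x - y) $ i\<bar> \<le> 1 / N" by (auto simp: add_divide_distrib)
      qed
      finally show ?thesis by simp
    qed
    have bd: "bounded (U q)" for q
      using dist unfolding bounded_def by blast
    have diam: "diameter (U q) \<le> ?d / N" for q
      using dist unfolding diameter_def by (auto intro!: cSUP_least)
    have "unit_face k \<subseteq> (\<Union>q\<in>I. U q)"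
    proof
      fix x :: "real^'n" assume x: "x \<in> unit_face k"
      \<comment> \<open>Ceiling minus one rather than floor, so that the coordinate value 1 falls
        into the last cell \<open>N - 1\<close>.\<close>
      define q where "q = (\<lambda>i. if x $ i = 0 then 0 else nat (\<lceil>real N * x $ i\<rceil> - 1))"
      have q: "q i < N \<and> x $ i \<in> {real (q i) / N .. (real (q i) + 1) / N}" for i
      proof (cases "x $ i = 0")
        case False
        then have xi: "0 < x $ i" "x $ i \<le> 1" using x by (auto simp: unit_face_def less_le)
        define c where "c = \<lceil>real N * x $ i\<rceil>"
        have c: "of_int c - 1 < real N * x $ i" "real N * x $ i \<le> of_int c"
          unfolding c_def by linarith+
        have "real N * x $ i > 0" using xi N0 by simp
        with c have "c \<ge> 1" by linarith
        have "real N * x $ i \<le> N" using xi by (simp add: mult_left_le)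
        with c have "c < int N + 1" by linarith
        then have "nat (c - 1) < N" using \<open>c \<ge> 1\<close> by linarith
        moreover have "real (nat (c - 1)) = of_int c - 1" using \<open>c \<ge> 1\<close> by simp
        ultimately show ?thesis using False c N0
          by (simp add: q_def c_def[symmetric] field_simps)
      qed (use N0 in \<open>auto simp: q_def\<close>)
      then have "q \<in> I" using x by (auto simp: I_def q_def unit_face_def PiE_def)
      moreover have "x \<in> U q" using q by (auto simp: U_def)
      ultimately show "x \<in> (\<Union>q\<in>I. U q)" by blast
    qed
    then have "hausdorff_content ?s \<delta> (unit_face k) \<le> (\<Sum>q\<in>I. hausdorff_weight ?s (U q))"
      using bd diam N\<delta> \<delta> by (intro hausdorff_content_le_sum finI) (auto intro: order_trans)
    also have "\<dots> \<le> (\<Sum>q\<in>I. ennreal (unit_ball_vol (real ?s) * (?d / N / 2) ^ ?s))"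
    proof (rule sum_mono)
      fix q
      show "hausdorff_weight ?s (U q) \<le> ennreal (unit_ball_vol (real ?s) * (?d / N / 2) ^ ?s)"
        using diam[of q] diameter_ge_0[OF bd[of q]]
        by (auto simp: hausdorff_weight_def intro!: ennreal_leI mult_left_mono power_mono)
    qed
    also have "\<dots> = ennreal (real (card I) * (unit_ball_vol (real ?s) * (?d / N / 2) ^ ?s))"
      by (simp add: ennreal_mult' ennreal_of_nat_eq_real_of_nat)
    also have "real (card I) * (unit_ball_vol (real ?s) * (?d / N / 2) ^ ?s) = C"
      using N0 by (simp add: cardI C_def power_divide)
    finally show ?thesis .
  qed
  then have "hausdorff_outer_measure ?s (unit_face k :: (real^'n) set) \<le> ennreal C"
    unfolding hausdorff_outer_measure_eq by (intro SUP_least) auto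
  then show ?thesis by (simp add: order_le_less_trans)
qed

text \<open>
  A cover of the face, thickened by a unit interval in the direction orthogonal to the face,
  covers the open unit cube.
\<close>

lemma hausdorff_open_unit_face_pos:
  "hausdorff_outer_measure (CARD('n) - 1) (open_unit_face k :: (real^'n) set) > 0"
proof -
  let ?s = "CARD('n) - 1"
  define w where "w = unit_ball_vol (real ?s)"
  have w: "w > 0" by (simp add: w_def)
  \<comment> \<open>The thickened box over a set of diameter \<open>\<delta>\<close> has volume (2
    \<open>\<delta>\<close>)^s, which is 4^s / \<open>w\<close> times the Hausdorff weight; these
    volumes must add up to at least 1. Any fixed scale would do for a lower bound of the outer
    measure.\<close>
  have "ennreal (w / 4 ^ ?s) \<le> hausdorff_content ?s 1 (open_unit_face k :: (real^'n) set)"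
    unfolding hausdorff_content_def
  proof (rule INF_greatest)
    fix U :: "nat \<Rightarrow> (real^'n) set" assume U: "U \<in> hausdorff_covers 1 (open_unit_face k)"
    then have bd: "bounded (U i)" for i by (auto simp: hausdorff_covers_def)
    define \<delta> where "\<delta> = (\<lambda>i. diameter (U i))"
    have \<delta>0: "\<delta> i \<ge> 0" for i unfolding \<delta>_def by (rule diameter_ge_0[OF bd])
    \<comment> \<open>An arbitrary centre for the box around \<open>U i\<close>. For empty
      \<open>U i\<close> its value is irrelevant, as the box is then empty.\<close>
    define y where "y = (\<lambda>i. SOME y. y \<in> U i)"
    define B where "B = (\<lambda>i. if U i = {} then {} else
      cbox (\<chi> j. if j = k then 0 else y i $ j - \<delta> i) (\<chi> j. if j = k then 1 else y i $ j + \<delta> i))"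
    have vol: "emeasure lborel (B i) = ennreal (4 ^ ?s / w) * hausdorff_weight ?s (U i)" for i
    proof (cases "U i = {}")
      case False
      let ?a = "(\<chi> j. if j = k then 0 else y i $ j - \<delta> i) :: real^'n"
      let ?b = "(\<chi> j. if j = k then 1 else y i $ j + \<delta> i) :: real^'n"
      have ne: "cbox ?a ?b \<noteq> {}" using \<delta>0[of i] by (auto simp: interval_ne_empty_cart)
      have "emeasure lborel (B i) = ennreal (measure lborel (cbox ?a ?b))"
        using False emeasure_lborel_cbox_finite[of ?a ?b]
        by (simp add: B_def emeasure_eq_ennreal_measure less_top)
      also have "measure lborel (cbox ?a ?b) = (\<Prod>j\<in>UNIV. ?b $ j - ?a $ j)"
        using content_cbox_cart[OF ne] by simp
      also have "\<dots> = (\<Prod>j\<in>UNIV. if j = k then 1 else 2 * \<delta> i)"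
        by (intro prod.cong) auto
      also have "\<dots> = (\<Prod>j\<in>UNIV - {k}. 2 * \<delta> i)"
        by (subst prod.remove[of _ k]) (auto intro!: prod.cong)
      also have "\<dots> = (2 * \<delta> i) ^ ?s" by (simp add: card_Diff_singleton)
      also have "\<dots> = 4 ^ ?s / w * (w * (\<delta> i / 2) ^ ?s)"
        using w by (simp add: power_divide power_mult_distrib field_simps)
          (simp add: power_mult_distrib[symmetric])
      finally have "emeasure lborel (B i) = ennreal (4 ^ ?s / w) * ennreal (w * (\<delta> i / 2) ^ ?s)"
        using w \<delta>0[of i] by (simp only: ennreal_mult[symmetric] divide_nonneg_nonneg mult_nonneg_nonneg
            zero_le_power less_imp_le zero_le_numeral)
      also have "ennreal (w * (\<delta> i / 2) ^ ?s) = hausdorff_weight ?s (U i)"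
        unfolding hausdorff_weight_def w_def \<delta>_def using False by (simp only: if_False)
      finally show ?thesis .
    qed (simp add: B_def)
    have "box 0 (\<chi> i. 1) \<subseteq> (\<Union>i. B i)"
    proof
      fix x :: "real^'n" assume "x \<in> box 0 (\<chi> i. 1)"
      then have x: "0 < x $ j" "x $ j < 1" for j by (auto simp: mem_box_cart)
      define x' where "x' = (\<chi> j. if j = k then 0 else x $ j)"
      have "x' \<in> open_unit_face k" using x by (auto simp: x'_def open_unit_face_def)
      then obtain i where i: "x' \<in> U i" using U by (auto simp: hausdorff_covers_def)
      then have "y i \<in> U i" unfolding y_def by (metis someI)
      have "\<bar>x $ j - y i $ j\<bar> \<le> \<delta> i" if "j \<noteq> k" for j
      proof -
        have "\<bar>x $ j - y i $ j\<bar> = \<bar>(x' - y i) $ j\<bar>" using that by (simp add: x'_def)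
        also have "\<dots> \<le> norm (x' - y i)" by (rule component_le_norm_cart)
        also have "\<dots> \<le> \<delta> i"
          using diameter_bounded_bound[OF bd[of i] i \<open>y i \<in> U i\<close>] by (simp add: \<delta>_def dist_norm)
        finally show ?thesis .
      qed
      then have "x \<in> B i" using i x
        by (auto simp: B_def mem_box_cart abs_le_iff less_imp_le algebra_simps)
      then show "x \<in> (\<Union>i. B i)" by blast
    qed
    have "1 = emeasure lborel (box 0 (\<chi> i. 1) :: (real^'n) set)"
    proof -
      have "emeasure lborel (box 0 (\<chi> i. 1) :: (real^'n) set) = emeasure lborel (cbox 0 (\<chi> i. 1) :: (real^'n) set)"
        by (simp add: emeasure_lborel_cbox_eq emeasure_lborel_box_eq)
      also have "\<dots> = ennreal (measure lborel (cbox 0 (\<chi> i. 1) :: (real^'n) set))"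
        using emeasure_lborel_cbox_finite[of 0 "(\<chi> i. 1) :: real^'n"]
        by (simp add: emeasure_eq_ennreal_measure less_top)
      also have "measure lborel (cbox 0 (\<chi> i. 1) :: (real^'n) set) = 1"
        using content_cbox_cart[of 0 "(\<chi> i. 1) :: real^'n"] by (simp add: interval_ne_empty_cart)
      finally show ?thesis by simp
    qed
    also have "\<dots> \<le> emeasure lborel (\<Union>i. B i)"
      by (intro emeasure_mono \<open>box 0 (\<chi> i. 1) \<subseteq> (\<Union>i. B i)\<close>) (auto simp: B_def)
    also have "\<dots> \<le> suminf (\<lambda>i. emeasure lborel (B i))"
      by (intro emeasure_subadditive_countably) (auto simp: B_def)
    also have "\<dots> = ennreal (4 ^ ?s / w) * suminf (\<lambda>i. hausdorff_weight ?s (U i))"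
      by (simp add: vol)
    finally have "ennreal (w / 4 ^ ?s) * 1 \<le> ennreal (w / 4 ^ ?s) * (ennreal (4 ^ ?s / w) * suminf (\<lambda>i. hausdorff_weight ?s (U i)))"
      by (intro mult_left_mono) auto
    then show "ennreal (w / 4 ^ ?s) \<le> suminf (\<lambda>i. hausdorff_weight ?s (U i))"
      using w by (simp add: mult.assoc[symmetric] ennreal_mult'[symmetric])
  qed
  also have "\<dots> \<le> hausdorff_outer_measure ?s (open_unit_face k)"
    by (rule hausdorff_content_le_outer) simp
  finally show ?thesis
    using w by (metis divide_pos_pos ennreal_less_zero_iff less_le_trans zero_less_numeral zero_less_power)
qed

text \<open>The nearest-point projection onto \<open>K\<close> is 1-Lipschitz and maps the surface
  of a large cube onto a superset of the boundary of \<open>K\<close>: each boundary point is the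
  projection of the point where its outer normal ray leaves the cube.\<close>

lemma hausdorff_frontier_convex_finite:
  fixes K :: "(real^'n) set"
  assumes "compact K" "convex K" "interior K \<noteq> {}"
  shows "hausdorff_outer_measure (CARD('n) - 1) (frontier K) < top"
proof -
  let ?s = "CARD('n) - 1"
  obtain R where R: "R > 0" "\<And>x. x \<in> K \<Longrightarrow> norm x < R"
    using compact_imp_bounded[OF assms(1)] bounded_pos_less by blast
  define Q where "Q = (cbox (\<chi> i. -R) (\<chi> i. R) :: (real^'n) set)"
  define F where "F = (\<lambda>(i, c). {x :: real^'n. x $ i = c \<and> (\<forall>j. \<bar>x $ j\<bar> \<le> R)})"
  define S where "S = (\<Union>p\<in>UNIV \<times> {R, -R}. F p)"
  have "hausdorff_outer_measure ?s (F p) < top" for p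
  proof (cases p)
    case (Pair i c)
    define g where "g = (\<lambda>x :: real^'n. (2 * R) *\<^sub>R x + (\<chi> j. if j = i then c else - R))"
    have "F p \<subseteq> g ` unit_face i"
    proof
      fix x assume x: "x \<in> F p"
      define z :: "real^'n" where "z = (\<chi> j. if j = i then 0 else (x $ j + R) / (2 * R))"
      have "z \<in> unit_face i"
        using x R(1) by (auto simp: Pair F_def unit_face_def z_def abs_le_iff field_simps)
          (smt (verit))+
      moreover have "x = g z"
        using x R(1) by (auto simp: Pair F_def g_def z_def vec_eq_iff)
      ultimately show "x \<in> g ` unit_face i" by blast
    qed
    then have "hausdorff_outer_measure ?s (F p) \<le> hausdorff_outer_measure ?s (g ` unit_face i)"
      by (rule hausdorff_outer_measure_mono)
    also have "\<dots> \<le> ennreal ((2 * R) ^ ?s) * hausdorff_outer_measure ?s (unit_face i :: (real^'n) set)"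
      using R(1) by (intro hausdorff_outer_measure_lipschitz)
        (auto simp: g_def dist_norm scaleR_diff_right[symmetric])
    also have "\<dots> < top"
      using hausdorff_unit_face_finite[of i] by (simp add: ennreal_mult_less_top)
    finally show ?thesis .
  qed
  then have finS: "hausdorff_outer_measure ?s S < top"
    unfolding S_def by (intro hausdorff_outer_measure_finite_UN) auto
  have "frontier K \<subseteq> closest_point K ` S"
  proof
    fix x assume x: "x \<in> frontier K"
    have xK: "x \<in> K"
      using x assms(1) compact_imp_closed frontier_subset_closed by blast
    \<comment> \<open>This \<open>u\<close> points inwards, so the ray to the surface of the cube
      runs in direction \<open>- u\<close>.\<close>
    obtain u where u: "u \<noteq> 0" "\<And>y. y \<in> K \<Longrightarrow> u \<bullet> x \<le> u \<bullet> y"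
    proof (rule supporting_hyperplane_relative_frontier[OF assms(2)])
      show "x \<in> closure K" using xK closure_subset by blast
      show "x \<notin> rel_interior K"
        using x rel_interior_nonempty_interior[OF assms(3)] by (simp add: frontier_def)
    qed (use closure_subset in blast)
    have intQ: "interior Q = box (\<chi> i. -R) (\<chi> i. R)" by (simp add: Q_def)
    have "\<bar>x $ i\<bar> < R" for i
      using R(2)[OF xK] component_le_norm_cart[of x i] by linarith
    then have "x \<in> interior Q" unfolding intQ by (auto simp: mem_box_cart abs_less_iff)
       (smt (verit))+
    then obtain t where t: "t > 0" "x + t *\<^sub>R (- u) \<in> frontier Q"
      using ray_to_frontier[of Q x "- u"] u(1) by (auto simp: Q_def)
    define z where "z = x + t *\<^sub>R (- u)"
    have "z \<in> cbox (\<chi> i. -R) (\<chi> i. R) - box (\<chi> i. -R) (\<chi> i. R)"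
      using t(2) \<open>x \<in> interior Q\<close> unfolding intQ by (auto simp: Q_def z_def frontier_cbox)
    then have "z \<in> S"
      by (auto simp: S_def F_def mem_box_cart) (smt (verit))+
    moreover have "x = closest_point K z"
    proof (rule closest_point_unique[OF assms(2) compact_imp_closed[OF assms(1)] xK])
      show "\<forall>y\<in>K. dist z x \<le> dist z y"
      proof
        fix y assume "y \<in> K"
        have "norm (z - x) ^ 2 \<le> norm (z - y) ^ 2"
        proof -
          have "norm (z - y) ^ 2 = norm ((z - x) + (x - y)) ^ 2" by simp
          also have "\<dots> = norm (z - x) ^ 2 + 2 * ((z - x) \<bullet> (x - y)) + norm (x - y) ^ 2"
            by (simp only: power2_norm_eq_inner inner_add_left inner_add_right inner_commute)
          also have "(z - x) \<bullet> (x - y) = t * (u \<bullet> y - u \<bullet> x)"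
            by (simp add: z_def inner_diff_right right_diff_distrib)
          finally show ?thesis using u(2)[OF \<open>y \<in> K\<close>] t(1) by simp
        qed
        then show "dist z x \<le> dist z y" by (simp add: dist_norm)
      qed
    qed
    ultimately show "x \<in> closest_point K ` S" by blast
  qed
  then have "hausdorff_outer_measure ?s (frontier K) \<le> hausdorff_outer_measure ?s (closest_point K ` S)"
    by (rule hausdorff_outer_measure_mono)
  also have "\<dots> < top"
  proof -
    have "K \<noteq> {}" using assms(3) interior_subset by blast
    then have "hausdorff_outer_measure ?s (closest_point K ` S) \<le> hausdorff_outer_measure ?s S"
      using hausdorff_outer_measure_lipschitz[of 1 S "closest_point K" ?s]
        closest_point_lipschitz[OF assms(2) compact_imp_closed[OF assms(1)]] by simp
    then show ?thesis using finS by (rule order_le_less_trans)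
  qed
  finally show ?thesis .
qed

section \<open>Surface area measures\<close>

lemma space_surface_area_measure [simp]: "space (surface_area_measure K) = sphere 0 1"
  and sets_surface_area_measure [simp, measurable_cong]:
    "sets (surface_area_measure K) = sets (restrict_space borel (sphere 0 1))"
  by (simp_all add: surface_area_measure_def space_restrict_space)

text \<open>All conditions on the pair are closed. Projections of this compact set are what make the
  regular boundary Borel and the Gauss map measurable.\<close>

lemma compact_normal_bundle:
  assumes "compact K" "closed C"
  shows "compact {(x, u). x \<in> frontier K \<and> u \<in> outer_unit_normals K x \<and> u \<in> C}"
proof -
  have "{(x, u). x \<in> frontier K \<and> u \<in> outer_unit_normals K x \<and> u \<in> C}
      = (frontier K \<times> (sphere 0 1 \<inter> C)) \<inter> (\<Inter>y\<in>K. {p. snd p \<bullet> (y - fst p) \<le> 0})"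
    by (auto simp: outer_unit_normals_def)
  moreover have "compact \<dots>"
    by (intro compact_Int_closed compact_Times compact_frontier assms closed_INT ballI
        closed_Collect_le continuous_intros) auto
  ultimately show ?thesis by simp
qed

text \<open>The regular points are those having a normal, minus the sets \<open>D n\<close> of
  points having two normals at distance at least 1/(n+1). Each of these sets is a projection of a
  compact set.\<close>

lemma borel_regular_boundary:
  fixes K :: "(real^'n) set"
  assumes "compact K"
  shows "regular_boundary K \<in> sets borel"
proof -
  define P where "P = {x \<in> frontier K. outer_unit_normals K x \<noteq> {}}"
  define D where "D = (\<lambda>n::nat. {x \<in> frontier K. \<exists>u\<in>outer_unit_normals K x. \<exists>v\<in>outer_unit_normals K x.
      1 / (real n + 1) \<le> dist u v})"
  have "P = fst ` {(x, u). x \<in> frontier K \<and> u \<in> outer_unit_normals K x \<and> u \<in> UNIV}"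
    by (auto simp: P_def image_iff)
  then have "compact P"
    using compact_normal_bundle[OF assms, of UNIV] by (simp add: compact_continuous_image continuous_on_fst)
  have D: "compact (D n)" for n
  proof -
    let ?T = "(frontier K \<times> sphere 0 1 \<times> sphere 0 1)
      \<inter> (\<Inter>y\<in>K. {p. fst (snd p) \<bullet> (y - fst p) \<le> 0}) \<inter> (\<Inter>y\<in>K. {p. snd (snd p) \<bullet> (y - fst p) \<le> 0})
      \<inter> {p. 1 / (real n + 1) \<le> dist (fst (snd p)) (snd (snd p))}"
    have "?T = {(x, u, v). x \<in> frontier K \<and> u \<in> outer_unit_normals K x \<and>
        v \<in> outer_unit_normals K x \<and> 1 / (real n + 1) \<le> dist u v}"
      by (auto simp: outer_unit_normals_def)
    then have "D n = fst ` ?T"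
      by (auto simp: D_def image_def)
    moreover have "compact ?T"
      by (intro compact_Int_closed compact_Times compact_frontier assms closed_INT ballI
          closed_Collect_le continuous_intros) auto
    ultimately show ?thesis by (simp add: compact_continuous_image continuous_on_fst)
  qed
  have "x \<in> regular_boundary K \<longleftrightarrow> x \<in> P - (\<Union>n. D n)" for x
  proof
    assume "x \<in> regular_boundary K"
    then show "x \<in> P - (\<Union>n. D n)"
    proof -
      have front: "x \<in> frontier K" and ex1: "\<exists>!u. u \<in> outer_unit_normals K x"
        using \<open>x \<in> regular_boundary K\<close> by (simp_all add: regular_boundary_def)
      have "\<not> 1 / (real n + 1) \<le> dist u v"
        if "u \<in> outer_unit_normals K x" "v \<in> outer_unit_normals K x" for n u v
      proof -
        have "u = v" using ex1 that by blast
        then show ?thesis by simp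
      qed
      then show ?thesis using front ex1 by (auto simp: P_def D_def)
    qed
  next
    assume x: "x \<in> P - (\<Union>n. D n)"
    then obtain u where u: "x \<in> frontier K" "u \<in> outer_unit_normals K x" by (auto simp: P_def)
    have "v = u" if v: "v \<in> outer_unit_normals K x" for v
    proof (rule ccontr)
      assume "v \<noteq> u"
      then obtain n where "inverse (real (Suc n)) < dist v u"
        using reals_Archimedean[of "dist v u"] by auto
      then have "1 / (real n + 1) \<le> dist v u" by (simp add: inverse_eq_divide add_ac)
      then have "x \<in> D n" using u v unfolding D_def by blast
      then show False using x by blast
    qed
    then show "x \<in> regular_boundary K" using u by (auto simp: regular_boundary_def)
  qed
  then have "regular_boundary K = P - (\<Union>n. D n)" by blast
  moreover have "P \<in> sets borel" "D n \<in> sets borel" for n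
    using \<open>compact P\<close> D by (auto intro: borel_compact)
  ultimately show ?thesis by auto
qed

lemma gauss_map_normal:
  "x \<in> regular_boundary K \<Longrightarrow> gauss_map K x \<in> outer_unit_normals K x"
  unfolding gauss_map_def regular_boundary_def by (auto intro: theI')

lemma gauss_map_eqI:
  "x \<in> regular_boundary K \<Longrightarrow> u \<in> outer_unit_normals K x \<Longrightarrow> gauss_map K x = u"
  using gauss_map_normal[of x K] by (auto simp: regular_boundary_def)

text \<open>The points whose normal avoids an open set \<open>S\<close> are, within the regular
  boundary, the projection of the normal bundle over the closed set \<open>- S\<close>.\<close>

lemma measurable_gauss_map:
  fixes K :: "(real^'n) set"
  assumes "compact K"
  shows "gauss_map K \<in> restrict_space (hausdorff_measure s) (regular_boundary K) \<rightarrow>\<^sub>M restrict_space borel (sphere 0 1)"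
proof (rule measurable_restrict_space2)
  let ?M = "restrict_space (hausdorff_measure s) (regular_boundary K)"
  have sp: "space ?M = regular_boundary K" by (simp add: space_restrict_space)
  show "gauss_map K \<in> space ?M \<rightarrow> sphere 0 1"
    using gauss_map_normal[of _ K] by (auto simp: sp outer_unit_normals_def)
  show "gauss_map K \<in> borel_measurable ?M"
  proof (rule borel_measurableI)
    fix S :: "(real^'n) set" assume "open S"
    define P where "P = fst ` {(x, u). x \<in> frontier K \<and> u \<in> outer_unit_normals K x \<and> u \<in> - S}"
    have "compact P"
      unfolding P_def using compact_normal_bundle[OF assms, of "- S"] \<open>open S\<close>
      by (intro compact_continuous_image) (auto intro: continuous_intros)
    then have "regular_boundary K - P \<in> sets borel"
      using borel_regular_boundary[OF assms] by (auto intro: borel_compact)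
    moreover have "gauss_map K -` S \<inter> space ?M = (regular_boundary K - P) \<inter> regular_boundary K"
    proof -
      have "x \<in> P \<longleftrightarrow> gauss_map K x \<notin> S" if "x \<in> regular_boundary K" for x
      proof
        assume "x \<in> P"
        then show "gauss_map K x \<notin> S" using gauss_map_eqI[OF that] by (auto simp: P_def)
      next
        assume "gauss_map K x \<notin> S"
        then have "(x, gauss_map K x) \<in> {(x, u). x \<in> frontier K \<and> u \<in> outer_unit_normals K x \<and> u \<in> - S}"
          using gauss_map_normal[OF that] that by (auto simp: regular_boundary_def)
        then show "x \<in> P" unfolding P_def by force
      qed
      then show ?thesis by (auto simp: sp)
    qed
    ultimately show "gauss_map K -` S \<inter> space ?M \<in> sets ?M"
      by (auto simp: sets_restrict_space)
  qed
qed

lemma finite_measure_restrict_hausdorff: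
  assumes "convex_body (K :: (real^'n) set)"
  shows "finite_measure (restrict_space (hausdorff_measure (CARD('n) - 1)) (regular_boundary K))"
proof (rule finite_measureI)
  let ?M = "restrict_space (hausdorff_measure (CARD('n) - 1)) (regular_boundary K)"
  have K: "compact K" "convex K" "interior K \<noteq> {}" using assms by (auto simp: convex_body_def)
  have "emeasure ?M (space ?M) = hausdorff_outer_measure (CARD('n) - 1) (regular_boundary K)"
    using borel_regular_boundary[OF K(1)]
    by (simp add: space_restrict_space emeasure_restrict_space emeasure_hausdorff_measure)
  also have "\<dots> \<le> hausdorff_outer_measure (CARD('n) - 1) (frontier K)"
    by (rule hausdorff_outer_measure_mono) (auto simp: regular_boundary_def)
  also have "\<dots> < top" by (rule hausdorff_frontier_convex_finite[OF K])
  finally show "emeasure ?M (space ?M) \<noteq> \<infinity>" by simp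
qed

lemma finite_measure_surface_area_measure:
  assumes "convex_body K"
  shows "finite_measure (surface_area_measure K)"
  unfolding surface_area_measure_def
  using finite_measure_restrict_hausdorff[OF assms] measurable_gauss_map[of K] assms
  by (intro finite_measure.finite_measure_distr) (auto simp: convex_body_def)

lemma integral_surface_area_measure:
  fixes F :: "real^'n \<Rightarrow> real"
  assumes "compact K" "F \<in> borel_measurable borel"
  shows "(\<integral>v. F v \<partial>surface_area_measure K)
    = (\<integral>x. F (gauss_map K x) \<partial>restrict_space (hausdorff_measure (CARD('n) - 1)) (regular_boundary K))"
  unfolding surface_area_measure_def
  using assms by (intro integral_distr measurable_gauss_map measurable_restrict_space1)

lemma outer_unit_normals_image:
  fixes f :: "real^'n \<Rightarrow> real^'n"
  assumes f: "orthogonal_transformation f"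
  shows "outer_unit_normals (f ` K) (f x) = f ` outer_unit_normals K x"
proof -
  note lin = orthogonal_transformation_linear[OF f] and surj = orthogonal_transformation_surj[OF f]
  have "f w \<in> outer_unit_normals (f ` K) (f x) \<longleftrightarrow> w \<in> outer_unit_normals K x" for w
  proof -
    have "f w \<bullet> (f y - f x) = w \<bullet> (y - x)" for y
      using f by (simp only: linear_diff[OF lin, symmetric] orthogonal_transformation_def)
    then show ?thesis
      by (simp add: outer_unit_normals_def orthogonal_transformation_norm[OF f])
  qed
  note iff = this
  show ?thesis
  proof (intro set_eqI iffI)
    fix u assume u: "u \<in> outer_unit_normals (f ` K) (f x)"
    obtain w where "u = f w" using surj by (metis surjD)
    then show "u \<in> f ` outer_unit_normals K x" using u iff by blast
  qed (use iff in blast)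
qed

lemma outer_unit_normal_imp_frontier:
  assumes "closed K" "x \<in> K" "u \<in> outer_unit_normals K x"
  shows "x \<in> frontier K"
proof -
  have "x \<notin> interior K"
  proof
    assume "x \<in> interior K"
    then obtain e where e: "e > 0" "cball x e \<subseteq> K" by (auto simp: mem_interior_cball)
    have "norm u = 1" using assms(3) by (auto simp: outer_unit_normals_def)
    then have "x + e *\<^sub>R u \<in> K" using e by (intro subsetD[OF e(2)]) (simp add: dist_norm)
    then have "u \<bullet> (e *\<^sub>R u) \<le> 0" using assms(3) by (auto simp: outer_unit_normals_def)
    then show False using e \<open>norm u = 1\<close> by (simp add: dot_square_norm)
  qed
  then show ?thesis using assms by (simp add: frontier_def)
qed

section \<open>Thin slabs and their large faces\<close>

definition slab :: "'n \<Rightarrow> real \<Rightarrow> (real^'n) set" where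
  "slab k h = cbox 0 (\<chi> i. if i = k then h else 1)"

text \<open>Relative interiors only: on the rim of a large face the normal is not unique. The rims
  are counted among the sides.\<close>

definition slab_faces :: "'n \<Rightarrow> real \<Rightarrow> (real^'n) set" where
  "slab_faces k h = {x. (x $ k = 0 \<or> x $ k = h) \<and> (\<forall>i. i \<noteq> k \<longrightarrow> 0 < x $ i \<and> x $ i < 1)}"

definition slab_sides :: "'n \<Rightarrow> real \<Rightarrow> (real^'n) set" where
  "slab_sides k h = {x \<in> slab k h. \<exists>i. i \<noteq> k \<and> (x $ i = 0 \<or> x $ i = 1)}"

lemma mem_slab: "x \<in> slab k h \<longleftrightarrow> 0 \<le> x $ k \<and> x $ k \<le> h \<and> (\<forall>i. i \<noteq> k \<longrightarrow> 0 \<le> x $ i \<and> x $ i \<le> 1)"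
  unfolding slab_def by (auto simp: mem_box_cart split: if_splits)

text \<open>Small moves in both directions along the face stay in the slab, so a normal has no
  tangential component; the move across to the opposite face fixes its sign.\<close>

lemma outer_unit_normals_slab:
  assumes h: "h > 0" and x: "x \<in> slab_faces k h"
  shows "outer_unit_normals (slab k h) x = {if x $ k = 0 then - axis k 1 else axis k 1}"
proof -
  have xk: "x $ k = 0 \<or> x $ k = h" and xi: "\<And>i. i \<noteq> k \<Longrightarrow> 0 < x $ i \<and> x $ i < 1"
    using x by (auto simp: slab_faces_def)
  have "(if x $ k = 0 then - axis k 1 else axis k 1) \<in> outer_unit_normals (slab k h) x"
    using xk h by (auto simp: outer_unit_normals_def mem_slab inner_axis')
  moreover have "w = (if x $ k = 0 then - axis k 1 else axis k 1)"
    if w: "w \<in> outer_unit_normals (slab k h) x" for w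
  proof -
    have nw: "norm w = 1" and le: "\<And>y. y \<in> slab k h \<Longrightarrow> w \<bullet> (y - x) \<le> 0"
      using w by (auto simp: outer_unit_normals_def)
    have wi: "w $ i = 0" if "i \<noteq> k" for i
    proof -
      define e where "e = min (x $ i) (1 - x $ i)"
      have e: "e > 0" "e \<le> x $ i" "e \<le> 1 - x $ i" using xi[OF that] by (auto simp: e_def)
      have "x + axis i e \<in> slab k h" "x - axis i e \<in> slab k h"
        using xk h that e by (auto simp: mem_slab axis_def intro: less_imp_le dest: xi)
      then have "w \<bullet> axis i e \<le> 0" "w \<bullet> (- axis i e) \<le> 0"
        using le[of "x + axis i e"] le[of "x - axis i e"] by auto
      then show ?thesis using e by (simp add: inner_axis mult_le_0_iff zero_le_mult_iff)
    qed
    then have wk: "w = (w $ k) *\<^sub>R axis k 1" by (auto simp: vec_eq_iff axis_def)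
    from arg_cong[OF this, of norm] have "norm w = \<bar>w $ k\<bar>" by simp
    then have "\<bar>w $ k\<bar> = 1" using nw by simp
    moreover have "w $ k * (if x $ k = 0 then h else - h) \<le> 0"
    proof -
      have "x + axis k (if x $ k = 0 then h else - h) \<in> slab k h"
        using xk h by (auto simp: mem_slab axis_def intro: less_imp_le dest: xi)
      then show ?thesis using le[of "x + axis k (if x $ k = 0 then h else - h)"] by (simp add: inner_axis split: if_splits)
    qed
    ultimately have wk_eq: "w $ k = (if x $ k = 0 then -1 else 1)"
      using h by (auto simp: mult_le_0_iff abs_if split: if_splits)
    show ?thesis using wk unfolding wk_eq by (simp split: if_splits)
  qed
  ultimately show ?thesis by blast
qed

text \<open>Translates of the sides of a thin slab are packed into the boundary of the unit cube.\<close>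

lemma hausdorff_slab_sides_le:
  assumes "M > 0"
  shows "of_nat M * hausdorff_outer_measure (CARD('n) - 1) (slab_sides k (1 / (2 * real M)) :: (real^'n) set)
    \<le> hausdorff_outer_measure (CARD('n) - 1) (frontier (cbox 0 (\<chi> i. 1)) :: (real^'n) set)"
proof -
  let ?H = "hausdorff_measure (CARD('n) - 1) :: (real^'n) measure"
  let ?L = "slab_sides k (1 / (2 * real M)) :: (real^'n) set"
  \<comment> \<open>Shifts by multiples of 1/M against a thickness of 1/(2M): the \<open>M\<close>
    translates are pairwise disjoint.\<close>
  define T where "T = (\<lambda>j x. x + axis k (real j / real M) :: real^'n)"
  have cl: "closed ?L"
  proof -
    have "?L = slab k (1 / (2 * real M)) \<inter> (\<Union>i\<in>UNIV - {k}. {x. x $ i = 0} \<union> {x. x $ i = 1})"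
      by (auto simp: slab_sides_def)
    also have "closed \<dots>"
      unfolding slab_def
      by (intro closed_Int closed_UN ballI closed_Un closed_Collect_eq continuous_intros closed_cbox) auto
    finally show ?thesis .
  qed
  have TL: "T j ` ?L = (\<lambda>x. x - axis k (real j / real M)) -` ?L" for j
    by (auto simp: T_def image_iff) (metis diff_add_cancel)
  have bor: "T j ` ?L \<in> sets borel" for j
    unfolding TL using cl by (intro borel_closed closed_vimage continuous_intros)
  have iso: "emeasure ?H (T j ` ?L) = hausdorff_outer_measure (CARD('n) - 1) ?L" for j
    using bor by (simp add: emeasure_hausdorff_measure hausdorff_outer_measure_isometric_image T_def)
  have disj: "disjoint_family_on (\<lambda>j. T j ` ?L) {..<M}"
  proof -
    have False if "i < j" "x \<in> T i ` ?L" "x \<in> T j ` ?L" for i j x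
    proof -
      from that(2) obtain y where y: "x = T i y" "y \<in> ?L" by (rule imageE)
      from that(3) obtain z where z: "x = T j z" "z \<in> ?L" by (rule imageE)
      have "x $ k = y $ k + real i / real M" unfolding y(1) by (simp add: T_def)
      moreover have "x $ k = z $ k + real j / real M" unfolding z(1) by (simp add: T_def)
      moreover have "y $ k \<le> 1 / (2 * real M)" "0 \<le> z $ k"
        using y(2) z(2) by (auto simp: slab_sides_def mem_slab)
      ultimately have "real j / real M - real i / real M \<le> 1 / (2 * real M)" by linarith
      then have "real j - real i \<le> 1 / 2"
        using assms mult_le_cancel_left_pos[of "real M" "2 * real j" "1 + 2 * real i"]
        by (simp add: field_simps)
      then show False using \<open>i < j\<close> by linarith
    qed
    then show ?thesis unfolding disjoint_family_on_def by (metis IntE equals0I linorder_neqE_nat)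
  qed
  have "of_nat M * hausdorff_outer_measure (CARD('n) - 1) ?L = (\<Sum>j<M. emeasure ?H (T j ` ?L))"
    by (simp only: iso sum_constant card_lessThan)
  also have "\<dots> = emeasure ?H (\<Union>j<M. T j ` ?L)"
    using bor disj by (intro sum_emeasure) auto
  also have "\<dots> = hausdorff_outer_measure (CARD('n) - 1) (\<Union>j<M. T j ` ?L)"
    using bor by (intro emeasure_hausdorff_measure) auto
  also have "\<dots> \<le> hausdorff_outer_measure (CARD('n) - 1) (frontier (cbox 0 (\<chi> i. 1)) :: (real^'n) set)"
  proof (rule hausdorff_outer_measure_mono, rule subsetI)
    fix x assume "x \<in> (\<Union>j<M. T j ` ?L)"
    then obtain j y where j: "j < M" and y: "y \<in> ?L" and xy: "x = y + axis k (real j / real M)"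
      by (auto simp: T_def)
    obtain i where i: "i \<noteq> k" "y $ i = 0 \<or> y $ i = 1" using y by (auto simp: slab_sides_def)
    \<comment> \<open>Even the highest translate, shifted by (M-1)/M, ends below 1 and so stays in
      the unit cube.\<close>
    have "real j / real M \<le> (real M - 1) / real M"
      using j by (intro divide_right_mono) auto
    then have "1 / (2 * real M) + real j / real M \<le> 1"
      using assms by (simp add: field_simps)
    then have "x \<in> cbox 0 (\<chi> i. 1)"
      using y by (auto simp: xy slab_sides_def mem_slab mem_box_cart axis_def) 
    moreover have "x \<notin> box 0 (\<chi> i. 1)"
      using i by (auto simp: xy mem_box_cart axis_def intro!: exI[of _ i])
    ultimately show "x \<in> frontier (cbox 0 (\<chi> i. 1))"
      by (simp add: frontier_cbox)
  qed
  finally show ?thesis .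
qed

text \<open>
  The body is a thin rotated slab: its two large faces have normals \<open>v\<close> and \<open>- v\<close>, and the area of
  the remaining part of the boundary tends to zero with the thickness.
\<close>

lemma surface_area_measures_determine_even_function:
  fixes F :: "real^'n \<Rightarrow> real"
  assumes meas: "F \<in> borel_measurable borel"
    and bound: "\<And>u. u \<in> sphere 0 1 \<Longrightarrow> \<bar>F u\<bar> \<le> B"
    and even: "\<And>u. F (- u) = F u"
    and zero: "\<And>K. convex_body K \<Longrightarrow> (\<integral>u. F u \<partial>surface_area_measure K) = 0"
    and v: "v \<in> sphere 0 1"
  shows "F v = 0"
proof -
  let ?s = "CARD('n) - 1"
  let ?H = "hausdorff_outer_measure ?s :: (real^'n) set \<Rightarrow> ennreal"
  obtain k :: 'n where True by simp
  have "\<exists>f. orthogonal_transformation f \<and> f (axis k (1::real)) = v"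
  proof (rule orthogonal_transformation_exists_1[of "axis k 1" v])
    show "norm (axis k 1 :: real^'n) = 1" "norm v = 1" using v by simp_all
  qed blast
  then obtain f where f: "orthogonal_transformation f" and fk: "f (axis k (1::real)) = v"
    by blast
  note lin = orthogonal_transformation_linear[OF f] and inj = orthogonal_transformation_inj[OF f]
  have iso: "?H (f ` A) = ?H A" for A
    by (rule hausdorff_outer_measure_isometric_image)
      (use f in \<open>simp add: dist_norm linear_diff[OF lin, symmetric] orthogonal_transformation_norm\<close>)
  have B0: "B \<ge> 0" using bound[OF v] by linarith
  \<comment> \<open>Only positivity of this area matters: one of the two large faces already bounds
    the good part of the boundary from below, for every thickness.\<close>
  define c where "c = enn2real (?H (open_unit_face k))"
  have "?H (open_unit_face k) \<le> ?H (unit_face k)"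
    by (rule hausdorff_outer_measure_mono) (auto simp: open_unit_face_def unit_face_def intro: less_imp_le,
      (metis less_imp_le order_refl zero_le_one)+)
  then have c: "?H (open_unit_face k) = ennreal c"
    unfolding c_def using hausdorff_unit_face_finite[of k] by (simp add: order_le_less_trans)
  have "c > 0" using hausdorff_open_unit_face_pos[of k] c by simp
  define C where "C = enn2real (?H (frontier (cbox 0 (\<chi> i. 1))))"
  have "interior (cbox 0 (\<chi> i. 1) :: (real^'n) set) \<noteq> {}"
    by (simp add: interval_ne_empty_cart)
  then have C: "?H (frontier (cbox 0 (\<chi> i. 1))) = ennreal C"
    unfolding C_def using hausdorff_frontier_convex_finite[of "cbox 0 (\<chi> i. 1) :: (real^'n) set"] by simp
  \<comment> \<open>The right side does not depend on \<open>M\<close>, so the estimate for all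
    \<open>M\<close> forces \<open>F v = 0\<close>.\<close>
  have "real M * (\<bar>F v\<bar> * c) \<le> B * C" if "M > 0" for M :: nat
  proof -
    define h where "h = 1 / (2 * real M)"
    have h: "h > 0" using that by (simp add: h_def)
    define K where "K = f ` slab k h"
    define Hr where "Hr = restrict_space (hausdorff_measure ?s) (regular_boundary K)"
    have cK: "compact K" 
      unfolding K_def slab_def by (intro compact_continuous_image linear_continuous_on lin[unfolded linear_conv_bounded_linear]) simp
    have intK: "interior K = f ` box 0 (\<chi> i. if i = k then h else 1)"
      unfolding K_def slab_def by (simp add: interior_injective_linear_image[OF lin inj])
    have "convex_body K"
      unfolding convex_body_def intK using cK h
      by (auto simp: interval_ne_empty_cart) (auto simp: K_def slab_def intro: convex_linear_image[OF lin])
    interpret Hr: finite_measure Hr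
      unfolding Hr_def by (rule finite_measure_restrict_hausdorff[OF \<open>convex_body K\<close>])
    have regb: "regular_boundary K \<in> sets borel" by (rule borel_regular_boundary[OF cK])
    have spHr: "space Hr = regular_boundary K" by (simp add: Hr_def space_restrict_space)
    have gauss: "f x \<in> regular_boundary K \<and> F (gauss_map K (f x)) = F v" if x: "x \<in> slab_faces k h" for x
    proof -
      have N: "outer_unit_normals K (f x) = {f (if x $ k = 0 then - axis k 1 else axis k 1)}"
        unfolding K_def outer_unit_normals_image[OF f] outer_unit_normals_slab[OF h x] by simp
      have "x \<in> slab k h" using x h by (auto simp: slab_faces_def mem_slab intro: less_imp_le)
      then have "f x \<in> frontier K"
        using N by (intro outer_unit_normal_imp_frontier[of K "f x"] compact_imp_closed[OF cK]) (auto simp: K_def)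
      then have reg: "f x \<in> regular_boundary K" using N by (simp add: regular_boundary_def)
      then have "gauss_map K (f x) = f (if x $ k = 0 then - axis k 1 else axis k 1)"
        using gauss_map_normal N by blast
      then show ?thesis using reg even fk by (simp add: linear_neg[OF lin])
    qed
    define A where "A = f ` slab_faces k h"
    have "A \<in> sets borel"
    proof -
      \<comment> \<open>With the continuous inverse \<open>g\<close> the image \<open>A\<close>
        becomes a preimage, whose measurability is immediate.\<close>
      obtain g where g: "linear g" "g \<circ> f = id" "f \<circ> g = id"
        using linear_injective_isomorphism[OF lin inj] by (auto simp: fun_eq_iff)
      have A_eq: "A = g -` slab_faces k h"
      proof -
        have "g (f x) = x" "f (g x) = x" for x using g(2,3) by (simp_all add: fun_eq_iff)
        then show ?thesis unfolding A_def by (auto simp: image_iff) (metis \<open>\<And>x. f (g x) = x\<close>)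
      qed
      have "slab_faces k h = ({x. x $ k = 0} \<union> {x. x $ k = h}) \<inter> (\<Inter>i\<in>UNIV - {k}. {x. 0 < x $ i} \<inter> {x. x $ i < 1})"
        by (auto simp: slab_faces_def)
      also have "\<dots> \<in> sets borel"
        by (intro sets.Int sets.Un borel_closed closed_Collect_eq borel_open open_INT open_Int open_Collect_less
            continuous_intros ballI) auto
      finally have sf: "slab_faces k h \<in> sets borel" .
      have "g \<in> borel_measurable borel"
        using g(1) by (simp add: borel_measurable_continuous_onI linear_continuous_on linear_linear)
      from measurable_sets[OF this sf] show ?thesis unfolding A_eq by simp
    qed
    have Areg: "A \<subseteq> regular_boundary K" using gauss by (auto simp: A_def)
    have AHr: "A \<in> sets Hr" using \<open>A \<in> sets borel\<close> Areg
      by (auto simp: Hr_def sets_restrict_space)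
    have emHr: "emeasure Hr X = ?H X" if "X \<in> sets borel" "X \<subseteq> regular_boundary K" for X
      using that regb by (simp add: Hr_def emeasure_restrict_space emeasure_hausdorff_measure)
    have measA: "measure Hr A \<ge> c"
    proof -
      have "ennreal c = ?H (f ` open_unit_face k)" by (simp only: iso c)
      also have "\<dots> \<le> ?H A"
        by (rule hausdorff_outer_measure_mono) (auto simp: A_def open_unit_face_def slab_faces_def)
      also have "\<dots> = ennreal (measure Hr A)"
        using emHr[OF \<open>A \<in> sets borel\<close> Areg] by (simp add: Hr.emeasure_eq_measure)
      finally show ?thesis by simp
    qed
    have measR: "real M * measure Hr (space Hr - A) \<le> C"
    proof -
      have "space Hr - A \<subseteq> f ` slab_sides k h"
      proof
        fix y assume y: "y \<in> space Hr - A"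
        then have "y \<in> K - interior K"
          using compact_imp_closed[OF cK] by (auto simp: spHr regular_boundary_def frontier_def)
        then obtain x where x: "y = f x" "x \<in> slab k h" "x \<notin> box 0 (\<chi> i. if i = k then h else 1)"
          unfolding intK by (auto simp: K_def)
        have "x \<notin> slab_faces k h" using y x by (auto simp: A_def)
        then have "x \<in> slab_sides k h"
          using x(2,3) by (auto simp: slab_faces_def slab_sides_def mem_slab mem_box_cart less_le split: if_splits)
        then show "y \<in> f ` slab_sides k h" using x by blast
      qed
      then have "?H (space Hr - A) \<le> ?H (slab_sides k h)"
        using hausdorff_outer_measure_mono iso by metis
      moreover have "?H (space Hr - A) = ennreal (measure Hr (space Hr - A))"
        using emHr[of "space Hr - A"] regb \<open>A \<in> sets borel\<close> by (simp add: Hr.emeasure_eq_measure spHr)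
      ultimately have "of_nat M * ennreal (measure Hr (space Hr - A)) \<le> of_nat M * ?H (slab_sides k h)"
        by (simp add: mult_left_mono)
      also have "\<dots> \<le> ennreal C"
        using hausdorff_slab_sides_le[OF that, of k] C by (simp add: h_def)
      finally have "ennreal (real M * measure Hr (space Hr - A)) \<le> ennreal C"
        by (simp add: ennreal_of_nat_eq_real_of_nat ennreal_mult')
      then show ?thesis by (simp add: C_def)
    qed
    define G where "G = (\<lambda>x. F (gauss_map K x))"
    have "G \<in> borel_measurable Hr"
      unfolding G_def Hr_def
      by (rule measurable_compose[OF measurable_gauss_map[OF cK] measurable_restrict_space1[OF meas]])
    have Gb: "\<bar>G x\<bar> \<le> B" if "x \<in> space Hr" for x
      using that gauss_map_normal[of x K] by (auto simp: G_def spHr outer_unit_normals_def intro!: bound)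
    have intG: "integrable Hr G"
      by (rule Hr.integrable_const_bound[of _ B]) (use Gb \<open>G \<in> borel_measurable Hr\<close> in auto)
    have "(\<integral>x. G x \<partial>Hr) = 0"
      using zero[OF \<open>convex_body K\<close>] integral_surface_area_measure[OF cK meas] by (simp add: G_def Hr_def)
    have intA: "integrable Hr (\<lambda>x. F v * indicator A x)"
      using AHr by (intro integrable_mult_right integrable_real_indicator) (auto simp: less_top[symmetric])
    have intR: "integrable Hr (\<lambda>x. B * indicator (space Hr - A) x :: real)"
      using AHr by (intro integrable_mult_right integrable_real_indicator) (auto simp: less_top[symmetric])
    \<comment> \<open>The integral of \<open>G\<close> is zero, so it may be subtracted. On
      \<open>A\<close> both integrands agree, by evenness for the face with normal
      \<open>- v\<close>; outside \<open>A\<close> only the bound \<open>B\<close> is left.\<close>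
    have "\<bar>F v\<bar> * measure Hr A = \<bar>(\<integral>x. F v * indicator A x \<partial>Hr)\<bar>"
      using AHr by (simp add: abs_mult)
    also have "\<dots> = \<bar>(\<integral>x. F v * indicator A x - G x \<partial>Hr)\<bar>"
      using \<open>(\<integral>x. G x \<partial>Hr) = 0\<close> by (simp add: Bochner_Integration.integral_diff[OF intA intG])
    also have "\<dots> \<le> (\<integral>x. \<bar>F v * indicator A x - G x\<bar> \<partial>Hr)" by (rule integral_abs_bound)
    also have "\<dots> \<le> (\<integral>x. B * indicator (space Hr - A) x \<partial>Hr)"
    proof (rule integral_mono)
      show "integrable Hr (\<lambda>x. \<bar>F v * indicator A x - G x\<bar>)"
        by (intro integrable_abs Bochner_Integration.integrable_diff intA intG)
      fix x assume "x \<in> space Hr"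
      then show "\<bar>F v * indicator A x - G x\<bar> \<le> B * indicator (space Hr - A) x"
        using Gb[of x] gauss by (auto simp: A_def G_def indicator_def)
    qed (rule intR)
    also have "\<dots> = B * measure Hr (space Hr - A)" using AHr by simp
    finally have "\<bar>F v\<bar> * measure Hr A \<le> B * measure Hr (space Hr - A)" .
    then have "\<bar>F v\<bar> * c \<le> B * measure Hr (space Hr - A)"
      using measA by (meson abs_ge_zero mult_left_mono order_trans)
    then have "real M * (\<bar>F v\<bar> * c) \<le> real M * (B * measure Hr (space Hr - A))"
      by (intro mult_left_mono) auto
    also have "\<dots> \<le> B * C"
      using mult_left_mono[OF measR B0] by (simp add: mult_ac)
    finally show ?thesis .
  qed
  note main = this
  show ?thesis
  proof (rule ccontr)
    assume "F v \<noteq> 0"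
    then have pos: "\<bar>F v\<bar> * c > 0" using \<open>c > 0\<close> by simp
    obtain M :: nat where "B * C / (\<bar>F v\<bar> * c) < M" using reals_Archimedean2 by blast
    then have *: "B * C < real M * (\<bar>F v\<bar> * c)" using pos by (simp add: field_simps)
    moreover have "B * C \<ge> 0" using B0 by (simp add: C_def)
    ultimately have "M > 0" by (cases M) auto
    then show False using main[of M] * by linarith
  qed
qed

section \<open>Polynomials, the Laplacian and zonal harmonics\<close>

text \<open>A coordinate-free normal form for polynomials: a sum of products of linear forms. The
  degree of a term is the length of its list of vectors, so homogeneous parts are obtained by
  filtering.\<close>

definition linear_products :: "(real \<times> (real^'n) list) list \<Rightarrow> real^'n \<Rightarrow> real" where
  "linear_products ts x = (\<Sum>(c, us)\<leftarrow>ts. c * (\<Prod>u\<leftarrow>us. x \<bullet> u))"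

lemma linear_products_simps [simp]:
  "linear_products [] x = 0"
  "linear_products ((c, us) # ts) x = c * (\<Prod>u\<leftarrow>us. x \<bullet> u) + linear_products ts x"
  "linear_products (ts @ ts') x = linear_products ts x + linear_products ts' x"
  by (simp_all add: linear_products_def)

lemma real_polynomial_function_inner [simp, intro]: "real_polynomial_function (\<lambda>x. x \<bullet> v)"
  by (intro real_polynomial_function.intros(1) bounded_linear_inner_left)

text \<open>With \<open>v = 0\<close> and \<open>i = 0\<close> this also covers pure powers of
  \<open>x \<bullet> x\<close>.\<close>

lemma real_polynomial_function_zonal [simp, intro]:
  "real_polynomial_function (\<lambda>x :: real^'n. (x \<bullet> v) ^ i * (x \<bullet> x) ^ j)"
proof -
  have "real_polynomial_function (\<lambda>x :: real^'n. \<Sum>i\<in>UNIV. x $ i * x $ i)"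
    by (rule real_polynomial_function_sum)
      (simp, intro real_polynomial_function.intros(4) real_polynomial_function.intros(1) bounded_linear_vec_nth)
  then have "real_polynomial_function (\<lambda>x :: real^'n. x \<bullet> x)"
    by (simp add: inner_vec_def)
  then show ?thesis
    by (intro real_polynomial_function.intros(4) real_polynomial_function_power real_polynomial_function_inner)
qed

lemma real_polynomial_function_prod_list [simp]:
  "real_polynomial_function (\<lambda>x. \<Prod>u\<leftarrow>us. x \<bullet> u)"
  by (induction us) auto

lemma linear_products_exists:
  fixes P :: "real^'n \<Rightarrow> real"
  assumes "real_polynomial_function P"
  shows "\<exists>ts. P = linear_products ts"
  using assms
proof (induction rule: real_polynomial_function.induct)
  case (linear f)
  then have "f = linear_products [(1, [adjoint f 1])]"
    using adjoint_works[of f _ 1] by (auto simp: bounded_linear.linear)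
  then show ?case by blast
next
  case (const c)
  have "(\<lambda>x. c) = linear_products [(c, [])]" by auto
  then show ?case by blast
next
  case (add f g)
  then obtain ts ts' where "f = linear_products ts" "g = linear_products ts'" by blast
  then have "(\<lambda>x. f x + g x) = linear_products (ts @ ts')" by auto
  then show ?case by blast
next
  case (mult f g)
  then obtain ts ts' where fg: "f = linear_products ts" "g = linear_products ts'" by blast
  have one: "linear_products (map (\<lambda>(d, vs). (c * d, us @ vs)) ts') x = (c * (\<Prod>u\<leftarrow>us. x \<bullet> u)) * linear_products ts' x"
    for c us x by (induction ts') (auto simp: algebra_simps)
  have "linear_products (concat (map (\<lambda>(c, us). map (\<lambda>(d, vs). (c * d, us @ vs)) ts') ts)) x
      = linear_products ts x * linear_products ts' x" for x
    by (induction ts) (auto simp: one algebra_simps)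
  then have "(\<lambda>x. f x * g x) = linear_products (concat (map (\<lambda>(c, us). map (\<lambda>(d, vs). (c * d, us @ vs)) ts') ts))"
    using fg by auto
  then show ?case by blast
qed

lemma prod_list_inner_scaleR:
  "(\<Prod>u\<leftarrow>us. (t *\<^sub>R x) \<bullet> u) = t ^ length us * (\<Prod>u\<leftarrow>us. x \<bullet> u)"
  by (induction us) (auto simp: algebra_simps)

lemma linear_products_scaleR:
  assumes "\<And>p. p \<in> set ts \<Longrightarrow> length (snd p) \<le> N"
  shows "linear_products ts (t *\<^sub>R x)
    = (\<Sum>i\<le>N. linear_products (filter (\<lambda>p. length (snd p) = i) ts) x * t ^ i)"
  using assms
proof (induction ts)
  case (Cons p ts)
  obtain c us where p: "p = (c, us)" by (cases p)
  have len: "length us \<le> N" using Cons.prems[of p] p by simp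
  have "(\<Sum>i\<le>N. linear_products (filter (\<lambda>p. length (snd p) = i) (p # ts)) x * t ^ i)
     = (\<Sum>i\<le>N. (if i = length us then c * (\<Prod>u\<leftarrow>us. x \<bullet> u) * t ^ i else 0)
         + linear_products (filter (\<lambda>p. length (snd p) = i) ts) x * t ^ i)"
    by (intro sum.cong) (auto simp: p algebra_simps)
  also have "\<dots> = c * (\<Prod>u\<leftarrow>us. x \<bullet> u) * t ^ length us + linear_products ts (t *\<^sub>R x)"
    using len Cons by (simp add: sum.distrib)
  also have "\<dots> = linear_products (p # ts) (t *\<^sub>R x)"
    by (simp add: p prod_list_inner_scaleR del: inner_scaleR_left)
  finally show ?case by simp
qed simp

text \<open>An arbitrary representation may contain terms of other degrees. Comparing coefficients
  of \<open>t\<close> in \<open>P (t *\<^sub>R x)\<close> shows that these cancel, so they can be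
  filtered out.\<close>

lemma homogeneous_polynomial_linear_products:
  fixes P :: "real^'n \<Rightarrow> real"
  assumes "homogeneous_polynomial k P"
  shows "\<exists>ts. P = linear_products ts \<and> (\<forall>p\<in>set ts. length (snd p) = k)"
proof -
  obtain ts where ts: "P = linear_products ts"
    using linear_products_exists assms unfolding homogeneous_polynomial_def by blast
  define Q where "Q = (\<lambda>i. linear_products (filter (\<lambda>p. length (snd p) = i) ts))"
  define N where "N = Max (insert k ((length \<circ> snd) ` set ts))"
  have len: "length (snd p) \<le> N" if "p \<in> set ts" for p
    using that by (auto simp: N_def)
  have "k \<le> N" by (simp add: N_def)
  have "P x = Q k x" for x
  proof -
    have "(\<Sum>i\<le>N. Q i x * t ^ i) = (\<Sum>i\<le>N. (if i = k then P x else 0) * t ^ i)" for t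
    proof -
      have "(\<Sum>i\<le>N. Q i x * t ^ i) = P (t *\<^sub>R x)"
        unfolding Q_def ts by (rule linear_products_scaleR[symmetric]) (rule len)
      also have "\<dots> = t ^ k * P x" using assms by (simp add: homogeneous_polynomial_def)
      also have "\<dots> = (\<Sum>i\<le>N. if i = k then t ^ k * P x else 0)" using \<open>k \<le> N\<close> by simp
      also have "\<dots> = (\<Sum>i\<le>N. (if i = k then P x else 0) * t ^ i)" by (intro sum.cong) auto
      finally show ?thesis .
    qed
    then have "\<forall>t. (\<Sum>i\<le>N. Q i x * t ^ i) = (\<Sum>i\<le>N. (if i = k then P x else 0) * t ^ i)" by blast
    then have "\<forall>i\<le>N. Q i x = (if i = k then P x else 0)" unfolding polyfun_eq_coeffs .
    then show ?thesis using \<open>k \<le> N\<close> by simp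
  qed
  then have "P = linear_products (filter (\<lambda>p. length (snd p) = k) ts)" by (auto simp: Q_def)
  then show ?thesis by (intro exI conjI) auto
qed

text \<open>
  Powers of linear forms span the homogeneous polynomials: replacing \<open>v\<close> by \<open>v + t *\<^sub>R u\<close> and
  comparing the coefficients of \<open>t\<close> turns one factor \<open>x \<bullet> v\<close> into \<open>x \<bullet> u\<close>.
\<close>

lemma homogeneous_functional_zero:
  fixes L :: "(real^'n \<Rightarrow> real) \<Rightarrow> real"
  assumes add: "\<And>P Q. real_polynomial_function P \<Longrightarrow> real_polynomial_function Q \<Longrightarrow>
      L (\<lambda>x. P x + Q x) = L P + L Q"
    and scale: "\<And>c P. real_polynomial_function P \<Longrightarrow> L (\<lambda>x. c * P x) = c * L P"
    and pow: "\<And>v. L (\<lambda>x. (x \<bullet> v) ^ k) = 0"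
    and hom: "homogeneous_polynomial k P"
  shows "L P = 0"
proof -
  have zero: "L (\<lambda>x. 0) = 0"
    using scale[of "\<lambda>x. 0" 0] by auto
  have sum: "L (\<lambda>x. \<Sum>i\<in>I. c i * R i x) = (\<Sum>i\<in>I. c i * L (R i))"
    if "finite I" "\<And>i. real_polynomial_function (R i)" for I :: "nat set" and c R
    using that(1)
  proof (induction I rule: finite_induct)
    case (insert i I)
    have "real_polynomial_function (\<lambda>x. \<Sum>i\<in>I. c i * R i x)"
      by (rule real_polynomial_function_sum) (use insert that(2) in auto)
    then have "L (\<lambda>x. c i * R i x + (\<Sum>i\<in>I. c i * R i x)) = L (\<lambda>x. c i * R i x) + L (\<lambda>x. \<Sum>i\<in>I. c i * R i x)"
      using that(2) by (intro add) auto
    then show ?case using insert that(2) by (simp add: scale)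
  qed (simp add: zero)
  \<comment> \<open>Induction on the list of factors, trading one listed factor for a higher power;
    \<open>v\<close> must stay arbitrary because the hypothesis is applied to
    \<open>v + t *\<^sub>R u\<close>.\<close>
  have prods: "L (\<lambda>x. (x \<bullet> v) ^ j * (\<Prod>u\<leftarrow>us. x \<bullet> u)) = 0" if "j + length us = k" for us j v
    using that
  proof (induction us arbitrary: j v)
    case Nil
    then show ?case using pow by simp
  next
    case (Cons u us)
    define R where "R = (\<lambda>i x. (x \<bullet> u) ^ i * (x \<bullet> v) ^ (Suc j - i) * (\<Prod>u\<leftarrow>us. x \<bullet> u))"
    have R: "real_polynomial_function (R i)" for i
      unfolding R_def
      by (intro real_polynomial_function.intros(4) real_polynomial_function_power
          real_polynomial_function_inner real_polynomial_function_prod_list)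
    have "(\<Sum>i\<le>Suc j. (real (Suc j choose i) * L (R i)) * t ^ i) = 0" for t
    proof -
      have "(x \<bullet> (v + t *\<^sub>R u)) ^ Suc j * (\<Prod>u\<leftarrow>us. x \<bullet> u)
          = (\<Sum>i\<le>Suc j. (real (Suc j choose i) * t ^ i) * R i x)" for x
      proof -
        have "(x \<bullet> (v + t *\<^sub>R u)) ^ Suc j = (t * (x \<bullet> u) + x \<bullet> v) ^ Suc j"
          by (simp add: inner_add_right add.commute)
        also have "\<dots> = (\<Sum>i\<le>Suc j. real (Suc j choose i) * (t * (x \<bullet> u)) ^ i * (x \<bullet> v) ^ (Suc j - i))"
          by (rule binomial_ring)
        finally show ?thesis
          by (simp only: sum_distrib_right) (intro sum.cong refl, simp only: R_def power_mult_distrib mult_ac)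
      qed
      then have "(\<lambda>x. (x \<bullet> (v + t *\<^sub>R u)) ^ Suc j * (\<Prod>u\<leftarrow>us. x \<bullet> u))
          = (\<lambda>x. \<Sum>i\<le>Suc j. (real (Suc j choose i) * t ^ i) * R i x)" by blast
      then have "(\<Sum>i\<le>Suc j. (real (Suc j choose i) * t ^ i) * L (R i)) = 0"
        using Cons.IH[of "Suc j" "v + t *\<^sub>R u"] Cons.prems sum[of "{..Suc j}" R "\<lambda>i. real (Suc j choose i) * t ^ i"] R
        by simp
      then show ?thesis by (simp add: mult_ac)
    qed
    then have "\<forall>t. (\<Sum>i\<le>Suc j. (real (Suc j choose i) * L (R i)) * t ^ i) = 0" by blast
    then have "\<forall>i\<le>Suc j. real (Suc j choose i) * L (R i) = 0" unfolding polyfun_eq_0 .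
    \<comment> \<open>The coefficient of \<open>t\<close> to the first power; its binomial factor
      \<open>Suc j\<close> is nonzero, also in \<open>HOL\<close> division-free form.\<close>
    then have "real (Suc j choose 1) * L (R 1) = 0" by simp
    then have "L (R 1) = 0" by simp
    moreover have "R 1 = (\<lambda>x. (x \<bullet> v) ^ j * (\<Prod>u\<leftarrow>u # us. x \<bullet> u))"
      by (auto simp: R_def mult_ac)
    ultimately show ?case by simp
  qed
  obtain ts where ts: "P = linear_products ts" "\<forall>p\<in>set ts. length (snd p) = k"
    using homogeneous_polynomial_linear_products[OF hom] by blast
  have "real_polynomial_function (linear_products ts) \<and> L (linear_products ts) = 0"
    using ts(2)
  proof (induction ts)
    case Nil
    then show ?case using zero by (auto simp: linear_products_def)
  next
    case (Cons p ts)
    obtain c us where p: "p = (c, us)" by (cases p)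
    have eq: "linear_products (p # ts) = (\<lambda>x. c * (\<Prod>u\<leftarrow>us. x \<bullet> u) + linear_products ts x)"
      by (auto simp: p)
    have "L (\<lambda>x. \<Prod>u\<leftarrow>us. x \<bullet> u) = 0" using prods[of 0 us] Cons.prems p by simp
    then have L0: "L (\<lambda>x. c * (\<Prod>u\<leftarrow>us. x \<bullet> u)) = 0"
      by (subst scale) (auto intro: real_polynomial_function_prod_list)
    have pc: "real_polynomial_function (\<lambda>x. c * (\<Prod>u\<leftarrow>us. x \<bullet> u))"
      by (intro real_polynomial_function.intros(4) real_polynomial_function.intros(2)
          real_polynomial_function_prod_list)
    have IH: "real_polynomial_function (linear_products ts)" "L (linear_products ts) = 0"
      using Cons by auto
    show ?case
      unfolding eq using add[OF pc IH(1)] L0 IH(2) real_polynomial_function.intros(3)[OF pc IH(1)] by simp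
  qed
  then show ?thesis using ts(1) by simp
qed

section \<open>The Laplacian of polynomials and of zonal functions\<close>

definition second_derivative_along :: "(real^'n \<Rightarrow> real) \<Rightarrow> real^'n \<Rightarrow> (real^'n \<Rightarrow> real) \<Rightarrow> bool" where
  "second_derivative_along P e P2 \<longleftrightarrow> (\<exists>P1.
     (\<forall>x t. ((\<lambda>t. P (x + t *\<^sub>R e)) has_real_derivative P1 (x + t *\<^sub>R e)) (at t)) \<and>
     (\<forall>x t. ((\<lambda>t. P1 (x + t *\<^sub>R e)) has_real_derivative P2 (x + t *\<^sub>R e)) (at t)))"

text \<open>A value of \<open>deriv\<close> says nothing about differentiability. Linearity of
  \<open>laplacian\<close> is therefore derived from \<open>second_derivative_along\<close>, which
  asserts both derivatives along whole lines.\<close>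

lemma second_derivative_along_deriv:
  assumes "second_derivative_along P e P2"
  shows "(deriv ^^ 2) (\<lambda>t. P (x + t *\<^sub>R e)) 0 = P2 x"
proof -
  obtain P1 where
    1: "\<And>x t. ((\<lambda>t. P (x + t *\<^sub>R e)) has_real_derivative P1 (x + t *\<^sub>R e)) (at t)" and
    2: "\<And>x t. ((\<lambda>t. P1 (x + t *\<^sub>R e)) has_real_derivative P2 (x + t *\<^sub>R e)) (at t)"
    using assms unfolding second_derivative_along_def by blast
  have "deriv (\<lambda>t. P (x + t *\<^sub>R e)) = (\<lambda>t. P1 (x + t *\<^sub>R e))"
    using 1 by (auto intro: DERIV_imp_deriv)
  moreover have "deriv (\<lambda>t. P1 (x + t *\<^sub>R e)) 0 = P2 (x + 0 *\<^sub>R e)"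
    using 2 by (rule DERIV_imp_deriv)
  ultimately show ?thesis by (simp add: numeral_2_eq_2)
qed

lemma second_derivative_along_add:
  "second_derivative_along P e P2 \<Longrightarrow> second_derivative_along Q e Q2 \<Longrightarrow>
    second_derivative_along (\<lambda>x. P x + Q x) e (\<lambda>x. P2 x + Q2 x)"
  unfolding second_derivative_along_def
proof (elim exE conjE)
  fix P1 Q1
  assume "\<forall>x t. ((\<lambda>t. P (x + t *\<^sub>R e)) has_real_derivative P1 (x + t *\<^sub>R e)) (at t)"
    "\<forall>x t. ((\<lambda>t. P1 (x + t *\<^sub>R e)) has_real_derivative P2 (x + t *\<^sub>R e)) (at t)"
    "\<forall>x t. ((\<lambda>t. Q (x + t *\<^sub>R e)) has_real_derivative Q1 (x + t *\<^sub>R e)) (at t)"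
    "\<forall>x t. ((\<lambda>t. Q1 (x + t *\<^sub>R e)) has_real_derivative Q2 (x + t *\<^sub>R e)) (at t)"
  then show "\<exists>R1. (\<forall>x t. ((\<lambda>t. P (x + t *\<^sub>R e) + Q (x + t *\<^sub>R e)) has_real_derivative R1 (x + t *\<^sub>R e)) (at t)) \<and>
     (\<forall>x t. ((\<lambda>t. R1 (x + t *\<^sub>R e)) has_real_derivative P2 (x + t *\<^sub>R e) + Q2 (x + t *\<^sub>R e)) (at t))"
    by (intro exI[of _ "\<lambda>x. P1 x + Q1 x"]) (auto intro!: DERIV_add)
qed

lemma second_derivative_along_cmult:
  "second_derivative_along P e P2 \<Longrightarrow> second_derivative_along (\<lambda>x. c * P x) e (\<lambda>x. c * P2 x)"
  unfolding second_derivative_along_def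
proof (elim exE conjE)
  fix P1
  assume "\<forall>x t. ((\<lambda>t. P (x + t *\<^sub>R e)) has_real_derivative P1 (x + t *\<^sub>R e)) (at t)"
    "\<forall>x t. ((\<lambda>t. P1 (x + t *\<^sub>R e)) has_real_derivative P2 (x + t *\<^sub>R e)) (at t)"
  then show "\<exists>R1. (\<forall>x t. ((\<lambda>t. c * P (x + t *\<^sub>R e)) has_real_derivative R1 (x + t *\<^sub>R e)) (at t)) \<and>
     (\<forall>x t. ((\<lambda>t. R1 (x + t *\<^sub>R e)) has_real_derivative c * P2 (x + t *\<^sub>R e)) (at t))"
    by (intro exI[of _ "\<lambda>x. c * P1 x"]) (auto intro!: DERIV_cmult)
qed

lemma polynomial_derivative_along:
  fixes P :: "real^'n \<Rightarrow> real"
  assumes "real_polynomial_function P"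
  shows "\<exists>P1. real_polynomial_function P1 \<and>
    (\<forall>x t. ((\<lambda>t. P (x + t *\<^sub>R e)) has_real_derivative P1 (x + t *\<^sub>R e)) (at t))"
  using assms
proof (induction rule: real_polynomial_function.induct)
  case (linear f)
  have "f (x + t *\<^sub>R e) = f x + t * f e" for x t
    using linear by (simp add: bounded_linear.linear linear_add linear_scale)
  then show ?case
    by (intro exI[of _ "\<lambda>x. f e"]) (auto intro!: derivative_eq_intros)
next
  case (const c)
  show ?case by (intro exI[of _ "\<lambda>x. 0"]) auto
next
  case (add f g)
  then obtain f1 g1 where "real_polynomial_function f1" "real_polynomial_function g1"
    "\<forall>x t. ((\<lambda>t. f (x + t *\<^sub>R e)) has_real_derivative f1 (x + t *\<^sub>R e)) (at t)"
    "\<forall>x t. ((\<lambda>t. g (x + t *\<^sub>R e)) has_real_derivative g1 (x + t *\<^sub>R e)) (at t)" by blast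
  then show ?case
    by (intro exI[of _ "\<lambda>x. f1 x + g1 x"]) (auto intro!: DERIV_add)
next
  case (mult f g)
  then obtain f1 g1 where "real_polynomial_function f1" "real_polynomial_function g1"
    "\<forall>x t. ((\<lambda>t. f (x + t *\<^sub>R e)) has_real_derivative f1 (x + t *\<^sub>R e)) (at t)"
    "\<forall>x t. ((\<lambda>t. g (x + t *\<^sub>R e)) has_real_derivative g1 (x + t *\<^sub>R e)) (at t)" by blast
  then show ?case
    using mult by (intro exI[of _ "\<lambda>x. f1 x * g x + g1 x * f x"]) (auto intro!: DERIV_mult)
qed

lemma polynomial_second_derivative_along:
  assumes "real_polynomial_function P"
  shows "\<exists>P2. real_polynomial_function P2 \<and> second_derivative_along P e P2"
  unfolding second_derivative_along_def
  using polynomial_derivative_along[OF assms, of e] polynomial_derivative_along[of _ e] by metis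

lemma laplacian_eq:
  assumes "\<And>i. second_derivative_along P (axis i 1) (P2 i)"
  shows "laplacian P = (\<lambda>x. \<Sum>i\<in>UNIV. P2 i x)"
  unfolding laplacian_def using second_derivative_along_deriv[OF assms] by auto

lemma polynomial_laplacian:
  assumes "real_polynomial_function P"
  obtains P2 where "\<And>i. real_polynomial_function (P2 i)" "\<And>i. second_derivative_along P (axis i 1) (P2 i)"
proof -
  have "\<forall>i. \<exists>P2. real_polynomial_function P2 \<and> second_derivative_along P (axis i 1) P2"
    using polynomial_second_derivative_along[OF assms] by blast
  from choice[OF this] show ?thesis using that by blast
qed

lemma real_polynomial_function_laplacian:
  assumes "real_polynomial_function P"
  shows "real_polynomial_function (laplacian P)"
proof -
  obtain P2 where P2: "\<And>i. real_polynomial_function (P2 i)" "\<And>i. second_derivative_along P (axis i 1) (P2 i)"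
    using polynomial_laplacian[OF assms] by blast
  show ?thesis
    unfolding laplacian_eq[OF P2(2)] by (rule real_polynomial_function_sum) (auto simp: P2(1))
qed

lemma laplacian_add:
  assumes "real_polynomial_function P" "real_polynomial_function Q"
  shows "laplacian (\<lambda>x. P x + Q x) = (\<lambda>x. laplacian P x + laplacian Q x)"
proof -
  obtain P2 where P2: "\<And>i. second_derivative_along P (axis i 1) (P2 i)"
    using polynomial_laplacian[OF assms(1)] by metis
  obtain Q2 where Q2: "\<And>i. second_derivative_along Q (axis i 1) (Q2 i)"
    using polynomial_laplacian[OF assms(2)] by metis
  show ?thesis
    unfolding laplacian_eq[OF P2] laplacian_eq[OF Q2] laplacian_eq[OF second_derivative_along_add[OF P2 Q2]]
    by (simp add: sum.distrib)
qed

lemma laplacian_cmult: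
  assumes "real_polynomial_function P"
  shows "laplacian (\<lambda>x. c * P x) = (\<lambda>x. c * laplacian P x)"
proof -
  obtain P2 where P2: "\<And>i. second_derivative_along P (axis i 1) (P2 i)"
    using polynomial_laplacian[OF assms(1)] by metis
  show ?thesis
    unfolding laplacian_eq[OF P2] laplacian_eq[OF second_derivative_along_cmult[OF P2]]
    by (simp add: sum_distrib_left)
qed

lemma laplacian_sum:
  assumes "finite I" "\<And>i. i \<in> I \<Longrightarrow> real_polynomial_function (P i)"
  shows "laplacian (\<lambda>x. \<Sum>i\<in>I. P i x) = (\<lambda>x. \<Sum>i\<in>I. laplacian (P i) x)"
  using assms
proof (induction I rule: finite_induct)
  case empty
  have "laplacian (\<lambda>x. 0 * 0 :: real) = (\<lambda>x::real^'b. 0 * laplacian (\<lambda>x. 0) x)"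
    by (rule laplacian_cmult) auto
  then show ?case by simp
next
  case (insert i I)
  then have "laplacian (\<lambda>x. P i x + (\<Sum>i\<in>I. P i x)) = (\<lambda>x. laplacian (P i) x + laplacian (\<lambda>x. \<Sum>i\<in>I. P i x) x)"
    by (intro laplacian_add) auto
  then show ?case using insert by simp
qed

text \<open>The product rule along each axis, summed with the Parseval identities \<open>s1\<close>,
  \<open>s2\<close>, \<open>s3\<close>. The second constant collects 4aj + 4j(j-1) + 2jd. Truncated
  exponents \<open>a - 2\<close> and \<open>j - 1\<close> are harmless, since their coefficients
  vanish whenever truncation occurs.\<close>

lemma laplacian_zonal:
  fixes v :: "real^'n"
  shows "laplacian (\<lambda>x. (x \<bullet> v) ^ a * (x \<bullet> x) ^ j) =
    (\<lambda>x. real a * (real a - 1) * (v \<bullet> v) * ((x \<bullet> v) ^ (a - 2) * (x \<bullet> x) ^ j)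
       + 2 * real j * (2 * real a + 2 * real j - 2 + real CARD('n)) * ((x \<bullet> v) ^ a * (x \<bullet> x) ^ (j - 1)))"
proof -
  define P1 where "P1 = (\<lambda>e x. real a * (x \<bullet> v) ^ (a - 1) * (e \<bullet> v) * (x \<bullet> x) ^ j
     + (x \<bullet> v) ^ a * (real j * (x \<bullet> x) ^ (j - 1) * (2 * (x \<bullet> e))))"
  define P2 where "P2 = (\<lambda>e x. real a * (real (a - 1) * (x \<bullet> v) ^ (a - 1 - 1) * (e \<bullet> v)) * (e \<bullet> v) * (x \<bullet> x) ^ j
     + 2 * (real a * (x \<bullet> v) ^ (a - 1) * (e \<bullet> v) * (real j * (x \<bullet> x) ^ (j - 1) * (2 * (x \<bullet> e))))
     + (x \<bullet> v) ^ a * (real j * (real (j - 1) * (x \<bullet> x) ^ (j - 1 - 1) * (2 * (x \<bullet> e))) * (2 * (x \<bullet> e))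
        + real j * (x \<bullet> x) ^ (j - 1) * (2 * (e \<bullet> e))))"
  have s: "((\<lambda>t. (x + t *\<^sub>R e) \<bullet> w) has_real_derivative e \<bullet> w) (at t)" for x e w :: "real^'n" and t
    by (auto simp: inner_add_left intro!: derivative_eq_intros)
  have r: "((\<lambda>t. (x + t *\<^sub>R e) \<bullet> (x + t *\<^sub>R e)) has_real_derivative 2 * ((x + t *\<^sub>R e) \<bullet> e)) (at t)"
    for x e :: "real^'n" and t
    by (simp add: inner_add_left inner_add_right) (auto intro!: derivative_eq_intros simp: inner_commute)
  have "second_derivative_along (\<lambda>x. (x \<bullet> v) ^ a * (x \<bullet> x) ^ j) e (P2 e)" for e
    unfolding second_derivative_along_def
  proof (intro exI[of _ "P1 e"] conjI allI)
    fix x t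
    show "((\<lambda>t. ((x + t *\<^sub>R e) \<bullet> v) ^ a * ((x + t *\<^sub>R e) \<bullet> (x + t *\<^sub>R e)) ^ j) has_real_derivative P1 e (x + t *\<^sub>R e)) (at t)"
      unfolding P1_def by (rule derivative_eq_intros s r refl)+ (simp add: algebra_simps)
    show "((\<lambda>t. P1 e (x + t *\<^sub>R e)) has_real_derivative P2 e (x + t *\<^sub>R e)) (at t)"
      unfolding P1_def P2_def by (rule derivative_eq_intros s r refl)+ (simp add: algebra_simps)
  qed
  then have lap: "laplacian (\<lambda>x. (x \<bullet> v) ^ a * (x \<bullet> x) ^ j) = (\<lambda>x. \<Sum>i\<in>UNIV. P2 (axis i 1) x)"
    by (rule laplacian_eq)
  show ?thesis
  proof
    fix x
    have s1: "(\<Sum>i\<in>UNIV. (axis i 1 \<bullet> v) * (axis i 1 \<bullet> v)) = v \<bullet> v"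
      and s2: "(\<Sum>i\<in>UNIV. (axis i 1 \<bullet> v) * (x \<bullet> axis i 1)) = x \<bullet> v"
      and s3: "(\<Sum>i\<in>UNIV. (x \<bullet> axis i 1) * (x \<bullet> axis i 1)) = x \<bullet> x"
      unfolding inner_axis inner_axis' by (simp_all add: inner_vec_def mult.commute)
    define A where "A = real a * (real a - 1) * (x \<bullet> v) ^ (a - 2) * (x \<bullet> x) ^ j"
    define B where "B = 4 * real a * real j * (x \<bullet> v) ^ (a - 1) * (x \<bullet> x) ^ (j - 1)"
    define C where "C = 4 * real j * (real j - 1) * (x \<bullet> v) ^ a * (x \<bullet> x) ^ (j - 2)"
    define D where "D = 2 * real j * (x \<bullet> v) ^ a * (x \<bullet> x) ^ (j - 1)"
    have P2: "P2 e x = A * ((e \<bullet> v) * (e \<bullet> v)) + B * ((e \<bullet> v) * (x \<bullet> e)) + C * ((x \<bullet> e) * (x \<bullet> e)) + D * (e \<bullet> e)" for e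
    proof -
      \<comment> \<open>Differentiation produces the truncated \<open>real (a - 1)\<close>; it
        differs from \<open>real a - 1\<close> only at \<open>a = 0\<close>, where the factor
        \<open>real a\<close> is zero. Likewise for \<open>j\<close> below.\<close>
      have A: "A = real a * real (a - 1) * (x \<bullet> v) ^ (a - 2) * (x \<bullet> x) ^ j"
        unfolding A_def by (cases a) auto
      have C: "C = 4 * real j * real (j - 1) * (x \<bullet> v) ^ a * (x \<bullet> x) ^ (j - 2)"
        unfolding C_def by (cases j) auto
      show ?thesis
        unfolding P2_def A C B_def D_def diff_diff_add one_add_one
        by (simp add: algebra_simps)
    qed
    have "(\<Sum>i\<in>UNIV. P2 (axis i 1) x) = A * (v \<bullet> v) + B * (x \<bullet> v) + C * (x \<bullet> x) + D * real CARD('n)"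
      unfolding P2 sum.distrib sum_distrib_left[symmetric] s1 s2 s3 by (simp add: inner_axis)
    also have "B * (x \<bullet> v) = 4 * real a * real j * ((x \<bullet> v) ^ a * (x \<bullet> x) ^ (j - 1))"
      unfolding B_def by (cases a) auto
    also have "C * (x \<bullet> x) = 4 * real j * (real j - 1) * ((x \<bullet> v) ^ a * (x \<bullet> x) ^ (j - 1))"
    proof (cases "j \<le> 1")
      case True
      then have "j = 0 \<or> j = 1" by auto
      then show ?thesis unfolding C_def by auto
    next
      case False
      then obtain i where "j = Suc (Suc i)" by (metis add_2_eq_Suc le_Suc_ex not_less_eq_eq Suc_1 One_nat_def)
      then show ?thesis unfolding C_def by simp
    qed
    finally show "laplacian (\<lambda>x. (x \<bullet> v) ^ a * (x \<bullet> x) ^ j) x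
       = real a * (real a - 1) * (v \<bullet> v) * ((x \<bullet> v) ^ (a - 2) * (x \<bullet> x) ^ j)
       + 2 * real j * (2 * real a + 2 * real j - 2 + real CARD('n)) * ((x \<bullet> v) ^ a * (x \<bullet> x) ^ (j - 1))"
      unfolding lap A_def D_def by (simp add: algebra_simps)
  qed
qed

text \<open>The recursion for the coefficients makes the Laplacian of \<open>zonal_harmonic\<close> telescope to zero.\<close>

fun zonal_coeff :: "nat \<Rightarrow> nat \<Rightarrow> nat \<Rightarrow> real" where
  "zonal_coeff d r 0 = 1"
| "zonal_coeff d r (Suc j) = - zonal_coeff d r j * (real (2 * r - 2 * j) * (real (2 * r - 2 * j) - 1))
     / (2 * real (Suc j) * (2 * real (2 * r - 2 * Suc j) + 2 * real (Suc j) - 2 + real d))"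

text \<open>For unit \<open>v\<close> its restriction to the sphere is a multiple of the Gegenbauer
  polynomial (Chebyshev if d = 2) of degree \<open>2 * r\<close> in \<open>x \<bullet> v\<close>.
  The coefficient 1 at \<open>j = 0\<close> later isolates the top power.\<close>

definition zonal_harmonic :: "nat \<Rightarrow> real^'n \<Rightarrow> real^'n \<Rightarrow> real" where
  "zonal_harmonic r v x =
    (\<Sum>j\<le>r. zonal_coeff CARD('n) r j * ((x \<bullet> v) ^ (2 * r - 2 * j) * (x \<bullet> x) ^ j))"

lemma homogeneous_zonal_harmonic: "homogeneous_polynomial (2 * r) (zonal_harmonic r v)"
  unfolding homogeneous_polynomial_def
proof (intro conjI allI)
  show "real_polynomial_function (zonal_harmonic r v)"
    unfolding zonal_harmonic_def
    by (rule real_polynomial_function_sum) (auto intro: real_polynomial_function.intros)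
  fix c x
  have "((c *\<^sub>R x) \<bullet> v) ^ (2 * r - 2 * j) * ((c *\<^sub>R x) \<bullet> (c *\<^sub>R x)) ^ j
      = c ^ (2 * r) * ((x \<bullet> v) ^ (2 * r - 2 * j) * (x \<bullet> x) ^ j)" if "j \<le> r" for j
  proof -
    have "c ^ (2 * r - 2 * j) * (c * c) ^ j = c ^ (2 * r)"
      using that by (simp add: power_mult_distrib power_add[symmetric] mult_2[symmetric] flip: mult_2)
    then show ?thesis by (simp add: power_mult_distrib mult_ac)
  qed
  then show "zonal_harmonic r v (c *\<^sub>R x) = c ^ (2 * r) * zonal_harmonic r v x"
    unfolding zonal_harmonic_def sum_distrib_left by (intro sum.cong) (auto simp: mult_ac)
qed

lemma laplacian_zonal_harmonic:
  fixes v :: "real^'n"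
  assumes "norm v = 1"
  shows "laplacian (zonal_harmonic r v) x = 0"
proof -
  let ?a = "zonal_coeff CARD('n) r"
  have vv: "v \<bullet> v = 1" using assms by (simp add: dot_square_norm)
  define p where "p = (\<lambda>j. real (2 * r - 2 * j) * (real (2 * r - 2 * j) - 1) * ((x \<bullet> v) ^ (2 * r - 2 * j - 2) * (x \<bullet> x) ^ j))"
  define q where "q = (\<lambda>j. 2 * real j * (2 * real (2 * r - 2 * j) + 2 * real j - 2 + real CARD('n)) * ((x \<bullet> v) ^ (2 * r - 2 * j) * (x \<bullet> x) ^ (j - 1)))"
  have "laplacian (zonal_harmonic r v) x = (\<Sum>j\<le>r. ?a j * (p j + q j))"
    unfolding zonal_harmonic_def
    by (subst laplacian_sum) (auto simp: laplacian_cmult laplacian_zonal vv p_def q_def)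
  also have "\<dots> = (\<Sum>j<Suc r. ?a j * p j) + (\<Sum>j<Suc r. ?a j * q j)"
    by (simp add: algebra_simps sum.distrib lessThan_Suc_atMost)
  \<comment> \<open>The end terms drop out: \<open>p r\<close> contains the factor
    \<open>2 * r - 2 * r\<close>, and \<open>q 0\<close> the factor 0. After the shift,
    \<open>q (Suc j)\<close> cancels \<open>p j\<close>.\<close>
  also have "(\<Sum>j<Suc r. ?a j * p j) = (\<Sum>j<r. ?a j * p j)"
    by (simp add: p_def)
  also have "(\<Sum>j<Suc r. ?a j * q j) = (\<Sum>j<r. ?a (Suc j) * q (Suc j))"
    by (subst sum.lessThan_Suc_shift) (simp add: q_def)
  also have "\<dots> = (\<Sum>j<r. - (?a j * p j))"
  proof (rule sum.cong[OF refl])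
    fix j assume "j \<in> {..<r}"
    \<comment> \<open>The denominator in the recursion is positive, so the recursion can be
      multiplied out.\<close>
    have "2 * real (Suc j) * (2 * real (2 * r - 2 * Suc j) + 2 * real (Suc j) - 2 + real CARD('n)) > 0"
    proof (intro mult_pos_pos)
      have "real CARD('n) \<le> 2 * real (2 * r - 2 * Suc j) + 2 * real (Suc j) - 2 + real CARD('n)" by simp
      then show "0 < 2 * real (2 * r - 2 * Suc j) + 2 * real (Suc j) - 2 + real CARD('n)"
        by (rule less_le_trans[rotated]) simp
    qed auto
    then have "?a (Suc j) * (2 * real (Suc j) * (2 * real (2 * r - 2 * Suc j) + 2 * real (Suc j) - 2 + real CARD('n)))
       = - ?a j * (real (2 * r - 2 * j) * (real (2 * r - 2 * j) - 1))"
      unfolding zonal_coeff.simps by (simp only: nonzero_divide_eq_eq[OF less_imp_neq[symmetric]] times_divide_eq_left nonzero_mult_div_cancel_right)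
    moreover have "2 * r - 2 * Suc j = 2 * r - 2 * j - 2" by simp
    ultimately show "?a (Suc j) * q (Suc j) = - (?a j * p j)"
      unfolding q_def p_def by (simp only: mult.assoc[symmetric] diff_Suc_1 mult_minus_left)
  qed
  finally show ?thesis by (simp add: sum_negf)
qed

section \<open>Quadrature on the sphere\<close>

lemma atomic_integral_superset:
  assumes "finite S" "Poly_Mapping.keys \<mu> \<subseteq> S"
  shows "atomic_integral \<mu> f = (\<Sum>x\<in>S. Poly_Mapping.lookup \<mu> x * f x)"
  unfolding atomic_integral_def
  by (rule sum.mono_neutral_left[OF assms]) (simp add: in_keys_iff)

lemma atomic_integral_plus:
  "atomic_integral (\<mu> + \<nu>) f = atomic_integral \<mu> f + atomic_integral \<nu> f"
  using Poly_Mapping.keys_add[of \<mu> \<nu>]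
  by (simp add: atomic_integral_superset[of "Poly_Mapping.keys \<mu> \<union> Poly_Mapping.keys \<nu>"]
      lookup_add sum.distrib[symmetric] algebra_simps)

lemma atomic_integral_single: "atomic_integral (Poly_Mapping.single x w) f = w * f x"
  by (simp add: atomic_integral_superset[of "{x}"])

lemma atomic_integral_sum_measure:
  assumes "finite I"
  shows "atomic_integral (\<Sum>i\<in>I. \<mu> i) f = (\<Sum>i\<in>I. atomic_integral (\<mu> i) f)"
  using assms
  by (induction I rule: finite_induct) (auto simp: atomic_integral_plus, simp add: atomic_integral_def)

lemma atomic_integral_cong:
  assumes "\<And>x. x \<in> Poly_Mapping.keys \<mu> \<Longrightarrow> f x = g x"
  shows "atomic_integral \<mu> f = atomic_integral \<mu> g"
  unfolding atomic_integral_def using assms by (auto intro: sum.cong)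

lemma atomic_integral_add:
  "atomic_integral \<mu> (\<lambda>x. f x + g x) = atomic_integral \<mu> f + atomic_integral \<mu> g"
  by (simp add: atomic_integral_def sum.distrib algebra_simps)

lemma atomic_integral_cmult: "atomic_integral \<mu> (\<lambda>x. c * f x) = c * atomic_integral \<mu> f"
  by (simp add: atomic_integral_def sum_distrib_left algebra_simps)

lemma atomic_integral_sum:
  "atomic_integral \<mu> (\<lambda>x. \<Sum>i\<in>I. f i x) = (\<Sum>i\<in>I. atomic_integral \<mu> (f i))"
  unfolding atomic_integral_def sum_distrib_left by (rule sum.swap)

lemma atomic_measure_eq_sum_single:
  "\<mu> = (\<Sum>x\<in>Poly_Mapping.keys \<mu>. Poly_Mapping.single x (Poly_Mapping.lookup \<mu> x))"
proof (rule poly_mapping_eqI)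
  fix k
  have "(\<Sum>x\<in>Poly_Mapping.keys \<mu>. Poly_Mapping.lookup (Poly_Mapping.single x (Poly_Mapping.lookup \<mu> x)) k)
      = (\<Sum>x\<in>Poly_Mapping.keys \<mu>. if x = k then Poly_Mapping.lookup \<mu> k else 0)"
    by (intro sum.cong) (auto simp: lookup_single when_def)
  also have "\<dots> = Poly_Mapping.lookup \<mu> k"
    by (simp add: in_keys_iff)
  finally show "Poly_Mapping.lookup \<mu> k = Poly_Mapping.lookup (\<Sum>x\<in>Poly_Mapping.keys \<mu>. Poly_Mapping.single x (Poly_Mapping.lookup \<mu> x)) k"
    by (simp add: lookup_sum)
qed

text \<open>Replaces a list of nodes, in which points may repeat and weights cancel, by the support.
  Conversely an enumeration of the support serves as the list.\<close>

lemma directional_rule_iff: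
  "directional_rule \<mu> \<longleftrightarrow> Poly_Mapping.keys \<mu> \<subseteq> sphere 0 1 \<and> atomic_integral \<mu> (\<lambda>_. 1) = 1"
proof
  assume "directional_rule \<mu>"
  then obtain N :: nat and x w where x: "\<And>j. j \<in> {1..N} \<Longrightarrow> x j \<in> sphere 0 1" and w: "(\<Sum>j=1..N. w j) = 1"
    and \<mu>: "\<mu> = (\<Sum>j=1..N. Poly_Mapping.single (x j) (w j))"
    unfolding directional_rule_def by blast
  have "Poly_Mapping.keys \<mu> \<subseteq> (\<Union>j\<in>{1..N}. Poly_Mapping.keys (Poly_Mapping.single (x j) (w j)))"
    unfolding \<mu> by (rule keys_sum)
  also have "\<dots> \<subseteq> sphere 0 1"
    using x by (auto split: if_splits)
  finally show "Poly_Mapping.keys \<mu> \<subseteq> sphere 0 1 \<and> atomic_integral \<mu> (\<lambda>_. 1) = 1"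
    using w by (simp add: \<mu> atomic_integral_sum_measure atomic_integral_single)
next
  assume \<mu>: "Poly_Mapping.keys \<mu> \<subseteq> sphere 0 1 \<and> atomic_integral \<mu> (\<lambda>_. 1) = 1"
  obtain h where h: "bij_betw h {1..card (Poly_Mapping.keys \<mu>)} (Poly_Mapping.keys \<mu>)"
    using ex_bij_betw_nat_finite_1[OF finite_keys] by blast
  have "\<forall>j\<in>{1..card (Poly_Mapping.keys \<mu>)}. h j \<in> sphere 0 1"
    using \<mu> bij_betwE[OF h] by blast
  moreover have "(\<Sum>j=1..card (Poly_Mapping.keys \<mu>). Poly_Mapping.lookup \<mu> (h j)) = 1"
    using \<mu> sum.reindex_bij_betw[OF h, of "Poly_Mapping.lookup \<mu>"] by (simp add: atomic_integral_def)
  moreover have "\<mu> = (\<Sum>j=1..card (Poly_Mapping.keys \<mu>). Poly_Mapping.single (h j) (Poly_Mapping.lookup \<mu> (h j)))"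
    using atomic_measure_eq_sum_single[of \<mu>]
      sum.reindex_bij_betw[OF h, of "\<lambda>x. Poly_Mapping.single x (Poly_Mapping.lookup \<mu> x)"] by simp
  ultimately show "directional_rule \<mu>"
    unfolding directional_rule_def by blast
qed

lemma lookup_map_scale:
  fixes c :: real
  shows "Poly_Mapping.lookup (Poly_Mapping.map (\<lambda>w. c * w) \<mu>) x = c * Poly_Mapping.lookup \<mu> x"
  by (simp add: Poly_Mapping.map.rep_eq when_def)

lemma lookup_antipodal_symmetrization:
  "Poly_Mapping.lookup (antipodal_symmetrization \<mu>) x
    = (1 / 2) * Poly_Mapping.lookup (\<mu> + atomic_pushforward uminus \<mu>) x"
  unfolding antipodal_symmetrization_def by (rule lookup_map_scale)

lemma keys_antipodal_symmetrization:
  "Poly_Mapping.keys (antipodal_symmetrization \<mu>) \<subseteq> Poly_Mapping.keys (\<mu> + atomic_pushforward uminus \<mu>)"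
  by (auto simp: in_keys_iff lookup_antipodal_symmetrization)

lemma atomic_integral_antipodal_symmetrization:
  "atomic_integral (antipodal_symmetrization \<mu>) f = atomic_integral \<mu> (\<lambda>x. (f x + f (- x)) / 2)"
proof -
  let ?\<nu> = "\<mu> + atomic_pushforward uminus \<mu>"
  have "atomic_integral (antipodal_symmetrization \<mu>) f = (1 / 2) * atomic_integral ?\<nu> f"
  proof -
    have "atomic_integral (antipodal_symmetrization \<mu>) f
        = (\<Sum>x\<in>Poly_Mapping.keys ?\<nu>. Poly_Mapping.lookup (antipodal_symmetrization \<mu>) x * f x)"
      by (intro atomic_integral_superset keys_antipodal_symmetrization) auto
    then show ?thesis
      unfolding lookup_antipodal_symmetrization
      by (simp add: atomic_integral_def sum_distrib_left mult.assoc)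
  qed
  moreover have "atomic_integral (atomic_pushforward uminus \<mu>) f = atomic_integral \<mu> (\<lambda>x. f (- x))"
    unfolding atomic_pushforward_def by (simp add: atomic_integral_sum_measure atomic_integral_single)
      (simp add: atomic_integral_def)
  ultimately show ?thesis
    using atomic_integral_cmult[of \<mu> "1/2" "\<lambda>x. f x + f (- x)"]
    by (simp add: atomic_integral_plus atomic_integral_add)
qed

lemma directional_rule_antipodal_symmetrization:
  assumes "directional_rule \<mu>"
  shows "directional_rule (antipodal_symmetrization \<mu>)"
proof -
  have \<mu>: "Poly_Mapping.keys \<mu> \<subseteq> sphere 0 1" "atomic_integral \<mu> (\<lambda>_. 1) = 1"
    using assms by (auto simp: directional_rule_iff)
  have "Poly_Mapping.keys (antipodal_symmetrization \<mu>) \<subseteq> Poly_Mapping.keys (\<mu> + atomic_pushforward uminus \<mu>)"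
    by (rule keys_antipodal_symmetrization)
  also have "\<dots> \<subseteq> Poly_Mapping.keys \<mu> \<union> Poly_Mapping.keys (atomic_pushforward uminus \<mu>)"
    by (rule Poly_Mapping.keys_add)
  also have "Poly_Mapping.keys (atomic_pushforward uminus \<mu>)
      \<subseteq> (\<Union>x\<in>Poly_Mapping.keys \<mu>. Poly_Mapping.keys (Poly_Mapping.single (- x) (Poly_Mapping.lookup \<mu> x)))"
    unfolding atomic_pushforward_def by (rule keys_sum)
  also have "\<dots> \<subseteq> uminus ` Poly_Mapping.keys \<mu>" by (auto split: if_splits)
  finally have "Poly_Mapping.keys (antipodal_symmetrization \<mu>) \<subseteq> sphere 0 1"
    using \<mu>(1) by fastforce
  then show ?thesis
    using \<mu>(2) by (simp add: directional_rule_iff atomic_integral_antipodal_symmetrization)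
qed

text \<open>The condition on \<open>m\<close> matters at \<open>x = 0\<close>, where
  \<open>0 powr 0\<close> is 0 but \<open>0 ^ 0\<close> is 1.\<close>

lemma abs_powr_even: "m \<ge> 1 \<Longrightarrow> \<bar>x\<bar> powr real (2 * m) = x ^ (2 * m)" for x :: real
  by (cases "x = 0") (auto simp: powr_realpow power_even_abs simp del: of_nat_mult)

lemma power_square_split:
  fixes c :: real
  assumes "r \<le> m"
  shows "(c * c) ^ (m - r) * c ^ (2 * r) = c ^ (2 * m)"
proof -
  have m: "2 * m = 2 * (m - r) + 2 * r" using assms by simp
  show ?thesis unfolding m by (simp only: power_add power_mult power2_eq_square)
qed

lemma continuous_on_real_polynomial_function:
  "real_polynomial_function P \<Longrightarrow> continuous_on S P"
  by (simp add: real_polynomial_function_eq continuous_on_polymonial_function)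

section \<open>Integration against the uniform measure\<close>

context
  fixes \<sigma> :: "(real^'n) measure"
  assumes \<sigma>: "uniform_sphere_measure \<sigma>"
begin

lemma sets_uniform_sphere [measurable_cong]: "sets \<sigma> = sets (restrict_space borel (sphere 0 1))"
  and space_uniform_sphere: "space \<sigma> = sphere 0 1"
  and prob_space_uniform_sphere: "prob_space \<sigma>"
proof -
  show s: "sets \<sigma> = sets (restrict_space borel (sphere 0 1))" and "prob_space \<sigma>"
    using \<sigma> by (auto simp: uniform_sphere_measure_def)
  show "space \<sigma> = sphere 0 1"
    using sets_eq_imp_space_eq[OF s] by (simp add: space_restrict_space)
qed

lemma borel_measurable_uniform_sphere:
  assumes "g \<in> borel_measurable borel"
  shows "g \<in> borel_measurable \<sigma>"
  unfolding measurable_cong_sets[OF sets_uniform_sphere refl] using assms by (rule measurable_restrict_space1)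

lemma integrable_uniform_sphere:
  fixes g :: "real^'n \<Rightarrow> real"
  assumes "continuous_on UNIV g"
  shows "integrable \<sigma> g"
proof -
  interpret prob_space \<sigma> by (rule prob_space_uniform_sphere)
  have "bounded (g ` sphere 0 1)"
    using assms by (intro compact_imp_bounded compact_continuous_image) (auto intro: continuous_on_subset)
  then obtain B where "\<forall>y\<in>g ` sphere 0 1. norm y \<le> B"
    unfolding bounded_iff by blast
  then have "\<And>u. u \<in> sphere 0 1 \<Longrightarrow> norm (g u) \<le> B" by blast
  then show ?thesis
    using assms by (intro integrable_const_bound[of _ B] AE_I2 borel_measurable_uniform_sphere
        borel_measurable_continuous_onI) (auto simp: space_uniform_sphere)
qed

lemma integrable_uniform_sphere_polynomial:
  "real_polynomial_function P \<Longrightarrow> integrable \<sigma> P"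
  by (intro integrable_uniform_sphere continuous_on_real_polynomial_function)

text \<open>Invariance is assumed only under rotations of determinant 1, and in dimension at least 2
  one of these carries \<open>v\<close> to \<open>w\<close>.\<close>

lemma integral_uniform_sphere_zonal:
  fixes g :: "real \<Rightarrow> real"
  assumes dim: "CARD('n) \<ge> 2" and g: "continuous_on UNIV g" and v: "norm v = norm w"
  shows "(\<integral>u. g (u \<bullet> v) \<partial>\<sigma>) = (\<integral>u. g (u \<bullet> w) \<partial>\<sigma>)"
proof -
  obtain f where f: "orthogonal_transformation f" "det (matrix f) = 1" "f v = w"
    using rotation_exists[OF dim v] by blast
  have d: "distr \<sigma> \<sigma> f = \<sigma>" using \<sigma> f by (auto simp: uniform_sphere_measure_def)
  have cont: "continuous_on UNIV f"
    by (intro linear_continuous_on orthogonal_transformation_linear[OF f(1), unfolded linear_conv_bounded_linear])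
  have mf: "f \<in> measurable \<sigma> \<sigma>"
    unfolding measurable_cong_sets[OF refl sets_uniform_sphere]
    by (intro measurable_restrict_space2 borel_measurable_uniform_sphere borel_measurable_continuous_onI cont)
      (auto simp: space_uniform_sphere orthogonal_transformation_norm[OF f(1)])
  have "(\<integral>u. g (u \<bullet> w) \<partial>\<sigma>) = (\<integral>u. g (u \<bullet> w) \<partial>distr \<sigma> \<sigma> f)" by (simp add: d)
  also have "\<dots> = (\<integral>u. g (f u \<bullet> w) \<partial>\<sigma>)"
    by (intro integral_distr mf borel_measurable_uniform_sphere borel_measurable_continuous_onI
        continuous_on_compose2[OF g] continuous_intros) auto
  also have "\<dots> = (\<integral>u. g (u \<bullet> v) \<partial>\<sigma>)"
    using f(1) unfolding f(3)[symmetric] orthogonal_transformation_def by simp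
  finally show ?thesis by simp
qed

text \<open>By rotation and scaling it suffices to treat a coordinate vector. If \<open>c\<close>
  were 0, all coordinate moments would vanish, hence so would the integral of their sum, whose
  integrand is positive on the sphere.\<close>

lemma even_moment_exists:
  assumes dim: "CARD('n) \<ge> 2"
  obtains c where "c > 0" "\<And>v. (\<integral>u. (u \<bullet> v) ^ (2 * k) \<partial>\<sigma>) = c * (v \<bullet> v) ^ k"
proof -
  interpret prob_space \<sigma> by (rule prob_space_uniform_sphere)
  obtain i :: 'n where True by simp
  define c where "c = (\<integral>u. (u \<bullet> axis i 1) ^ (2 * k) \<partial>\<sigma>)"
  have eq: "(\<integral>u. (u \<bullet> v) ^ (2 * k) \<partial>\<sigma>) = c * (v \<bullet> v) ^ k" for v
  proof -
    have "(\<integral>u. (u \<bullet> v) ^ (2 * k) \<partial>\<sigma>) = (\<integral>u. (u \<bullet> (norm v *\<^sub>R axis i 1)) ^ (2 * k) \<partial>\<sigma>)"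
      by (intro integral_uniform_sphere_zonal[OF dim, of "\<lambda>s. s ^ (2 * k)"] continuous_intros) simp
    also have "\<dots> = (\<integral>u. norm v ^ (2 * k) * (u \<bullet> axis i 1) ^ (2 * k) \<partial>\<sigma>)"
      by (simp add: power_mult_distrib)
    also have "\<dots> = norm v ^ (2 * k) * c" by (simp add: c_def)
    also have "norm v ^ (2 * k) = (v \<bullet> v) ^ k"
      by (simp add: power_mult power2_norm_eq_inner)
    finally show ?thesis by simp
  qed
  have int: "integrable \<sigma> (\<lambda>u. (u \<bullet> axis j 1) ^ (2 * k))" for j
    by (intro integrable_uniform_sphere continuous_intros)
  have "c \<ge> 0" unfolding c_def by (intro integral_nonneg_AE AE_I2) simp
  moreover have "c \<noteq> 0"
  proof
    assume "c = 0"
    then have "(\<integral>u. (\<Sum>j\<in>UNIV. (u \<bullet> axis j 1) ^ (2 * k)) \<partial>\<sigma>) = 0"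
      by (subst Bochner_Integration.integral_sum) (auto intro: int simp: eq)
    moreover have "integrable \<sigma> (\<lambda>u. \<Sum>j\<in>UNIV. (u \<bullet> axis j 1) ^ (2 * k))"
      by (intro Bochner_Integration.integrable_sum int)
    ultimately have "AE u in \<sigma>. (\<Sum>j\<in>UNIV. (u \<bullet> axis j 1) ^ (2 * k)) = 0"
      by (subst integral_nonneg_eq_0_iff_AE[symmetric]) (auto intro!: sum_nonneg)
    moreover have "AE u in \<sigma>. (\<Sum>j\<in>UNIV. (u \<bullet> axis j 1) ^ (2 * k)) \<noteq> 0"
    proof (rule AE_I2)
      fix u assume "u \<in> space \<sigma>"
      then have "u \<noteq> 0" by (auto simp: space_uniform_sphere)
      then obtain j where "u $ j \<noteq> 0" by (auto simp: vec_eq_iff)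
      then have "(u \<bullet> axis j 1) ^ (2 * k) > 0" by (simp add: inner_axis power_mult)
      then have "(\<Sum>j\<in>UNIV. (u \<bullet> axis j 1) ^ (2 * k)) > 0"
        by (intro sum_pos2[of _ j]) auto
      then show "(\<Sum>j\<in>UNIV. (u \<bullet> axis j 1) ^ (2 * k)) \<noteq> 0" by simp
    qed
    ultimately have "AE u in \<sigma>. False" by eventually_elim simp
    then show False by simp
  qed
  ultimately show ?thesis using eq by (intro that[of c]) auto
qed

text \<open>
  On powers of linear forms, and hence on all homogeneous polynomials of degree \<open>2 * k\<close>, the
  integrals of \<open>P\<close> and \<open>laplacian P\<close> are proportional, with a nonzero factor.
\<close>

lemma integral_harmonic_eq_0:
  assumes dim: "CARD('n) \<ge> 2" and k: "k \<ge> 1"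
    and P: "homogeneous_polynomial (2 * k) P" and harm: "\<And>x. laplacian P x = 0"
  shows "(\<integral>u. P u \<partial>\<sigma>) = 0"
proof -
  obtain c where c: "c > 0" "\<And>v. (\<integral>u. (u \<bullet> v) ^ (2 * k) \<partial>\<sigma>) = c * (v \<bullet> v) ^ k"
    using even_moment_exists[OF dim, of k] by blast
  obtain b where b: "b > 0" "\<And>v. (\<integral>u. (u \<bullet> v) ^ (2 * (k - 1)) \<partial>\<sigma>) = b * (v \<bullet> v) ^ (k - 1)"
    using even_moment_exists[OF dim, of "k - 1"] by blast
  define K where "K = real (2 * k) * (real (2 * k) - 1) * b"
  have "K > 0" using k b by (simp add: K_def)
  \<comment> \<open>The factors are crossed: on \<open>(x \<bullet> v) ^ (2 * k)\<close> the first
    integral is \<open>K * (v \<bullet> v) ^ k\<close> and the second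
    \<open>c * (v \<bullet> v) ^ k\<close>, so \<open>L\<close> vanishes there.\<close>
  define L where "L = (\<lambda>P. c * (\<integral>u. laplacian P u \<partial>\<sigma>) - K * (\<integral>u. P u \<partial>\<sigma>))"
  have "L P = 0"
  proof (rule homogeneous_functional_zero[of L "2 * k"])
    show "L (\<lambda>x. P x + Q x) = L P + L Q"
      if "real_polynomial_function P" "real_polynomial_function Q" for P Q
      using that
      by (simp add: L_def laplacian_add integrable_uniform_sphere_polynomial real_polynomial_function_laplacian algebra_simps)
    show "L (\<lambda>x. c * P x) = c * L P" if "real_polynomial_function P" for c P
      using that by (simp add: L_def laplacian_cmult algebra_simps)
    show "L (\<lambda>x. (x \<bullet> v) ^ (2 * k)) = 0" for v
    proof -
      have "laplacian (\<lambda>x. (x \<bullet> v) ^ (2 * k)) = (\<lambda>x. real (2 * k) * (real (2 * k) - 1) * (v \<bullet> v) * (x \<bullet> v) ^ (2 * (k - 1)))"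
        using laplacian_zonal[of v "2 * k" 0] by (simp add: diff_mult_distrib2)
      then have "(\<integral>u. laplacian (\<lambda>x. (x \<bullet> v) ^ (2 * k)) u \<partial>\<sigma>)
          = real (2 * k) * (real (2 * k) - 1) * (v \<bullet> v) * (b * (v \<bullet> v) ^ (k - 1))"
        by (simp only: integral_mult_right_zero b(2))
      also have "\<dots> = K * ((v \<bullet> v) * (v \<bullet> v) ^ (k - 1))" by (simp add: K_def mult_ac)
      also have "(v \<bullet> v) * (v \<bullet> v) ^ (k - 1) = (v \<bullet> v) ^ k" using k by (cases k) auto
      finally show ?thesis by (simp add: L_def c(2))
    qed
  qed (rule P)
  moreover have "laplacian P = (\<lambda>x. 0)" using harm by auto
  ultimately show ?thesis using \<open>K > 0\<close> by (simp add: L_def)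
qed

text \<open>The quadrature error is a linear functional that vanishes on powers of linear forms: for
  unit vectors by assumption, for others by scaling, and for \<open>v = 0\<close> because the degree
  is positive.\<close>

lemma homogeneous_quadrature:
  assumes m: "m \<ge> 1" and pow: "\<And>v. v \<in> sphere 0 1 \<Longrightarrow>
      atomic_integral \<mu> (\<lambda>u. (u \<bullet> v) ^ (2 * m)) = (\<integral>u. (u \<bullet> v) ^ (2 * m) \<partial>\<sigma>)"
    and P: "homogeneous_polynomial (2 * m) P"
  shows "atomic_integral \<mu> P = (\<integral>u. P u \<partial>\<sigma>)"
proof -
  define L where "L = (\<lambda>P. atomic_integral \<mu> P - (\<integral>u. P u \<partial>\<sigma>))"
  have "L P = 0"
  proof (rule homogeneous_functional_zero[of L "2 * m"])
    show "L (\<lambda>x. P x + Q x) = L P + L Q"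
      if "real_polynomial_function P" "real_polynomial_function Q" for P Q
      using that by (simp add: L_def atomic_integral_add integrable_uniform_sphere_polynomial algebra_simps)
    show cm: "L (\<lambda>x. c * P x) = c * L P" for c P
      by (simp add: L_def atomic_integral_cmult algebra_simps)
    show "L (\<lambda>x. (x \<bullet> v) ^ (2 * m)) = 0" for v
    proof (cases "v = 0")
      case True
      then show ?thesis using m cm[of 0 "\<lambda>x. 0"] by (simp add: power_0_left)
    next
      case False
      have "(\<lambda>x. (x \<bullet> v) ^ (2 * m)) = (\<lambda>x. norm v ^ (2 * m) * (x \<bullet> (v /\<^sub>R norm v)) ^ (2 * m))"
        using False by (auto simp: fun_eq_iff power_mult_distrib power_inverse)
      moreover have "L (\<lambda>x. (x \<bullet> (v /\<^sub>R norm v)) ^ (2 * m)) = 0"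
        using pow[of "v /\<^sub>R norm v"] False by (simp add: L_def)
      ultimately show ?thesis by (simp add: cm)
    qed
  qed (rule P)
  then show ?thesis by (simp add: L_def)
qed

text \<open>Strong induction on \<open>r\<close>. On the sphere the zonal harmonic is the power of
  degree \<open>2 * r\<close> plus lower even powers, and it integrates to zero against both
  measures; so the error for \<open>r\<close> is a combination of errors already known to vanish.
  The base case is the normalization of \<open>\<mu>\<close>.\<close>

lemma power_quadrature_if_harmonics_vanish:
  assumes dim: "CARD('n) \<ge> 2" and \<mu>: "directional_rule \<mu>"
    and harm: "\<And>r Y. r \<in> {1..m} \<Longrightarrow> Y \<in> spherical_harmonics (2 * r) \<Longrightarrow> atomic_integral \<mu> Y = 0"
    and v: "v \<in> sphere 0 1" and "r \<le> m"
  shows "atomic_integral \<mu> (\<lambda>u. (u \<bullet> v) ^ (2 * r)) = (\<integral>u. (u \<bullet> v) ^ (2 * r) \<partial>\<sigma>)"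
  using \<open>r \<le> m\<close>
proof (induction r rule: less_induct)
  case (less r)
  interpret prob_space \<sigma> by (rule prob_space_uniform_sphere)
  have keys: "Poly_Mapping.keys \<mu> \<subseteq> sphere 0 1" and one: "atomic_integral \<mu> (\<lambda>_. 1) = 1"
    using \<mu> by (auto simp: directional_rule_iff)
  show ?case
  proof (cases "r = 0")
    case True
    then show ?thesis using one by (simp add: prob_space)
  next
    case False
    let ?a = "zonal_coeff CARD('n) r"
    have hom: "homogeneous_polynomial (2 * r) (zonal_harmonic r v)"
      and lap: "\<And>x. laplacian (zonal_harmonic r v) x = 0"
      using v by (auto intro: homogeneous_zonal_harmonic laplacian_zonal_harmonic)
    then have "restrict (zonal_harmonic r v) (sphere 0 1) \<in> spherical_harmonics (2 * r)"
      unfolding spherical_harmonics_def by blast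
    then have "atomic_integral \<mu> (restrict (zonal_harmonic r v) (sphere 0 1)) = 0"
      using harm[of r] False less.prems by auto
    also have "atomic_integral \<mu> (restrict (zonal_harmonic r v) (sphere 0 1)) = atomic_integral \<mu> (zonal_harmonic r v)"
      using keys by (intro atomic_integral_cong) auto
    finally have A: "atomic_integral \<mu> (zonal_harmonic r v) = 0" .
    have I: "(\<integral>u. zonal_harmonic r v u \<partial>\<sigma>) = 0"
      using False by (intro integral_harmonic_eq_0[OF dim _ hom lap]) auto
    define e where "e = (\<lambda>s. atomic_integral \<mu> (\<lambda>u. (u \<bullet> v) ^ (2 * s)) - (\<integral>u. (u \<bullet> v) ^ (2 * s) \<partial>\<sigma>))"
    have on_sphere: "zonal_harmonic r v u = (\<Sum>j\<le>r. ?a j * (u \<bullet> v) ^ (2 * (r - j)))" if "u \<in> sphere 0 1" for u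
      using that by (simp add: zonal_harmonic_def dot_square_norm diff_mult_distrib2)
    have int: "integrable \<sigma> (\<lambda>u. ?a j * (u \<bullet> v) ^ (2 * (r - j)))" for j
      by (intro integrable_uniform_sphere continuous_intros)
    have "0 = (\<Sum>j\<le>r. ?a j * atomic_integral \<mu> (\<lambda>u. (u \<bullet> v) ^ (2 * (r - j))))"
    proof -
      have "atomic_integral \<mu> (zonal_harmonic r v) = atomic_integral \<mu> (\<lambda>u. \<Sum>j\<le>r. ?a j * (u \<bullet> v) ^ (2 * (r - j)))"
        using keys on_sphere by (intro atomic_integral_cong) auto
      then show ?thesis using A by (simp add: atomic_integral_sum atomic_integral_cmult)
    qed
    moreover have "0 = (\<Sum>j\<le>r. ?a j * (\<integral>u. (u \<bullet> v) ^ (2 * (r - j)) \<partial>\<sigma>))"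
    proof -
      have "(\<integral>u. zonal_harmonic r v u \<partial>\<sigma>) = (\<integral>u. (\<Sum>j\<le>r. ?a j * (u \<bullet> v) ^ (2 * (r - j))) \<partial>\<sigma>)"
        using on_sphere by (intro Bochner_Integration.integral_cong) (auto simp: space_uniform_sphere)
      then show ?thesis using I int by (subst (asm) Bochner_Integration.integral_sum) auto
    qed
    ultimately have "(\<Sum>j\<le>r. ?a j * e (r - j)) = 0"
      by (simp add: e_def right_diff_distrib sum_subtractf)
    \<comment> \<open>Only \<open>j = 0\<close> survives, and its coefficient is 1.\<close>
    moreover have "(\<Sum>j\<le>r. ?a j * e (r - j)) = (\<Sum>j\<le>r. if j = 0 then e r else 0)"
    proof (rule sum.cong[OF refl])
      fix j assume "j \<in> {..r}"
      then show "?a j * e (r - j) = (if j = 0 then e r else 0)"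
        using less.IH[of "r - j"] less.prems False by (auto simp: e_def)
    qed
    ultimately show ?thesis by (simp add: e_def)
  qed
qed

section \<open>Reduction from bodies to normals\<close>

lemma B_body_discrepancy:
  assumes dim: "CARD('n) \<ge> 2" and p: "p > 0" and K: "convex_body K"
    and \<mu>: "Poly_Mapping.keys \<mu> \<subseteq> sphere 0 1"
  shows "atomic_integral \<mu> (B_body p K) - (\<integral>u. B_body p K u \<partial>\<sigma>)
    = (1 / 2) * (\<integral>v. (atomic_integral \<mu> (\<lambda>u. \<bar>u \<bullet> v\<bar> powr p) - (\<integral>u. \<bar>u \<bullet> v\<bar> powr p \<partial>\<sigma>)) \<partial>surface_area_measure K)"
proof -
  let ?S = "surface_area_measure K"
  interpret S: finite_measure ?S by (rule finite_measure_surface_area_measure[OF K])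
  interpret prob_space \<sigma> by (rule prob_space_uniform_sphere)
  interpret pair_sigma_finite \<sigma> ?S ..
  interpret pair: finite_measure "\<sigma> \<Otimes>\<^sub>M ?S"
    by (intro finite_measure_pair_measure) unfold_locales
  \<comment> \<open>A bounded kernel on a product of finite measures: all integrability needed for
    Fubini follows from this.\<close>
  have bound: "\<bar>u \<bullet> v\<bar> powr p \<le> 1" if "u \<in> sphere 0 1" "v \<in> sphere 0 1" for u v :: "real^'n"
  proof -
    have "\<bar>u \<bullet> v\<bar> \<le> 1" using Cauchy_Schwarz_ineq2[of u v] that by simp
    then show ?thesis using powr_mono2[of p "\<bar>u \<bullet> v\<bar>" 1] p by simp
  qed
  have id\<sigma>: "(\<lambda>x. x) \<in> borel_measurable \<sigma>" by (intro borel_measurable_uniform_sphere) simp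
  have idS: "(\<lambda>x. x) \<in> borel_measurable ?S"
    unfolding measurable_cong_sets[OF sets_surface_area_measure refl] by (rule measurable_restrict_space1) simp
  have meas: "(\<lambda>(u, v). \<bar>u \<bullet> v\<bar> powr p) \<in> borel_measurable (\<sigma> \<Otimes>\<^sub>M ?S)"
    unfolding case_prod_beta
    by (intro measurable_abs_powr borel_measurable_inner
        measurable_compose[OF measurable_fst id\<sigma>] measurable_compose[OF measurable_snd idS])
  have intpair: "integrable (\<sigma> \<Otimes>\<^sub>M ?S) (\<lambda>(u, v). \<bar>u \<bullet> v\<bar> powr p)"
    using meas bound by (intro pair.integrable_const_bound[of _ 1] AE_I2)
      (auto simp: space_pair_measure space_uniform_sphere)
  have intS: "integrable ?S (\<lambda>v. \<bar>u \<bullet> v\<bar> powr p)" if "u \<in> sphere 0 1" for u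
    using bound[OF that] measurable_compose[OF measurable_Pair1' meas, of u] that
    by (intro S.integrable_const_bound[of _ 1] AE_I2) (auto simp: space_uniform_sphere)
  have "atomic_integral \<mu> (B_body p K)
      = (1 / 2) * (\<Sum>x\<in>Poly_Mapping.keys \<mu>. \<integral>v. Poly_Mapping.lookup \<mu> x * \<bar>x \<bullet> v\<bar> powr p \<partial>?S)"
    by (simp add: atomic_integral_def B_body_def sum_distrib_left mult.left_commute)
  also have "(\<Sum>x\<in>Poly_Mapping.keys \<mu>. \<integral>v. Poly_Mapping.lookup \<mu> x * \<bar>x \<bullet> v\<bar> powr p \<partial>?S)
      = (\<integral>v. atomic_integral \<mu> (\<lambda>u. \<bar>u \<bullet> v\<bar> powr p) \<partial>?S)"
    unfolding atomic_integral_def using \<mu> intS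
    by (intro Bochner_Integration.integral_sum[symmetric] integrable_mult_right) auto
  finally have 1: "atomic_integral \<mu> (B_body p K) = (1 / 2) * (\<integral>v. atomic_integral \<mu> (\<lambda>u. \<bar>u \<bullet> v\<bar> powr p) \<partial>?S)" .
  have "(\<integral>u. B_body p K u \<partial>\<sigma>) = (1 / 2) * (\<integral>u. (\<integral>v. \<bar>u \<bullet> v\<bar> powr p \<partial>?S) \<partial>\<sigma>)"
    by (simp add: B_body_def)
  also have "(\<integral>u. (\<integral>v. \<bar>u \<bullet> v\<bar> powr p \<partial>?S) \<partial>\<sigma>) = (\<integral>v. (\<integral>u. \<bar>u \<bullet> v\<bar> powr p \<partial>\<sigma>) \<partial>?S)"
    using Fubini_integral[OF intpair] by simp
  finally have 2: "(\<integral>u. B_body p K u \<partial>\<sigma>) = (1 / 2) * (\<integral>v. (\<integral>u. \<bar>u \<bullet> v\<bar> powr p \<partial>\<sigma>) \<partial>?S)" .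
  have int1: "integrable ?S (\<lambda>v. atomic_integral \<mu> (\<lambda>u. \<bar>u \<bullet> v\<bar> powr p))"
    unfolding atomic_integral_def using \<mu> intS
    by (intro Bochner_Integration.integrable_sum integrable_mult_right) auto
  have int2: "integrable ?S (\<lambda>v. \<integral>u. \<bar>u \<bullet> v\<bar> powr p \<partial>\<sigma>)"
    using integrable_snd[OF intpair] by simp
  show ?thesis
    unfolding 1 2 Bochner_Integration.integral_diff[OF int1 int2] by (simp add: algebra_simps)
qed

text \<open>Fubini turns the identity for all bodies into an identity on the sphere of normals.\<close>

lemma body_quadrature_iff:
  assumes dim: "CARD('n) \<ge> 2" and p: "p > 0" and \<mu>: "Poly_Mapping.keys \<mu> \<subseteq> sphere 0 1"
  shows "(\<forall>K. convex_body K \<longrightarrow> atomic_integral \<mu> (B_body p K) = (\<integral>u. B_body p K u \<partial>\<sigma>))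
    \<longleftrightarrow> (\<forall>v\<in>sphere 0 1. atomic_integral \<mu> (\<lambda>u. \<bar>u \<bullet> v\<bar> powr p) = (\<integral>u. \<bar>u \<bullet> v\<bar> powr p \<partial>\<sigma>))"
proof -
  obtain i :: 'n where True by simp
  define c where "c = (\<integral>u. \<bar>u \<bullet> axis i 1\<bar> powr p \<partial>\<sigma>)"
  have c: "(\<integral>u. \<bar>u \<bullet> v\<bar> powr p \<partial>\<sigma>) = c" if "v \<in> sphere 0 1" for v
    unfolding c_def using that p
    by (intro integral_uniform_sphere_zonal[OF dim, of "\<lambda>s. \<bar>s\<bar> powr p"] continuous_on_powr' continuous_intros) auto
  \<comment> \<open>Subtracting the constant \<open>c\<close>, which equals the mean only for unit
    \<open>v\<close>, makes \<open>F\<close> visibly continuous and even on the whole space.\<close>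
  define F where "F = (\<lambda>v. atomic_integral \<mu> (\<lambda>u. \<bar>u \<bullet> v\<bar> powr p) - c)"
  have disc: "atomic_integral \<mu> (B_body p K) - (\<integral>u. B_body p K u \<partial>\<sigma>) = (1 / 2) * (\<integral>v. F v \<partial>surface_area_measure K)"
    if "convex_body K" for K
    unfolding B_body_discrepancy[OF dim p that \<mu>] F_def
    by (intro arg_cong[of _ _ "(*) (1 / 2)"] Bochner_Integration.integral_cong) (auto simp: c)
  show ?thesis
  proof
    assume all: "\<forall>K. convex_body K \<longrightarrow> atomic_integral \<mu> (B_body p K) = (\<integral>u. B_body p K u \<partial>\<sigma>)"
    have cont: "continuous_on UNIV F"
      unfolding F_def atomic_integral_def using p
      by (intro continuous_intros continuous_on_powr') auto
    have "bounded (F ` sphere 0 1)"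
      using cont by (intro compact_imp_bounded compact_continuous_image) (auto intro: continuous_on_subset)
    then obtain B where "\<forall>y\<in>F ` sphere 0 1. norm y \<le> B"
      unfolding bounded_iff by blast
    then have B: "\<And>u. u \<in> sphere 0 1 \<Longrightarrow> \<bar>F u\<bar> \<le> B" by auto
    have "F v = 0" if "v \<in> sphere 0 1" for v
    proof (rule surface_area_measures_determine_even_function[OF _ B _ _ that])
      show "F \<in> borel_measurable borel" using cont by (rule borel_measurable_continuous_onI)
      show "F (- u) = F u" for u by (simp add: F_def)
      show "(\<integral>u. F u \<partial>surface_area_measure K) = 0" if "convex_body K" for K
        using disc[OF that] all that by simp
    qed
    then show "\<forall>v\<in>sphere 0 1. atomic_integral \<mu> (\<lambda>u. \<bar>u \<bullet> v\<bar> powr p) = (\<integral>u. \<bar>u \<bullet> v\<bar> powr p \<partial>\<sigma>)"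
      by (simp add: F_def c)
  next
    assume v: "\<forall>v\<in>sphere 0 1. atomic_integral \<mu> (\<lambda>u. \<bar>u \<bullet> v\<bar> powr p) = (\<integral>u. \<bar>u \<bullet> v\<bar> powr p \<partial>\<sigma>)"
    show "\<forall>K. convex_body K \<longrightarrow> atomic_integral \<mu> (B_body p K) = (\<integral>u. B_body p K u \<partial>\<sigma>)"
    proof (intro allI impI)
      fix K :: "(real^'n) set" assume K: "convex_body K"
      have "(\<integral>v. F v \<partial>surface_area_measure K) = (\<integral>v. 0 \<partial>surface_area_measure K)"
        using v by (intro Bochner_Integration.integral_cong) (auto simp: F_def c)
      then show "atomic_integral \<mu> (B_body p K) = (\<integral>u. B_body p K u \<partial>\<sigma>)"
        using disc[OF K] by simp
    qed
  qed
qed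

text \<open>Symmetrization does not affect integrals of even functions. An even polynomial of degree
  at most \<open>2 * m\<close> agrees on the sphere with a homogeneous one of degree
  \<open>2 * m\<close>, to which \<open>homogeneous_quadrature\<close> applies.\<close>

lemma design_quadrature_iff:
  assumes \<mu>: "directional_rule \<mu>" and m: "m \<ge> 1"
  shows "weighted_projective_design \<sigma> m (antipodal_symmetrization \<mu>) \<longleftrightarrow>
    (\<forall>v\<in>sphere 0 1. atomic_integral \<mu> (\<lambda>u. (u \<bullet> v) ^ (2 * m)) = (\<integral>u. (u \<bullet> v) ^ (2 * m) \<partial>\<sigma>))"
proof
  have keys: "Poly_Mapping.keys \<mu> \<subseteq> sphere 0 1"
    using \<mu> by (auto simp: directional_rule_iff)
  have sym: "atomic_integral (antipodal_symmetrization \<mu>) f = atomic_integral \<mu> f"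
    if "\<And>x. x \<in> sphere 0 1 \<Longrightarrow> f (- x) = f x" for f
    unfolding atomic_integral_antipodal_symmetrization using keys that
    by (intro atomic_integral_cong) auto
  {
    assume d: "weighted_projective_design \<sigma> m (antipodal_symmetrization \<mu>)"
    show "\<forall>v\<in>sphere 0 1. atomic_integral \<mu> (\<lambda>u. (u \<bullet> v) ^ (2 * m)) = (\<integral>u. (u \<bullet> v) ^ (2 * m) \<partial>\<sigma>)"
    proof
      fix v :: "real^'n" assume "v \<in> sphere 0 1"
      define f where "f = restrict (\<lambda>x. (x \<bullet> v) ^ (2 * m)) (sphere 0 1)"
      \<comment> \<open>The zero function is homogeneous of every degree, so it can fill the other
        slots.\<close>
      define Q where "Q = (\<lambda>i x. if i = 2 * m then (x \<bullet> v) ^ (2 * m) else 0)"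
      have "real_polynomial_function (Q i)" for i
        by (cases "i = 2 * m") (auto simp: Q_def)
      then have "\<forall>i\<le>2 * m. homogeneous_polynomial i (Q i)"
        by (auto simp: homogeneous_polynomial_def Q_def power_mult_distrib)
      moreover have "f = restrict (\<lambda>x. \<Sum>i\<le>2 * m. Q i x) (sphere 0 1)"
        by (simp add: f_def Q_def)
      ultimately have "f \<in> spherical_polynomials (2 * m)"
        unfolding spherical_polynomials_def by blast
      then have "f \<in> even_spherical_polynomials (2 * m)"
        by (auto simp: even_spherical_polynomials_def f_def)
      then have "atomic_integral (antipodal_symmetrization \<mu>) f = (\<integral>u. f u \<partial>\<sigma>)"
        using d by (auto simp: weighted_projective_design_def)
      moreover have "atomic_integral (antipodal_symmetrization \<mu>) f = atomic_integral \<mu> f"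
        by (rule sym) (auto simp: f_def)
      moreover have "atomic_integral \<mu> f = atomic_integral \<mu> (\<lambda>u. (u \<bullet> v) ^ (2 * m))"
        using keys by (intro atomic_integral_cong) (auto simp: f_def)
      moreover have "(\<integral>u. f u \<partial>\<sigma>) = (\<integral>u. (u \<bullet> v) ^ (2 * m) \<partial>\<sigma>)"
        by (intro Bochner_Integration.integral_cong) (auto simp: f_def space_uniform_sphere)
      ultimately show "atomic_integral \<mu> (\<lambda>u. (u \<bullet> v) ^ (2 * m)) = (\<integral>u. (u \<bullet> v) ^ (2 * m) \<partial>\<sigma>)" by simp
    qed
  next
    assume pow: "\<forall>v\<in>sphere 0 1. atomic_integral \<mu> (\<lambda>u. (u \<bullet> v) ^ (2 * m)) = (\<integral>u. (u \<bullet> v) ^ (2 * m) \<partial>\<sigma>)"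
    have "atomic_integral (antipodal_symmetrization \<mu>) f = (\<integral>u. f u \<partial>\<sigma>)"
      if f: "f \<in> even_spherical_polynomials (2 * m)" for f
    proof -
      obtain Q where Q: "\<And>i. i \<le> 2 * m \<Longrightarrow> homogeneous_polynomial i (Q i)"
        and f_eq: "f = restrict (\<lambda>x. \<Sum>i\<le>2 * m. Q i x) (sphere 0 1)"
        using f by (auto simp: even_spherical_polynomials_def spherical_polynomials_def)
      have f_even: "f (- x) = f x" if "x \<in> sphere 0 1" for x
        using f that by (auto simp: even_spherical_polynomials_def)
      \<comment> \<open>Each even part is raised to degree \<open>2 * m\<close> by powers of
        \<open>x \<bullet> x\<close>. The factor \<open>(x \<bullet> 0) ^ 0\<close> is 1 and only
        gives the term the shape of a zonal product.\<close>
      define P where "P = (\<lambda>x. \<Sum>r\<le>m. (x \<bullet> 0) ^ 0 * (x \<bullet> x) ^ (m - r) * Q (2 * r) x)"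
      have "homogeneous_polynomial (2 * m) P"
        unfolding homogeneous_polynomial_def
      proof (intro conjI allI)
        show "real_polynomial_function P"
          unfolding P_def using Q
          by (intro real_polynomial_function_sum real_polynomial_function.intros(4) real_polynomial_function_zonal)
            (auto simp: homogeneous_polynomial_def)
        fix c x
        have "((c *\<^sub>R x) \<bullet> (c *\<^sub>R x)) ^ (m - r) * Q (2 * r) (c *\<^sub>R x) = c ^ (2 * m) * ((x \<bullet> x) ^ (m - r) * Q (2 * r) x)"
          if "r \<le> m" for r
        proof -
          have "(c * c) ^ (m - r) * c ^ (2 * r) = c ^ (2 * m)"
            using that by (rule power_square_split)
          then show ?thesis
            using Q[of "2 * r"] that by (simp add: homogeneous_polynomial_def power_mult_distrib mult_ac)
        qed
        then show "P (c *\<^sub>R x) = c ^ (2 * m) * P x"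
          unfolding P_def sum_distrib_left by (intro sum.cong) auto
      qed
      then have "atomic_integral \<mu> P = (\<integral>u. P u \<partial>\<sigma>)"
        using homogeneous_quadrature[OF m] pow by blast
      moreover have fP: "f x = P x" if x: "x \<in> sphere 0 1" for x
      proof -
        have xx: "x \<bullet> x = 1" using x by (simp add: dot_square_norm)
        have "Q i (- x) = (-1) ^ i * Q i x" if "i \<le> 2 * m" for i
          using Q[OF that] unfolding homogeneous_polynomial_def by (metis scaleR_minus1_left)
        then have "f (- x) = (\<Sum>i\<le>2 * m. (-1) ^ i * Q i x)"
          using x by (simp add: f_eq)
        moreover have "f x = (\<Sum>i\<le>2 * m. Q i x)" using x by (simp add: f_eq)
        \<comment> \<open>Adding \<open>f x\<close> and \<open>f (- x)\<close> cancels the parts of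
          odd degree.\<close>
        ultimately have "2 * f x = (\<Sum>i\<le>2 * m. (1 + (-1) ^ i) * Q i x)"
          using f_even[OF x] by (simp add: algebra_simps sum.distrib)
        also have "\<dots> = (\<Sum>r\<le>m. 2 * Q (2 * r) x)"
          by (induction m) (auto simp: algebra_simps)
        finally show ?thesis using xx by (simp add: P_def sum_distrib_left[symmetric])
      qed
      moreover have "atomic_integral (antipodal_symmetrization \<mu>) f = atomic_integral \<mu> f"
        by (rule sym) (rule f_even)
      moreover have "atomic_integral \<mu> f = atomic_integral \<mu> P"
        using keys by (intro atomic_integral_cong fP) auto
      moreover have "(\<integral>u. f u \<partial>\<sigma>) = (\<integral>u. P u \<partial>\<sigma>)"
        by (intro Bochner_Integration.integral_cong) (auto simp: fP space_uniform_sphere)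
      ultimately show ?thesis by simp
    qed
    then show "weighted_projective_design \<sigma> m (antipodal_symmetrization \<mu>)"
      unfolding weighted_projective_design_def
      using directional_rule_antipodal_symmetrization[OF \<mu>] by blast
  }
qed

text \<open>For the converse, a harmonic of degree \<open>2 * r\<close> times
  \<open>(x \<bullet> x) ^ (m - r)\<close> is homogeneous of degree \<open>2 * m\<close> and
  unchanged on the sphere, so it is integrated exactly; its mean over the sphere is zero.\<close>

lemma harmonics_quadrature_iff:
  assumes dim: "CARD('n) \<ge> 2" and \<mu>: "directional_rule \<mu>" and m: "m \<ge> 1"
  shows "(\<forall>r\<in>{1..m}. \<forall>Y\<in>spherical_harmonics (2 * r). atomic_integral \<mu> Y = 0) \<longleftrightarrow>
    (\<forall>v\<in>sphere 0 1. atomic_integral \<mu> (\<lambda>u. (u \<bullet> v) ^ (2 * m)) = (\<integral>u. (u \<bullet> v) ^ (2 * m) \<partial>\<sigma>))"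
proof
  assume "\<forall>r\<in>{1..m}. \<forall>Y\<in>spherical_harmonics (2 * r). atomic_integral \<mu> Y = 0"
  then show "\<forall>v\<in>sphere 0 1. atomic_integral \<mu> (\<lambda>u. (u \<bullet> v) ^ (2 * m)) = (\<integral>u. (u \<bullet> v) ^ (2 * m) \<partial>\<sigma>)"
    using power_quadrature_if_harmonics_vanish[OF dim \<mu>, of m _ m] by blast
next
  assume pow: "\<forall>v\<in>sphere 0 1. atomic_integral \<mu> (\<lambda>u. (u \<bullet> v) ^ (2 * m)) = (\<integral>u. (u \<bullet> v) ^ (2 * m) \<partial>\<sigma>)"
  have keys: "Poly_Mapping.keys \<mu> \<subseteq> sphere 0 1"
    using \<mu> by (auto simp: directional_rule_iff)
  show "\<forall>r\<in>{1..m}. \<forall>Y\<in>spherical_harmonics (2 * r). atomic_integral \<mu> Y = 0"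
  proof (intro ballI)
    fix r and Y :: "real^'n \<Rightarrow> real"
    assume r: "r \<in> {1..m}" and Y: "Y \<in> spherical_harmonics (2 * r)"
    obtain P where Y_eq: "Y = restrict P (sphere 0 1)" and hom: "homogeneous_polynomial (2 * r) P"
      and harm: "\<And>x. laplacian P x = 0"
      using Y by (auto simp: spherical_harmonics_def)
    define R where "R = (\<lambda>x. (x \<bullet> 0) ^ 0 * (x \<bullet> x) ^ (m - r) * P x)"
    have "homogeneous_polynomial (2 * m) R"
      unfolding homogeneous_polynomial_def
    proof (intro conjI allI)
      show "real_polynomial_function R"
        unfolding R_def using hom
        by (intro real_polynomial_function.intros(4) real_polynomial_function_zonal)
          (auto simp: homogeneous_polynomial_def)
      fix c :: real and x
      have "(c * c) ^ (m - r) * c ^ (2 * r) = c ^ (2 * m)"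
        by (rule power_square_split) (use r in simp)
      then show "R (c *\<^sub>R x) = c ^ (2 * m) * R x"
        using hom by (simp add: R_def homogeneous_polynomial_def power_mult_distrib mult_ac)
    qed
    then have "atomic_integral \<mu> R = (\<integral>u. R u \<partial>\<sigma>)"
      using homogeneous_quadrature[OF m] pow by blast
    moreover have RP: "R x = P x" if "x \<in> sphere 0 1" for x
      using that by (simp add: R_def dot_square_norm)
    then have "atomic_integral \<mu> R = atomic_integral \<mu> Y"
      using keys by (intro atomic_integral_cong) (auto simp: Y_eq)
    moreover have "(\<integral>u. R u \<partial>\<sigma>) = (\<integral>u. P u \<partial>\<sigma>)"
      using RP by (intro Bochner_Integration.integral_cong) (auto simp: space_uniform_sphere)
    moreover have "(\<integral>u. P u \<partial>\<sigma>) = 0"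
      using r by (intro integral_harmonic_eq_0[OF dim _ hom harm]) auto
    ultimately show "atomic_integral \<mu> Y = 0" by simp
  qed
qed

end

section \<open>Exponents that are not even integers\<close>

text \<open>A Taylor-type expansion at 0 to every order, used in place of smoothness: it passes to
  sums, multiples and suitable compositions by plain estimates, and already excludes
  \<open>\<bar>t\<bar> powr p\<close>.\<close>

definition polynomially_approximable :: "(real \<Rightarrow> real) \<Rightarrow> bool" where
  "polynomially_approximable g \<longleftrightarrow> (\<forall>n::nat. \<exists>q C \<delta>. real_polynomial_function q \<and> \<delta> > 0 \<and>
     (\<forall>t. \<bar>t\<bar> < \<delta> \<longrightarrow> \<bar>g t - q t\<bar> \<le> C * \<bar>t\<bar> ^ n))"

lemma polynomially_approximable_add:
  assumes "polynomially_approximable f" "polynomially_approximable g"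
  shows "polynomially_approximable (\<lambda>t. f t + g t)"
  unfolding polynomially_approximable_def
proof
  fix n
  obtain q C \<delta> where q: "real_polynomial_function q" "\<delta> > 0" "\<And>t. \<bar>t\<bar> < \<delta> \<Longrightarrow> \<bar>f t - q t\<bar> \<le> C * \<bar>t\<bar> ^ n"
    using assms(1) unfolding polynomially_approximable_def by metis
  obtain r D \<epsilon> where r: "real_polynomial_function r" "\<epsilon> > 0" "\<And>t. \<bar>t\<bar> < \<epsilon> \<Longrightarrow> \<bar>g t - r t\<bar> \<le> D * \<bar>t\<bar> ^ n"
    using assms(2) unfolding polynomially_approximable_def by metis
  have "\<bar>f t + g t - (q t + r t)\<bar> \<le> (C + D) * \<bar>t\<bar> ^ n" if "\<bar>t\<bar> < min \<delta> \<epsilon>" for t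
    using q(3)[of t] r(3)[of t] that by (simp add: algebra_simps)
  then show "\<exists>q C \<delta>. real_polynomial_function q \<and> \<delta> > 0 \<and>
     (\<forall>t. \<bar>t\<bar> < \<delta> \<longrightarrow> \<bar>f t + g t - q t\<bar> \<le> C * \<bar>t\<bar> ^ n)"
    using q r by (intro exI[of _ "\<lambda>t. q t + r t"] exI[of _ "C + D"] exI[of _ "min \<delta> \<epsilon>"]) auto
qed

lemma polynomially_approximable_cmult:
  assumes "polynomially_approximable f"
  shows "polynomially_approximable (\<lambda>t. c * f t)"
  unfolding polynomially_approximable_def
proof
  fix n
  obtain q C \<delta> where q: "real_polynomial_function q" "\<delta> > 0" "\<And>t. \<bar>t\<bar> < \<delta> \<Longrightarrow> \<bar>f t - q t\<bar> \<le> C * \<bar>t\<bar> ^ n"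
    using assms unfolding polynomially_approximable_def by metis
  have "\<bar>c * f t - c * q t\<bar> \<le> (\<bar>c\<bar> * C) * \<bar>t\<bar> ^ n" if "\<bar>t\<bar> < \<delta>" for t
    using mult_left_mono[OF q(3)[OF that], of "\<bar>c\<bar>"]
    by (simp add: abs_mult[symmetric] right_diff_distrib mult.assoc)
  then show "\<exists>q C \<delta>. real_polynomial_function q \<and> \<delta> > 0 \<and>
     (\<forall>t. \<bar>t\<bar> < \<delta> \<longrightarrow> \<bar>c * f t - q t\<bar> \<le> C * \<bar>t\<bar> ^ n)"
    using q by (intro exI[of _ "\<lambda>t. c * q t"] exI[of _ "\<bar>c\<bar> * C"] exI[of _ \<delta>]) auto
qed

lemma polynomially_approximable_sum:
  assumes "finite I" "\<And>i. i \<in> I \<Longrightarrow> polynomially_approximable (f i)"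
  shows "polynomially_approximable (\<lambda>t. \<Sum>i\<in>I. f i t)"
  using assms
proof (induction I rule: finite_induct)
  case empty
  have "\<exists>q C \<delta>. real_polynomial_function q \<and> \<delta> > 0 \<and> (\<forall>t. \<bar>t\<bar> < \<delta> \<longrightarrow> \<bar>0 - q t\<bar> \<le> C * \<bar>t\<bar> ^ n)" for n
    by (intro exI[of _ "\<lambda>t. 0"] exI[of _ 0] exI[of _ 1]) auto
  then show ?case by (simp add: polynomially_approximable_def)
next
  case (insert i I)
  then show ?case by (simp add: polynomially_approximable_add)
qed

text \<open>The linear bound on \<open>r\<close> forces \<open>r 0 = 0\<close> and turns an error of
  order \<open>n\<close> in \<open>r t\<close> into one of order \<open>n\<close> in
  \<open>t\<close>.\<close>

lemma polynomially_approximable_compose: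
  assumes g: "polynomially_approximable g" and r: "real_polynomial_function r"
    and L: "\<And>t. \<bar>t\<bar> \<le> 1 \<Longrightarrow> \<bar>r t\<bar> \<le> L * \<bar>t\<bar>"
  shows "polynomially_approximable (\<lambda>t. g (r t))"
  unfolding polynomially_approximable_def
proof
  fix n
  obtain q C \<delta> where q: "real_polynomial_function q" "\<delta> > 0" "\<And>t. \<bar>t\<bar> < \<delta> \<Longrightarrow> \<bar>g t - q t\<bar> \<le> C * \<bar>t\<bar> ^ n"
    using g unfolding polynomially_approximable_def by metis
  have L0: "L \<ge> 0" using L[of 1] by simp
  \<comment> \<open>Division by \<open>L + 1\<close>, since \<open>L\<close> may be 0.\<close>
  define \<epsilon> where "\<epsilon> = min 1 (\<delta> / (L + 1))"
  have \<epsilon>: "\<epsilon> > 0" using q(2) L0 by (simp add: \<epsilon>_def)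
  have "\<bar>g (r t) - q (r t)\<bar> \<le> (\<bar>C\<bar> * L ^ n) * \<bar>t\<bar> ^ n" if t: "\<bar>t\<bar> < \<epsilon>" for t
  proof -
    have t1: "\<bar>t\<bar> \<le> 1" "\<bar>t\<bar> < \<delta> / (L + 1)" using t by (auto simp: \<epsilon>_def)
    have rt: "\<bar>r t\<bar> \<le> L * \<bar>t\<bar>" by (rule L[OF t1(1)])
    also have "\<dots> \<le> (L + 1) * \<bar>t\<bar>" by (intro mult_right_mono) auto
    also have "\<dots> < \<delta>" using t1(2) L0 by (simp add: field_simps)
    finally have "\<bar>g (r t) - q (r t)\<bar> \<le> C * \<bar>r t\<bar> ^ n" by (rule q(3))
    also have "\<dots> \<le> \<bar>C\<bar> * (L * \<bar>t\<bar>) ^ n"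
      using rt by (intro mult_mono power_mono) auto
    finally show ?thesis by (simp add: power_mult_distrib mult_ac)
  qed
  moreover have "real_polynomial_function (\<lambda>t. q (r t))"
    using real_polynomial_function_compose[of r q] q(1) r by (simp add: real_polynomial_function_eq o_def)
  ultimately show "\<exists>q C \<delta>. real_polynomial_function q \<and> \<delta> > 0 \<and>
     (\<forall>t. \<bar>t\<bar> < \<delta> \<longrightarrow> \<bar>g (r t) - q t\<bar> \<le> C * \<bar>t\<bar> ^ n)"
    using \<epsilon> by (intro exI[of _ "\<lambda>t. q (r t)"] exI[of _ "\<bar>C\<bar> * L ^ n"] exI[of _ \<epsilon>]) auto
qed

text \<open>The approximants are partial sums of the binomial series. Taking
  \<open>\<bar>t\<bar> ^ n\<close> out of the remainder leaves a series dominated by its value at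
  1/2.\<close>

lemma polynomially_approximable_one_plus_powr:
  "polynomially_approximable (\<lambda>t. (1 + t) powr a)"
  unfolding polynomially_approximable_def
proof
  fix n
  define b where "b = (\<lambda>k. a gchoose k)"
  have ser: "(\<lambda>k. b k * t ^ k) sums (1 + t) powr a" if "\<bar>t\<bar> < 1" for t
    unfolding b_def using that by (rule gen_binomial_real)
  \<comment> \<open>Convergence at 3/4, inside the unit disc, yields absolute convergence at
    1/2.\<close>
  have "summable (\<lambda>k. norm (b k * (1/2) ^ k))"
    using powser_insidea[of b "3/4" "1/2"] ser[of "3/4"] by (auto simp: sums_iff)
  then have sum2: "summable (\<lambda>k. \<bar>b (k + n)\<bar> * (1/2) ^ (k + n))"
    using summable_ignore_initial_segment[of "\<lambda>k. norm (b k * (1/2) ^ k)" n] by (simp add: abs_mult)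
  define C where "C = suminf (\<lambda>k. \<bar>b (k + n)\<bar> * (1/2) ^ (k + n)) * 2 ^ n"
  have poly: "real_polynomial_function (\<lambda>t. \<Sum>k<n. b k * t ^ k)"
    by (rule real_polynomial_function_sum) (simp, intro real_polynomial_function.intros(2,4)
      real_polynomial_function_power real_polynomial_function.intros(1) bounded_linear_ident)
  have "\<bar>(1 + t) powr a - (\<Sum>k<n. b k * t ^ k)\<bar> \<le> C * \<bar>t\<bar> ^ n" if t: "\<bar>t\<bar> < 1/2" for t
  proof -
    have s: "(\<lambda>k. b (k + n) * t ^ (k + n)) sums ((1 + t) powr a - (\<Sum>k<n. b k * t ^ k))"
      using sums_split_initial_segment[OF ser[of t], of n] t by simp
    have le: "norm (b (k + n) * t ^ (k + n)) \<le> (2 ^ n * \<bar>t\<bar> ^ n) * (\<bar>b (k + n)\<bar> * (1/2) ^ (k + n))" for k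
    proof -
      have "\<bar>t\<bar> ^ k \<le> (1/2) ^ k" using t by (intro power_mono) auto
      then have "\<bar>b (k + n)\<bar> * \<bar>t\<bar> ^ n * \<bar>t\<bar> ^ k \<le> \<bar>b (k + n)\<bar> * \<bar>t\<bar> ^ n * (1/2) ^ k"
        by (intro mult_left_mono) auto
      moreover have "(2::real) ^ n * (1/2) ^ (k + n) = (1/2) ^ k"
        by (simp add: power_add power_divide)
      ultimately show ?thesis
        by (simp add: abs_mult power_abs power_add mult_ac)
    qed
    have "\<bar>suminf (\<lambda>k. b (k + n) * t ^ (k + n))\<bar> \<le> suminf (\<lambda>k. (2 ^ n * \<bar>t\<bar> ^ n) * (\<bar>b (k + n)\<bar> * (1/2) ^ (k + n)))"
      using le sum2 by (intro norm_suminf_le[where 'a = real, unfolded real_norm_def] summable_mult) auto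
    also have "\<dots> = C * \<bar>t\<bar> ^ n"
      by (subst suminf_mult[OF sum2]) (simp add: C_def mult_ac)
    finally show ?thesis using s by (simp add: sums_iff)
  qed
  then show "\<exists>q C \<delta>. real_polynomial_function q \<and> \<delta> > 0 \<and>
     (\<forall>t. \<bar>t\<bar> < \<delta> \<longrightarrow> \<bar>(1 + t) powr a - q t\<bar> \<le> C * \<bar>t\<bar> ^ n)"
    using poly by (intro exI[of _ "\<lambda>t. \<Sum>k<n. b k * t ^ k"] exI[of _ C] exI[of _ "1/2"]) auto
qed

lemma polynomially_approximable_local:
  assumes "polynomially_approximable f" "\<epsilon> > 0" "\<And>t. \<bar>t\<bar> < \<epsilon> \<Longrightarrow> g t = f t"
  shows "polynomially_approximable g"
  unfolding polynomially_approximable_def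
proof
  fix n
  obtain q C \<delta> where q: "real_polynomial_function q" "\<delta> > 0" "\<And>t. \<bar>t\<bar> < \<delta> \<Longrightarrow> \<bar>f t - q t\<bar> \<le> C * \<bar>t\<bar> ^ n"
    using assms(1) unfolding polynomially_approximable_def by metis
  then show "\<exists>q C \<delta>. real_polynomial_function q \<and> \<delta> > 0 \<and> (\<forall>t. \<bar>t\<bar> < \<delta> \<longrightarrow> \<bar>g t - q t\<bar> \<le> C * \<bar>t\<bar> ^ n)"
    using assms by (intro exI[of _ q] exI[of _ C] exI[of _ "min \<delta> \<epsilon>"]) auto
qed

text \<open>Near 0 the inner expression keeps the sign of \<open>\<alpha>\<close>, so the absolute
  value can be factored as \<open>\<bar>\<alpha>\<bar>\<close> times the positive number
  \<open>1 + t * (\<beta> / \<alpha>)\<close>.\<close>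

lemma polynomially_approximable_abs_powr:
  assumes "\<alpha> \<noteq> 0"
  shows "polynomially_approximable (\<lambda>t. \<bar>\<alpha> + t * \<beta>\<bar> powr p)"
proof (rule polynomially_approximable_local)
  have "real_polynomial_function (\<lambda>t. t * (\<beta> / \<alpha>))"
    by (intro real_polynomial_function.intros(1) bounded_linear_mult_left)
  then have "polynomially_approximable (\<lambda>t. (1 + t * (\<beta> / \<alpha>)) powr p)"
    by (intro polynomially_approximable_compose[OF polynomially_approximable_one_plus_powr, where L = "\<bar>\<beta> / \<alpha>\<bar>"])
      (simp_all add: abs_mult mult.commute)
  then show "polynomially_approximable (\<lambda>t. \<bar>\<alpha>\<bar> powr p * (1 + t * (\<beta> / \<alpha>)) powr p)"
    by (rule polynomially_approximable_cmult)
  show "\<bar>\<alpha>\<bar> / (\<bar>\<beta>\<bar> + 1) > 0" using assms by simp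
  fix t assume "\<bar>t\<bar> < \<bar>\<alpha>\<bar> / (\<bar>\<beta>\<bar> + 1)"
  then have "\<bar>t\<bar> * (\<bar>\<beta>\<bar> + 1) < \<bar>\<alpha>\<bar>" by (simp add: pos_less_divide_eq)
  then have "\<bar>t * \<beta>\<bar> < \<bar>\<alpha>\<bar>" by (simp add: abs_mult algebra_simps)
  then have "\<bar>t * (\<beta> / \<alpha>)\<bar> < 1" using assms by (simp add: abs_mult)
  then have pos: "1 + t * (\<beta> / \<alpha>) > 0" by linarith
  have "\<alpha> + t * \<beta> = \<alpha> * (1 + t * (\<beta> / \<alpha>))" using assms by (simp add: field_simps)
  then have "\<bar>\<alpha> + t * \<beta>\<bar> = \<bar>\<alpha>\<bar> * (1 + t * (\<beta> / \<alpha>))" using pos by (simp only: abs_mult abs_of_pos)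
  then show "\<bar>\<alpha> + t * \<beta>\<bar> powr p = \<bar>\<alpha>\<bar> powr p * (1 + t * (\<beta> / \<alpha>)) powr p"
    using pos by (simp only: powr_mult)
qed

text \<open>
  The operator \<open>g \<mapsto> g (2 * t) - 2 powr e * g t\<close> annihilates \<open>t powr e\<close>, multiplies
  \<open>t powr p\<close> by a nonzero constant if \<open>p \<noteq> e\<close>, and preserves the error bound.
\<close>

lemma powr_not_approximable:
  fixes e b :: "'i \<Rightarrow> real"
  assumes "finite I" "\<And>i. i \<in> I \<Longrightarrow> e i \<noteq> p" "p < n" "\<delta> > 0"
    and "\<And>t. 0 < t \<Longrightarrow> t < \<delta> \<Longrightarrow> \<bar>W * t powr p - (\<Sum>i\<in>I. b i * t powr e i)\<bar> \<le> C * t powr n"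
  shows "W = 0"
  using assms
proof (induction I arbitrary: W b C \<delta> rule: finite_induct)
  case empty
  show ?case
  proof (rule ccontr)
    assume W: "W \<noteq> 0"
    have le: "\<bar>W\<bar> \<le> C * t powr (n - p)" if "0 < t" "t < \<delta>" for t
    proof -
      have "(C * t powr (n - p)) * t powr p = C * t powr n"
        by (simp add: mult.assoc powr_add[symmetric])
      then have "\<bar>W\<bar> * t powr p \<le> (C * t powr (n - p)) * t powr p"
        using empty.prems(4)[OF that] by (simp only: sum.empty diff_0_right abs_mult abs_of_nonneg powr_ge_zero)
      then show ?thesis by (rule mult_right_le_imp_le) (use that in simp)
    qed
    have "C > 0"
    proof -
      have "0 < C * (\<delta> / 2) powr (n - p)" using le[of "\<delta> / 2"] W empty.prems(3) by simp
      then show ?thesis by (simp add: zero_less_mult_iff)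
    qed
    \<comment> \<open>Solves \<open>C * s powr (n - p) = \<bar>W\<bar> / 2\<close>, contradicting
      the lower bound \<open>\<bar>W\<bar>\<close> for the left side at small arguments.\<close>
    define s where "s = (\<bar>W\<bar> / (2 * C)) powr (1 / (n - p))"
    define t where "t = min (\<delta> / 2) s"
    have s: "s > 0" "s powr (n - p) = \<bar>W\<bar> / (2 * C)"
      using W \<open>C > 0\<close> \<open>p < n\<close> by (auto simp: s_def powr_powr)
    have t: "0 < t" "t < \<delta>" "t \<le> s" using s empty.prems(3) by (auto simp: t_def)
    have "\<bar>W\<bar> \<le> C * t powr (n - p)" by (rule le[OF t(1,2)])
    also have "\<dots> \<le> C * s powr (n - p)"
      using t \<open>C > 0\<close> \<open>p < n\<close> by (intro mult_left_mono powr_mono2) auto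
    also have "\<dots> = \<bar>W\<bar> / 2" using s \<open>C > 0\<close> by simp
    finally show False using W by simp
  qed
next
  case (insert j I)
  let ?k = "2 powr e j"
  define g where "g = (\<lambda>t. W * t powr p - (\<Sum>i\<in>insert j I. b i * t powr e i))"
  have g: "\<bar>g t\<bar> \<le> C * t powr n" if "0 < t" "t < \<delta>" for t
    unfolding g_def by (rule insert.prems(4)[OF that])
  have "W * (2 powr p - ?k) = 0"
  proof (rule insert.IH)
    \<comment> \<open>The range is halved because the bound on \<open>g\<close> is also used at
      \<open>2 * t\<close>.\<close>
    show "\<delta> / 2 > 0" using insert.prems by simp
    fix t :: real assume t: "0 < t" "t < \<delta> / 2"
    have "W * (2 powr p - ?k) * t powr p - (\<Sum>i\<in>I. b i * (2 powr e i - ?k) * t powr e i)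
        = g (2 * t) - ?k * g t"
      using insert.hyps t
      by (simp add: g_def powr_mult algebra_simps sum.distrib sum_subtractf sum_distrib_left)
    also have "\<bar>\<dots>\<bar> \<le> \<bar>g (2 * t)\<bar> + ?k * \<bar>g t\<bar>"
      using abs_triangle_ineq4[of "g (2 * t)" "?k * g t"] by (simp add: abs_mult)
    also have "\<dots> \<le> C * (2 * t) powr n + ?k * (C * t powr n)"
      using g[of "2 * t"] g[of t] t by (intro add_mono mult_left_mono) auto
    also have "\<dots> = (C * 2 powr n + ?k * C) * t powr n"
      using t by (simp add: powr_mult algebra_simps)
    finally show "\<bar>W * (2 powr p - ?k) * t powr p - (\<Sum>i\<in>I. b i * (2 powr e i - ?k) * t powr e i)\<bar>
        \<le> (C * 2 powr n + ?k * C) * t powr n" .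
  qed (use insert.prems in auto)
  moreover have "2 powr p \<noteq> ?k" using insert.prems(1)[of j] by (auto simp: powr_inj)
  ultimately show ?case by simp
qed

text \<open>Averaging the approximation over \<open>t\<close> and \<open>- t\<close> leaves only
  even powers of the polynomial, none of which has exponent \<open>p\<close>. Without this, an odd
  integer \<open>p\<close> could not be excluded, since \<open>t powr p\<close> is then a monomial
  for positive \<open>t\<close>.\<close>

lemma abs_powr_not_polynomially_approximable:
  assumes g: "polynomially_approximable (\<lambda>t. W * \<bar>t\<bar> powr p)"
    and p: "\<And>k::int. p \<noteq> 2 * of_int k"
  shows "W = 0"
proof -
  obtain n :: nat where n: "p < n" using reals_Archimedean2 by blast
  obtain q C \<delta> where q: "real_polynomial_function q" "\<delta> > 0"
    and approx: "\<And>t. \<bar>t\<bar> < \<delta> \<Longrightarrow> \<bar>W * \<bar>t\<bar> powr p - q t\<bar> \<le> C * \<bar>t\<bar> ^ n"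
    using g unfolding polynomially_approximable_def by metis
  obtain a N where qa: "q = (\<lambda>t. \<Sum>i\<le>N. a i * t ^ i)"
    using q(1) by (auto simp: real_polynomial_function_iff_sum)
  define I where "I = {i. i \<le> N \<and> even i}"
  show ?thesis
  proof (rule powr_not_approximable[of I real p "real n" \<delta> W a C])
    show "finite I" by (simp add: I_def)
    show "real i \<noteq> p" if "i \<in> I" for i
    proof -
      have "even i" using that by (simp add: I_def)
      then obtain k where "i = 2 * k" by (rule evenE)
      then show ?thesis using p[of "int k"] by auto
    qed
    fix t :: real assume t: "0 < t" "t < \<delta>"
    have "q t + q (- t) = (\<Sum>i\<le>N. a i * (t ^ i + (- t) ^ i))"
      by (simp add: qa sum.distrib[symmetric] algebra_simps)
    also have "\<dots> = (\<Sum>i\<le>N. if even i then 2 * (a i * t ^ i) else 0)"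
      by (intro sum.cong) auto
    also have "\<dots> = (\<Sum>i\<in>I. 2 * (a i * t ^ i))"
      unfolding I_def by (subst sum.inter_filter[symmetric]) auto
    also have "\<dots> = 2 * (\<Sum>i\<in>I. a i * t powr real i)"
      using t by (simp add: sum_distrib_left powr_realpow)
    finally have "2 * (W * t powr p - (\<Sum>i\<in>I. a i * t powr real i))
        = (W * \<bar>t\<bar> powr p - q t) + (W * \<bar>- t\<bar> powr p - q (- t))"
      using t by simp
    also have "\<bar>\<dots>\<bar> \<le> C * \<bar>t\<bar> ^ n + C * \<bar>- t\<bar> ^ n"
      using approx[of t] approx[of "- t"] t by (intro order_trans[OF abs_triangle_ineq] add_mono) auto
    finally show "\<bar>W * t powr p - (\<Sum>i\<in>I. a i * t powr real i)\<bar> \<le> C * t powr real n"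
      using t by (simp add: powr_realpow abs_mult)
  qed (use n q in auto)
qed

text \<open>A vector that works for \<open>Y\<close> is perturbed along the new vector
  \<open>z\<close>; each condition excludes only one size of the perturbation.\<close>

lemma avoid_orthogonal_hyperplanes:
  fixes a :: "'a::real_inner"
  assumes "finite Y" "\<And>y. y \<in> Y \<Longrightarrow> y \<noteq> 0 \<and> y \<bullet> a = 0"
  shows "\<exists>v. v \<bullet> a = 0 \<and> (\<forall>y\<in>Y. v \<bullet> y \<noteq> 0)"
  using assms
proof (induction Y rule: finite_induct)
  case empty
  then show ?case by (intro exI[of _ 0]) simp
next
  case (insert z Y)
  then obtain v where v: "v \<bullet> a = 0" "\<And>y. y \<in> Y \<Longrightarrow> v \<bullet> y \<noteq> 0" by auto
  have zz: "z \<bullet> z \<noteq> 0" "z \<bullet> a = 0" using insert.prems by auto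
  \<comment> \<open>Where \<open>z \<bullet> y = 0\<close> the quotient is 0 by convention. Such
    \<open>y\<close> differ from \<open>z\<close> and are unaffected by the perturbation.\<close>
  define bad where "bad = (\<lambda>y. - (v \<bullet> y) / (z \<bullet> y)) ` insert z Y"
  have "finite bad" using insert.hyps by (simp add: bad_def)
  then obtain s where s: "s \<notin> bad" "s \<noteq> 0"
    using ex_new_if_finite[of "insert 0 bad"] by (metis finite_insert infinite_UNIV_char_0 insertCI)
  have "(v + s *\<^sub>R z) \<bullet> y \<noteq> 0" if y: "y \<in> insert z Y" for y
  proof (cases "z \<bullet> y = 0")
    case True
    then have "y \<in> Y" using y zz by auto
    then show ?thesis using v(2) True by (simp add: inner_add_left)
  next
    case False
    have "s \<noteq> - (v \<bullet> y) / (z \<bullet> y)" using s y by (auto simp: bad_def)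
    then show ?thesis using False by (auto simp: inner_add_left field_simps add_eq_0_iff)
  qed
  moreover have "(v + s *\<^sub>R z) \<bullet> a = 0" using v(1) zz by (simp add: inner_add_left)
  ultimately show ?case by blast
qed

text \<open>
  Some axis \<open>x\<close> carries a nonzero total weight. Along a line through a unit vector orthogonal to \<open>x\<close>
  but to no other axis, all other terms are smooth, while \<open>x\<close> contributes a multiple of \<open>\<bar>t\<bar> powr p\<close>.
\<close>

lemma no_constant_power_sum:
  fixes \<mu> :: "(real^'n) atomic_measure"
  assumes dim: "CARD('n) \<ge> 2" and \<mu>: "directional_rule \<mu>"
    and p: "p > 0" "\<And>k::int. p \<noteq> 2 * of_int k"
    and const: "\<And>v. v \<in> sphere 0 1 \<Longrightarrow> atomic_integral \<mu> (\<lambda>u. \<bar>u \<bullet> v\<bar> powr p) = c"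
  shows False
proof -
  let ?w = "Poly_Mapping.lookup \<mu>"
  \<comment> \<open>The support is closed under negation because the kernel sees only axes: the
    weights at \<open>x\<close> and \<open>- x\<close> add up.\<close>
  define S where "S = Poly_Mapping.keys \<mu> \<union> uminus ` Poly_Mapping.keys \<mu>"
  have keys: "Poly_Mapping.keys \<mu> \<subseteq> sphere 0 1" and one: "atomic_integral \<mu> (\<lambda>_. 1) = 1"
    using \<mu> by (auto simp: directional_rule_iff)
  have finS: "finite S" and S: "S \<subseteq> sphere 0 1"
    using keys by (auto simp: S_def)
  have symS: "uminus ` S = S"
    by (simp add: S_def image_Un image_image Un_commute)
  have A: "atomic_integral \<mu> f = (\<Sum>x\<in>S. ?w x * f x)" for f
    by (rule atomic_integral_superset) (auto simp: S_def)
  \<comment> \<open>Summed over \<open>S\<close> these axis weights give twice the total mass 1, so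
    they cannot all vanish.\<close>
  have "\<exists>x\<in>S. ?w x + ?w (- x) \<noteq> 0"
  proof (rule ccontr)
    assume "\<not> ?thesis"
    then have "(\<Sum>x\<in>S. ?w x + ?w (- x)) = 0" by simp
    moreover have "(\<Sum>x\<in>S. ?w (- x)) = (\<Sum>x\<in>uminus ` S. ?w x)"
      by (subst sum.reindex) auto
    ultimately show False using one A[of "\<lambda>_. 1"] by (simp add: sum.distrib symS)
  qed
  then obtain x where x: "x \<in> S" and W: "?w x + ?w (- x) \<noteq> 0" by blast
  have nx: "norm x = 1" using subsetD[OF S x] by simp
  then have xx: "x \<bullet> x = 1" by (simp add: dot_square_norm)
  have "x \<noteq> 0" using nx by auto
  then have "x \<noteq> - x" by (auto simp: vec_eq_iff)
  have "- x \<in> S" using x symS by blast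
  define S' where "S' = S - {x, - x}"
  \<comment> \<open>Projection onto the hyperplane orthogonal to \<open>x\<close>; it is nonzero on
    unit vectors off the axis of \<open>x\<close>.\<close>
  define h where "h = (\<lambda>y. y - (y \<bullet> x) *\<^sub>R x)"
  \<comment> \<open>Including \<open>z\<close> among the vectors to avoid ensures
    \<open>v' \<noteq> 0\<close> even when \<open>S'\<close> is empty; such a \<open>z\<close>
    exists because the dimension is at least 2.\<close>
  obtain z where z: "z \<noteq> 0" "orthogonal x z"
    using orthogonal_to_vector_exists[of x] dim by auto
  have "y \<noteq> 0 \<and> y \<bullet> x = 0" if "y \<in> insert z (h ` S')" for y
  proof -
    have "h y \<noteq> 0 \<and> h y \<bullet> x = 0" if y: "y \<in> S'" for y
    proof -
      have "y = x \<or> y = - x" if "h y = 0"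
      proof -
        have eq: "y = (y \<bullet> x) *\<^sub>R x" using that by (simp add: h_def)
        have "norm y = 1" using y S by (auto simp: S'_def)
        then have "\<bar>y \<bullet> x\<bar> = 1" using nx by (metis eq norm_scaleR mult.right_neutral)
        then have "y \<bullet> x = 1 \<or> y \<bullet> x = -1" by linarith
        then show ?thesis using eq by (metis scaleR_minus1_left scaleR_one)
      qed
      then show ?thesis using y by (auto simp: S'_def) (simp add: h_def inner_diff_left xx)
    qed
    then show ?thesis using that z by (auto simp: orthogonal_def inner_commute)
  qed
  then obtain v' where v': "v' \<bullet> x = 0" "\<And>y. y \<in> insert z (h ` S') \<Longrightarrow> v' \<bullet> y \<noteq> 0"
    using avoid_orthogonal_hyperplanes[of "insert z (h ` S')" x] finS by (auto simp: S'_def)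
  have "v' \<noteq> 0" using v'(2)[of z] by auto
  define v where "v = v' /\<^sub>R norm v'"
  have v: "norm v = 1" "v \<bullet> x = 0" using \<open>v' \<noteq> 0\<close> v'(1) by (simp_all add: v_def)
  have vy: "y \<bullet> v \<noteq> 0" if "y \<in> S'" for y
  proof -
    have "v' \<bullet> y = v' \<bullet> h y" using v'(1) by (simp add: h_def inner_diff_right)
    then show ?thesis using v'(2)[of "h y"] that \<open>v' \<noteq> 0\<close> by (auto simp: v_def inner_commute)
  qed
  \<comment> \<open>The constant identity on the sphere, extended p-homogeneously to
    \<open>v + t *\<^sub>R x\<close>, whose squared norm is \<open>1 + t\<^sup>2\<close>. The two
    points on the axis of \<open>x\<close> contribute the term in
    \<open>\<bar>t\<bar> powr p\<close>.\<close>
  have line: "c * (1 + t\<^sup>2) powr (p / 2) = (?w x + ?w (- x)) * \<bar>t\<bar> powr p + (\<Sum>y\<in>S'. ?w y * \<bar>y \<bullet> v + t * (y \<bullet> x)\<bar> powr p)" for t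
  proof -
    define u where "u = v + t *\<^sub>R x"
    have "u \<bullet> u = v \<bullet> v + 2 * t * (v \<bullet> x) + t * t * (x \<bullet> x)"
      unfolding u_def by (simp add: inner_add_left inner_add_right inner_commute algebra_simps)
    moreover have "v \<bullet> v = 1" using v(1) by (simp add: dot_square_norm)
    ultimately have nu: "(norm u)\<^sup>2 = 1 + t\<^sup>2"
      by (simp only: power2_norm_eq_inner v(2) xx) (simp add: power2_eq_square)
    have "(norm u)\<^sup>2 > 0" unfolding nu by (simp add: add_pos_nonneg)
    then have pos: "norm u > 0" by simp
    have "norm u powr p = ((norm u)\<^sup>2) powr (p / 2)"
      using pos by (simp add: powr_powr flip: powr_numeral)
    then have np: "norm u powr p = (1 + t\<^sup>2) powr (p / 2)" by (simp add: nu)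
    have "c = atomic_integral \<mu> (\<lambda>y. \<bar>y \<bullet> (u /\<^sub>R norm u)\<bar> powr p)"
      using pos by (intro const[symmetric]) simp
    then have "c * norm u powr p = atomic_integral \<mu> (\<lambda>y. norm u powr p * \<bar>y \<bullet> (u /\<^sub>R norm u)\<bar> powr p)"
      by (simp only: atomic_integral_cmult mult.commute)
    also have "(\<lambda>y. norm u powr p * \<bar>y \<bullet> (u /\<^sub>R norm u)\<bar> powr p) = (\<lambda>y. \<bar>y \<bullet> u\<bar> powr p)"
      using pos by (auto simp: fun_eq_iff powr_mult[symmetric] abs_mult mult.assoc[symmetric])
    also have "atomic_integral \<mu> (\<lambda>y. \<bar>y \<bullet> u\<bar> powr p) = (\<Sum>y\<in>S'. ?w y * \<bar>y \<bullet> u\<bar> powr p) + (\<Sum>y\<in>{x, - x}. ?w y * \<bar>y \<bullet> u\<bar> powr p)"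
      unfolding A S'_def using finS x \<open>- x \<in> S\<close> by (intro sum.subset_diff) auto
    also have "(\<Sum>y\<in>{x, - x}. ?w y * \<bar>y \<bullet> u\<bar> powr p) = (?w x + ?w (- x)) * \<bar>t\<bar> powr p"
      using \<open>x \<noteq> - x\<close> v xx by (simp add: u_def inner_add_right inner_commute algebra_simps)
    finally show ?thesis unfolding np by (simp add: u_def inner_add_right)
  qed
  have "polynomially_approximable (\<lambda>t. (1 + t\<^sup>2) powr (p / 2))"
  proof (rule polynomially_approximable_compose[OF polynomially_approximable_one_plus_powr, where L = 1])
    show "real_polynomial_function (\<lambda>t::real. t\<^sup>2)"
      by (intro real_polynomial_function_power real_polynomial_function.intros(1) bounded_linear_ident)
    show "\<bar>t\<^sup>2\<bar> \<le> 1 * \<bar>t\<bar>" if "\<bar>t\<bar> \<le> 1" for t :: real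
      using mult_left_le[OF that, of "\<bar>t\<bar>"] by (simp add: power2_eq_square abs_mult)
  qed
  then have "polynomially_approximable (\<lambda>t. c * (1 + t\<^sup>2) powr (p / 2))"
    by (rule polynomially_approximable_cmult)
  moreover have "polynomially_approximable (\<lambda>t. \<Sum>y\<in>S'. - ?w y * \<bar>y \<bullet> v + t * (y \<bullet> x)\<bar> powr p)"
    using finS vy by (intro polynomially_approximable_sum polynomially_approximable_cmult polynomially_approximable_abs_powr)
      (auto simp: S'_def)
  ultimately have "polynomially_approximable (\<lambda>t. c * (1 + t\<^sup>2) powr (p / 2) + (\<Sum>y\<in>S'. - ?w y * \<bar>y \<bullet> v + t * (y \<bullet> x)\<bar> powr p))"
    by (rule polynomially_approximable_add)
  also have "(\<lambda>t. c * (1 + t\<^sup>2) powr (p / 2) + (\<Sum>y\<in>S'. - ?w y * \<bar>y \<bullet> v + t * (y \<bullet> x)\<bar> powr p))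
      = (\<lambda>t. (?w x + ?w (- x)) * \<bar>t\<bar> powr p)"
    unfolding line by (simp add: sum_negf)
  finally show False
    using abs_powr_not_polynomially_approximable W p(2) by blast
qed

theorem theorem4p3:
  fixes \<sigma> :: "(real^'n) measure"
  assumes "CARD('n) \<ge> 2"
    and "uniform_sphere_measure \<sigma>"
  shows "(\<forall>(m::nat)\<ge>1. \<forall>\<mu>. directional_rule \<mu> \<longrightarrow>
            ((\<forall>K. convex_body K \<longrightarrow>
                atomic_integral \<mu> (B_body (real (2 * m)) K) = (\<integral>u. B_body (real (2 * m)) K u \<partial>\<sigma>))
             \<longleftrightarrow> (\<forall>r\<in>{1..m}. \<forall>Y\<in>spherical_harmonics (2 * r). atomic_integral \<mu> Y = 0)) \<and>
            ((\<forall>K. convex_body K \<longrightarrow>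
                atomic_integral \<mu> (B_body (real (2 * m)) K) = (\<integral>u. B_body (real (2 * m)) K u \<partial>\<sigma>))
             \<longleftrightarrow> weighted_projective_design \<sigma> m (antipodal_symmetrization \<mu>)))
       \<and> (\<forall>(p::real)>0. (\<forall>k::int. p \<noteq> 2 * of_int k) \<longrightarrow>
            \<not> (\<exists>\<mu>. directional_rule \<mu> \<and>
                (\<forall>K. convex_body K \<longrightarrow>
                   atomic_integral \<mu> (B_body p K) = (\<integral>u. B_body p K u \<partial>\<sigma>))))"
proof (intro conjI allI impI notI)
  fix m :: nat and \<mu> :: "(real^'n) atomic_measure"
  assume m: "m \<ge> 1" and \<mu>: "directional_rule \<mu>"
  have keys: "Poly_Mapping.keys \<mu> \<subseteq> sphere 0 1" using \<mu> by (simp add: directional_rule_iff)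
  have "real (2 * m) > 0" using m by simp
  from body_quadrature_iff[OF assms(2,1) this keys]
  have iff: "(\<forall>K. convex_body K \<longrightarrow> atomic_integral \<mu> (B_body (real (2 * m)) K) = (\<integral>u. B_body (real (2 * m)) K u \<partial>\<sigma>))
    \<longleftrightarrow> (\<forall>v\<in>sphere 0 1. atomic_integral \<mu> (\<lambda>u. (u \<bullet> v) ^ (2 * m)) = (\<integral>u. (u \<bullet> v) ^ (2 * m) \<partial>\<sigma>))"
    by (simp only: abs_powr_even[OF m])
  show "(\<forall>K. convex_body K \<longrightarrow> atomic_integral \<mu> (B_body (real (2 * m)) K) = (\<integral>u. B_body (real (2 * m)) K u \<partial>\<sigma>))
    \<longleftrightarrow> (\<forall>r\<in>{1..m}. \<forall>Y\<in>spherical_harmonics (2 * r). atomic_integral \<mu> Y = 0)"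
    unfolding iff harmonics_quadrature_iff[OF assms(2,1) \<mu> m] ..
  show "(\<forall>K. convex_body K \<longrightarrow> atomic_integral \<mu> (B_body (real (2 * m)) K) = (\<integral>u. B_body (real (2 * m)) K u \<partial>\<sigma>))
    \<longleftrightarrow> weighted_projective_design \<sigma> m (antipodal_symmetrization \<mu>)"
    unfolding iff design_quadrature_iff[OF assms(2) \<mu> m] ..
next
  fix p :: real
  assume p: "p > 0" "\<forall>k::int. p \<noteq> 2 * of_int k"
    and "\<exists>\<mu>. directional_rule \<mu> \<and> (\<forall>K. convex_body K \<longrightarrow> atomic_integral \<mu> (B_body p K) = (\<integral>u. B_body p K u \<partial>\<sigma>))"
  then obtain \<mu> where \<mu>: "directional_rule \<mu>"
    and "\<forall>K. convex_body K \<longrightarrow> atomic_integral \<mu> (B_body p K) = (\<integral>u. B_body p K u \<partial>\<sigma>)" by blast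
  then have quad: "\<forall>v\<in>sphere 0 1. atomic_integral \<mu> (\<lambda>u. \<bar>u \<bullet> v\<bar> powr p) = (\<integral>u. \<bar>u \<bullet> v\<bar> powr p \<partial>\<sigma>)"
    using body_quadrature_iff[OF assms(2,1) p(1)] by (auto simp: directional_rule_iff)
  obtain i :: 'n where True by simp
  have eq: "(\<integral>u. \<bar>u \<bullet> v\<bar> powr p \<partial>\<sigma>) = (\<integral>u. \<bar>u \<bullet> axis i 1\<bar> powr p \<partial>\<sigma>)" if "v \<in> sphere 0 1" for v
    using that p(1)
    by (intro integral_uniform_sphere_zonal[OF assms(2,1), of "\<lambda>s. \<bar>s\<bar> powr p"] continuous_on_powr' continuous_intros) auto
  show False
  proof (rule no_constant_power_sum[OF assms(1) \<mu> p(1)])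
    show "atomic_integral \<mu> (\<lambda>u. \<bar>u \<bullet> v\<bar> powr p) = (\<integral>u. \<bar>u \<bullet> axis i 1\<bar> powr p \<partial>\<sigma>)"
      if "v \<in> sphere 0 1" for v
      using bspec[OF quad that] eq[OF that] by (rule trans)
  qed (use p(2) in blast)
qed

end
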